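(* Let $n\ge1$, let $\mathcal A_1,\dots,\mathcal A_n$ be precontextual categories and $\sigma\in S_n$. Then there is a natural isomorphism $$\mathrm{Hom}(\mathcal A_{\sigma1},\dots,\mathcal A_{\sigma n};-)\cong\mathrm{Hom}(\mathcal A_1,\dots,\mathcal A_n;-)$$ between functors $\mathrm{Cont}\to\mathrm{Set}$ whose $\mathcal C$-component sends a multimorphism $F:\mathcal A_{\sigma1}\times\cdots\times\mathcal A_{\sigma n}\to\mathcal C$ to the unique multimorphism $F':\mathcal A_1\times\cdots\times\mathcal A_n\to\mathcal C$ that fits into a shuffling diagram $(F,F',\phi)$. Moreover, this isomorphism is natural in $\mathcal A_1,\dots,\mathcal A_n$: for precontextual categories $\mathcal A'_1,\dots,\mathcal A'_n$ and morphisms $U_i:\mathcal A'_i\to\mathcal A_i$ ($1\le i\le n$), the square formed by the bijections $\mathrm{Hom}(\mathcal A_{\sigma1},\dots,\mathcal A_{\sigma n};\mathcal C)\cong\mathrm{Hom}(\mathcal A_1,\dots,\mathcal A_n;\mathcal C)$ and $\mathrm{Hom}(\mathcal A'_{\sigma1},\dots,\mathcal A'_{\sigma n};\mathcal C)\cong\mathrm{Hom}(\mathcal A'_1,\dots,\mathcal A'_n;\mathcal C)$ and the precomposition maps $-\circ(U_{\sigma1}\times\cdots\times U_{\sigma n})$ and $-\circ(U_1\times\cdots\times U_n)$ commutes.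
   Context: A precontextual category $\mathcal C$ consists of: a category $|\mathcal C|$ (with a set of objects); a length function $\ell$ from objects to $\mathbb N$; a function $\partial$ from objects to objects with $\ell(\partial a)=\ell(a)-1$ if $\ell(a)\ge 1$ and $\partial a=a$ if $\ell(a)=0$; for each object $a$ with $\ell(a)\ge1$ a morphism $\mathbf p_a:a\to\partial a$; and a set $\mathbf Q$ of commutative squares in $|\mathcal C|$ having left side some $\mathbf p_a$ and right side some $\mathbf p_b$. A display map (written $\twoheadrightarrow$) is a finite, possibly empty, composite of maps $\mathbf p_a$; its length is $\ell(\text{domain})-\ell(\text{codomain})$. A distinguished square is a finite vertical composite of elements of $\mathbf Q$; length-1 distinguished squares are the elements of $\mathbf Q$. $\mathcal C$ is a contextual category if moreover: there is a unique object $1_{\mathcal C}$ of length $0$, and it is terminal; every element of $\mathbf Q$ is a pullback; $\mathbf Q$ contains the identity square of every $\mathbf p_a$ and is closed under horizontal composition; for every $a$ with $\ell(a)\ge 1$ and $f:b\to\partial a$ there is a unique element of $\mathbf Q$ with right side $\mathbf p_a$ and bottom $f$. A morphism (contextual functor) is a functor strictly preserving $\ell,\partial,\mathbf p$ and sending $\mathbf Q$ into $\mathbf Q$. $\mathrm{Cont}$ is the category of small contextual categories and contextual functors. Cellular diagrams. A sieve in a poset is a downward closed subset; $x^{\le}=\{y: y\le x\}$, $\partial x=\{y:y<x\}$. For a finite poset $(P,\le)$ with a linear order $\vartriangleleft$ refining $\le$, a functor $F:(P,\le)^{op}\to|\mathcal C|$ ($\mathcal C$ contextual) is cellular if one can choose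 for each sieve $X$ a limit cone $a^X\Rightarrow F|_X$ such that: $a^\varnothing=1_{\mathcal C}$; $a^{x^\le}=F(x)$ with cone given by $F$; if $X\subset Y$ are sieves with $Y\setminus X=\{y\}$ and $x\vartriangleleft y$ for all $x\in X$, then $a^Y\to a^X$ is a length-1 display map; if $X\subset X'$, $Y\subset Y'$, $X\subset Y$, $X'\subset Y'$ are sieves with $Y\setminus X=\{y\}=Y'\setminus X'$ and $x\vartriangleleft y$ for all $x\in X'$, then the induced square with top $a^{Y'}\to a^Y$ and bottom $a^{X'}\to a^X$ is distinguished. Such a choice is unique, and $F[X]:=a^X$. For a poset $P$ with all $x^\le$ finite, a local linearization is a relation $\vartriangleleft$, contained in the set of pairs having a common upper bound, that restricts on each $x^{\le}$ to a linear order refining $\le$; $F:P^{op}\to|\mathcal C|$ is cellular if each restriction to $(x^\le)^{op}$ is; for a sieve $X$ contained in some $x^\le$, $F[X]$ is the object $a^X$ for the restriction to $x^\le$. Multimorphisms. For $\mathcal A$ precontextual, $T(\mathcal A)$ is the poset of objects of length $\ge1$, with $x\le y$ iff there is a display map $y\twoheadrightarrow x$; thus $T(\mathcal A)^{op}$ maps to $|\mathcal A|$ via display maps. The product poset $T(\mathcal A_1)\times\cdots\times T(\mathcal A_n)$ carries the lexicographic local linearization: $(x_i)\blacktriangleleft(y_i)$ iff $(x_i)=(y_i)$, or for some $i$: $x_j=y_j$ for $j<i$, $x_i<y_i$, and $x_j,y_j$ comparable for $j>i$. A multimorphism from $(\mathcal A_1,\dots,\mathcal A_n)$ to a contextual category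 $\mathcal C$ is a functor $F:|\mathcal A_1|\times\cdots\times|\mathcal A_n|\to|\mathcal C|$ such that: $F(x_1,\dots,x_n)=1_{\mathcal C}$ whenever some $\ell(x_i)=0$; its restriction to $(T(\mathcal A_1)\times\cdots\times T(\mathcal A_n))^{op}$ is cellular for $\blacktriangleleft$; and for all length-1 distinguished squares $Q_i$ in $\mathcal A_i$ with top $f_i^0:x_i^0\to y_i^0$, bottom $f_i^1:x_i^1=\partial x_i^0\to y_i^1=\partial y_i^0$, the square with top $F(f^0_1,\dots,f^0_n)$, vertical sides the length-1 display maps $F(x^0_1,\dots,x^0_n)\to F[\partial(x^0_1,\dots,x^0_n)]$ and $F(y^0_1,\dots,y^0_n)\to F[\partial(y^0_1,\dots,y^0_n)]$, and bottom the map of limits induced by the maps $F(f_1^{\chi_I(1)},\dots,f_n^{\chi_I(n)})$, is distinguished; here $F[\partial(x^0_1,\dots,x_n^0)]$ is the limit over nonempty $I\subset\{1,\dots,n\}$ (ordered oppositely to inclusion) of $F(x_1^{\chi_I(1)},\dots,x_n^{\chi_I(n)})$, with $\chi_I$ the characteristic function of $I$. $\mathrm{Hom}(\mathcal A_1,\dots,\mathcal A_n;\mathcal C)$ is the set of multimorphisms. Shuffling diagrams. Let $\underline\sigma:|\mathcal A_1|\times\cdots\times|\mathcal A_n|\to|\mathcal A_{\sigma1}|\times\cdots\times|\mathcal A_{\sigma n}|$, $(a_1,\dots,a_n)\mapsto(a_{\sigma1},\dots,a_{\sigma n})$. A shuffling diagram is a triple $(F,F',\phi)$ with $F:\mathcal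 A_{\sigma1}\times\cdots\times\mathcal A_{\sigma n}\to\mathcal C$ and $F':\mathcal A_1\times\cdots\times\mathcal A_n\to\mathcal C$ multimorphisms (each for the lexicographic local linearization of its own source) and $\phi:F'\Rightarrow F\circ\underline\sigma$ a natural isomorphism such that for all $(a_1,\dots,a_n)$ (with entries of length $\ge 1$) the square with top $\phi_{a_1,\dots,a_n}:F'(a_1,\dots,a_n)\to F(a_{\sigma1},\dots,a_{\sigma n})$, vertical sides the display maps to $F'[\partial(a_1,\dots,a_n)]$ and $F[\partial(a_{\sigma1},\dots,a_{\sigma n})]$, and bottom the map of limits induced by $\phi$, is distinguished. For each $F$ there is a unique such $(F',\phi)$. *)

theory Defs
  imports "HOL-Library.FuncSet" "HOL-Combinatorics.Permutations"
begin

text \<open>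
  A category is given by a set of objects and a set of arrows inside two ambient types;
  \<open>Cmp C g f\<close> is the composite \<open>g \<circ> f\<close>.
\<close>

record ('o, 'm) cat =
  Obj :: "'o set"
  Arr :: "'m set"
  Src :: "'m \<Rightarrow> 'o"
  Trg :: "'m \<Rightarrow> 'o"
  Idn :: "'o \<Rightarrow> 'm"
  Cmp :: "'m \<Rightarrow> 'm \<Rightarrow> 'm"

definition hom :: "('o, 'm, 'z) cat_scheme \<Rightarrow> 'o \<Rightarrow> 'o \<Rightarrow> 'm set" where
  "hom C a b = {f \<in> Arr C. Src C f = a \<and> Trg C f = b}"

definition category :: "('o, 'm, 'z) cat_scheme \<Rightarrow> bool" where
  "category C \<longleftrightarrow>
     (\<forall>f\<in>Arr C. Src C f \<in> Obj C \<and> Trg C f \<in> Obj C) \<and>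
     (\<forall>a\<in>Obj C. Idn C a \<in> hom C a a) \<and>
     (\<forall>f\<in>Arr C. \<forall>g\<in>Arr C. Src C g = Trg C f \<longrightarrow> Cmp C g f \<in> hom C (Src C f) (Trg C g)) \<and>
     (\<forall>f\<in>Arr C. Cmp C f (Idn C (Src C f)) = f \<and> Cmp C (Idn C (Trg C f)) f = f) \<and>
     (\<forall>f\<in>Arr C. \<forall>g\<in>Arr C. \<forall>h\<in>Arr C. Src C g = Trg C f \<and> Src C h = Trg C g \<longrightarrow>
        Cmp C h (Cmp C g f) = Cmp C (Cmp C h g) f)"

definition iso_arr :: "('o, 'm, 'z) cat_scheme \<Rightarrow> 'm \<Rightarrow> bool" where
  "iso_arr C f \<longleftrightarrow> f \<in> Arr C \<and>
     (\<exists>g\<in>hom C (Trg C f) (Src C f). Cmp C g f = Idn C (Src C f) \<and> Cmp C f g = Idn C (Trg C f))"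

definition terminal :: "('o, 'm, 'z) cat_scheme \<Rightarrow> 'o \<Rightarrow> bool" where
  "terminal C t \<longleftrightarrow> t \<in> Obj C \<and> (\<forall>a\<in>Obj C. \<exists>!f. f \<in> hom C a t)"

record ('o, 'm, 'p, 'q) ftr =
  fob :: "'o \<Rightarrow> 'p"
  far :: "'m \<Rightarrow> 'q"

definition is_functor ::
    "('o, 'm, 'y) cat_scheme \<Rightarrow> ('p, 'q, 'z) cat_scheme \<Rightarrow> ('o, 'm, 'p, 'q) ftr \<Rightarrow> bool" where
  "is_functor A B F \<longleftrightarrow>
     (\<forall>a\<in>Obj A. fob F a \<in> Obj B) \<and>
     (\<forall>f\<in>Arr A. far F f \<in> hom B (fob F (Src A f)) (fob F (Trg A f))) \<and>
     (\<forall>a\<in>Obj A. far F (Idn A a) = Idn B (fob F a)) \<and>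
     (\<forall>f\<in>Arr A. \<forall>g\<in>Arr A. Src A g = Trg A f \<longrightarrow> far F (Cmp A g f) = Cmp B (far F g) (far F f))"

text \<open>
  Functors that are compared for equality are required to be \<open>undefined\<close> off their domain.
\<close>

definition ext_ftr :: "('o, 'm, 'y) cat_scheme \<Rightarrow> ('o, 'm, 'p, 'q) ftr \<Rightarrow> bool" where
  "ext_ftr A F \<longleftrightarrow> fob F \<in> extensional (Obj A) \<and> far F \<in> extensional (Arr A)"

definition comp_ftr ::
    "('o, 'm, 'y) cat_scheme \<Rightarrow> ('p, 'q, 'r, 's) ftr \<Rightarrow> ('o, 'm, 'p, 'q) ftr \<Rightarrow> ('o, 'm, 'r, 's) ftr" where
  "comp_ftr A G F =
     \<lparr>fob = \<lambda>a\<in>Obj A. fob G (fob F a), far = \<lambda>f\<in>Arr A. far G (far F f)\<rparr>"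

text \<open>A family indexed by \<open>{1..n}\<close> is an element of \<open>PiE {1..n} _\<close>.\<close>

definition prod_cat :: "nat \<Rightarrow> (nat \<Rightarrow> ('o, 'm, 'z) cat_scheme) \<Rightarrow> (nat \<Rightarrow> 'o, nat \<Rightarrow> 'm) cat" where
  "prod_cat n A =
     \<lparr>Obj = (\<Pi>\<^sub>E i\<in>{1..n}. Obj (A i)),
      Arr = (\<Pi>\<^sub>E i\<in>{1..n}. Arr (A i)),
      Src = (\<lambda>f. \<lambda>i\<in>{1..n}. Src (A i) (f i)),
      Trg = (\<lambda>f. \<lambda>i\<in>{1..n}. Trg (A i) (f i)),
      Idn = (\<lambda>a. \<lambda>i\<in>{1..n}. Idn (A i) (a i)),
      Cmp = (\<lambda>g f. \<lambda>i\<in>{1..n}. Cmp (A i) (g i) (f i))\<rparr>"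

definition prod_ftr ::
    "nat \<Rightarrow> (nat \<Rightarrow> ('o, 'm, 'p, 'q) ftr) \<Rightarrow> (nat \<Rightarrow> 'o, nat \<Rightarrow> 'm, nat \<Rightarrow> 'p, nat \<Rightarrow> 'q) ftr" where
  "prod_ftr n U =
     \<lparr>fob = \<lambda>a. \<lambda>i\<in>{1..n}. fob (U i) (a i), far = \<lambda>f. \<lambda>i\<in>{1..n}. far (U i) (f i)\<rparr>"

text \<open>The functor \<open>(a\<^sub>1, \<dots>, a\<^sub>n) \<mapsto> (a\<^bsub>\<sigma> 1\<^esub>, \<dots>, a\<^bsub>\<sigma> n\<^esub>)\<close>.\<close>

definition perm_ftr ::
    "nat \<Rightarrow> (nat \<Rightarrow> nat) \<Rightarrow> (nat \<Rightarrow> 'o, nat \<Rightarrow> 'm, nat \<Rightarrow> 'o, nat \<Rightarrow> 'm) ftr" where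
  "perm_ftr n \<sigma> = \<lparr>fob = \<lambda>a. \<lambda>i\<in>{1..n}. a (\<sigma> i), far = \<lambda>f. \<lambda>i\<in>{1..n}. f (\<sigma> i)\<rparr>"


section \<open>Precontextual and contextual categories\<close>

text \<open>
  A square \<open>(t, l, r, b)\<close> consists of its top, left, right and bottom arrow; the horizontal
  arrows \<open>t\<close> and \<open>b\<close> point to the right and the vertical arrows \<open>l\<close> and \<open>r\<close> point downwards.
\<close>

type_synonym 'm square = "'m \<times> 'm \<times> 'm \<times> 'm"

record ('o, 'm) precat = "('o, 'm) cat" +
  len :: "'o \<Rightarrow> nat"
  bd :: "'o \<Rightarrow> 'o"
  proj :: "'o \<Rightarrow> 'm"
  Sq :: "'m square set"

definition precontextual :: "('o, 'm) precat \<Rightarrow> bool" where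
  "precontextual A \<longleftrightarrow> category A \<and>
     (\<forall>a\<in>Obj A. bd A a \<in> Obj A \<and>
        (if len A a \<ge> 1 then len A (bd A a) = len A a - 1 else bd A a = a)) \<and>
     (\<forall>a\<in>Obj A. len A a \<ge> 1 \<longrightarrow> proj A a \<in> hom A a (bd A a)) \<and>
     (\<forall>(t, l, r, b)\<in>Sq A. \<exists>x\<in>Obj A. \<exists>y\<in>Obj A. len A x \<ge> 1 \<and> len A y \<ge> 1 \<and>
        l = proj A x \<and> r = proj A y \<and> t \<in> hom A x y \<and> b \<in> hom A (bd A x) (bd A y) \<and>
        Cmp A r t = Cmp A b l)"

text \<open>
  \<open>display A a b m\<close>: the arrow \<open>m : a \<rightarrow> b\<close> is a display map. Its length is
  \<open>len A a - len A b\<close>.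
\<close>

inductive display :: "('o, 'm) precat \<Rightarrow> 'o \<Rightarrow> 'o \<Rightarrow> 'm \<Rightarrow> bool" for A where
  display_id: "a \<in> Obj A \<Longrightarrow> display A a a (Idn A a)"
| display_step: "a \<in> Obj A \<Longrightarrow> len A a \<ge> 1 \<Longrightarrow> display A (bd A a) b m
    \<Longrightarrow> display A a b (Cmp A m (proj A a))"

text \<open>
  For given endpoints there is at most one display map.
\<close>

definition disp :: "('o, 'm) precat \<Rightarrow> 'o \<Rightarrow> 'o \<Rightarrow> 'm" where
  "disp A a b = (THE m. display A a b m)"

text \<open>
  The empty vertical composites are the squares with identities as vertical sides; the vertical
  sides of a composite of \<open>k\<close> squares have length \<open>k\<close>, so that the distinguished squares whose
  vertical sides have length 1 are the elements of \<open>Sq\<close>.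
\<close>

inductive distinguished :: "('o, 'm) precat \<Rightarrow> 'm square \<Rightarrow> bool" for A where
  distinguished_id:
    "f \<in> Arr A \<Longrightarrow> distinguished A (f, Idn A (Src A f), Idn A (Trg A f), f)"
| distinguished_step:
    "(t, l, r, m) \<in> Sq A \<Longrightarrow> distinguished A (m, l', r', b)
      \<Longrightarrow> distinguished A (t, Cmp A l' l, Cmp A r' r, b)"

fun pullback :: "('o, 'm, 'z) cat_scheme \<Rightarrow> 'm square \<Rightarrow> bool" where
  "pullback C (t, l, r, b) \<longleftrightarrow>
     (\<forall>c\<in>Obj C. \<forall>u\<in>hom C c (Src C r). \<forall>v\<in>hom C c (Src C b). Cmp C r u = Cmp C b v \<longrightarrow>
        (\<exists>!w. w \<in> hom C c (Src C t) \<and> Cmp C t w = u \<and> Cmp C l w = v))"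

definition contextual :: "('o, 'm) precat \<Rightarrow> bool" where
  "contextual C \<longleftrightarrow> precontextual C \<and>
     (\<exists>!a. a \<in> Obj C \<and> len C a = 0) \<and>
     (\<forall>a\<in>Obj C. len C a = 0 \<longrightarrow> terminal C a) \<and>
     (\<forall>q\<in>Sq C. pullback C q) \<and>
     (\<forall>a\<in>Obj C. len C a \<ge> 1 \<longrightarrow> (Idn C a, proj C a, proj C a, Idn C (bd C a)) \<in> Sq C) \<and>
     (\<forall>t l m b t' r b'. (t, l, m, b) \<in> Sq C \<and> (t', m, r, b') \<in> Sq C \<longrightarrow>
        (Cmp C t' t, l, r, Cmp C b' b) \<in> Sq C) \<and>
     (\<forall>a\<in>Obj C. \<forall>f\<in>Arr C. len C a \<ge> 1 \<and> Trg C f = bd C a \<longrightarrow>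
        (\<exists>!q. q \<in> Sq C \<and> (\<exists>t l. q = (t, l, proj C a, f))))"

definition unit_ob :: "('o, 'm) precat \<Rightarrow> 'o" where
  "unit_ob C = (THE a. a \<in> Obj C \<and> len C a = 0)"

definition contextual_functor ::
    "('o, 'm) precat \<Rightarrow> ('p, 'q) precat \<Rightarrow> ('o, 'm, 'p, 'q) ftr \<Rightarrow> bool" where
  "contextual_functor A B G \<longleftrightarrow> is_functor A B G \<and>
     (\<forall>a\<in>Obj A. len B (fob G a) = len A a \<and> fob G (bd A a) = bd B (fob G a)) \<and>
     (\<forall>a\<in>Obj A. len A a \<ge> 1 \<longrightarrow> far G (proj A a) = proj B (fob G a)) \<and>
     (\<forall>(t, l, r, b)\<in>Sq A. (far G t, far G l, far G r, far G b) \<in> Sq B)"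


section \<open>Cellular diagrams\<close>

text \<open>
  The opposite of a poset as a category: for \<open>x \<le> y\<close> there is an arrow \<open>(y, x) : y \<rightarrow> x\<close>.
\<close>

definition poset_op :: "'p set \<Rightarrow> ('p \<Rightarrow> 'p \<Rightarrow> bool) \<Rightarrow> ('p, 'p \<times> 'p) cat" where
  "poset_op P le =
     \<lparr>Obj = P, Arr = {(y, x). y \<in> P \<and> x \<in> P \<and> le x y}, Src = fst, Trg = snd,
      Idn = (\<lambda>x. (x, x)), Cmp = (\<lambda>g f. (fst f, snd g))\<rparr>"

definition sieve :: "'p set \<Rightarrow> ('p \<Rightarrow> 'p \<Rightarrow> bool) \<Rightarrow> 'p set \<Rightarrow> bool" where
  "sieve P le X \<longleftrightarrow> X \<subseteq> P \<and> (\<forall>x\<in>X. \<forall>y\<in>P. le y x \<longrightarrow> y \<in> X)"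

definition down :: "'p set \<Rightarrow> ('p \<Rightarrow> 'p \<Rightarrow> bool) \<Rightarrow> 'p \<Rightarrow> 'p set" where
  "down P le x = {y \<in> P. le y x}"

definition sdown :: "'p set \<Rightarrow> ('p \<Rightarrow> 'p \<Rightarrow> bool) \<Rightarrow> 'p \<Rightarrow> 'p set" where
  "sdown P le x = {y \<in> P. le y x \<and> y \<noteq> x}"

definition poset :: "'p set \<Rightarrow> ('p \<Rightarrow> 'p \<Rightarrow> bool) \<Rightarrow> bool" where
  "poset P le \<longleftrightarrow> (\<forall>x\<in>P. le x x) \<and> (\<forall>x\<in>P. \<forall>y\<in>P. le x y \<and> le y x \<longrightarrow> x = y) \<and>
     (\<forall>x\<in>P. \<forall>y\<in>P. \<forall>z\<in>P. le x y \<and> le y z \<longrightarrow> le x z)"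

definition linearization :: "'p set \<Rightarrow> ('p \<Rightarrow> 'p \<Rightarrow> bool) \<Rightarrow> ('p \<Rightarrow> 'p \<Rightarrow> bool) \<Rightarrow> bool" where
  "linearization P le lin \<longleftrightarrow> poset P lin \<and> (\<forall>x\<in>P. \<forall>y\<in>P. lin x y \<or> lin y x) \<and>
     (\<forall>x\<in>P. \<forall>y\<in>P. le x y \<longrightarrow> lin x y)"

definition local_linearization ::
    "'p set \<Rightarrow> ('p \<Rightarrow> 'p \<Rightarrow> bool) \<Rightarrow> ('p \<Rightarrow> 'p \<Rightarrow> bool) \<Rightarrow> bool" where
  "local_linearization P le lin \<longleftrightarrow> poset P le \<and> (\<forall>x\<in>P. finite (down P le x)) \<and>
     (\<forall>x\<in>P. \<forall>y\<in>P. lin x y \<longrightarrow> (\<exists>z\<in>P. le x z \<and> le y z)) \<and>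
     (\<forall>x\<in>P. linearization (down P le x) le lin)"

text \<open>
  \<open>cone C le F X c \<nu>\<close>: the arrows \<open>\<nu> x : c \<rightarrow> F x\<close>, for \<open>x \<in> X\<close>, form a cone on the restriction
  of the diagram \<open>F\<close> to \<open>X\<close>.
\<close>

definition cone :: "('o, 'm, 'z) cat_scheme \<Rightarrow> ('p \<Rightarrow> 'p \<Rightarrow> bool) \<Rightarrow> ('p, 'p \<times> 'p, 'o, 'm) ftr
    \<Rightarrow> 'p set \<Rightarrow> 'o \<Rightarrow> ('p \<Rightarrow> 'm) \<Rightarrow> bool" where
  "cone C le F X c \<nu> \<longleftrightarrow> c \<in> Obj C \<and> (\<forall>x\<in>X. \<nu> x \<in> hom C c (fob F x)) \<and>
     (\<forall>x\<in>X. \<forall>y\<in>X. le x y \<longrightarrow> Cmp C (far F (y, x)) (\<nu> y) = \<nu> x)"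

definition limit_cone :: "('o, 'm, 'z) cat_scheme \<Rightarrow> ('p \<Rightarrow> 'p \<Rightarrow> bool)
    \<Rightarrow> ('p, 'p \<times> 'p, 'o, 'm) ftr \<Rightarrow> 'p set \<Rightarrow> 'o \<Rightarrow> ('p \<Rightarrow> 'm) \<Rightarrow> bool" where
  "limit_cone C le F X a \<pi> \<longleftrightarrow> cone C le F X a \<pi> \<and>
     (\<forall>c \<nu>. cone C le F X c \<nu> \<longrightarrow> (\<exists>!m. m \<in> hom C c a \<and> (\<forall>x\<in>X. Cmp C (\<pi> x) m = \<nu> x)))"

text \<open>
  The arrow from \<open>c\<close> to a limit \<open>a\<close> with projections \<open>\<pi> x\<close> (\<open>x \<in> X\<close>) that is induced by a
  cone \<open>\<nu>\<close> on \<open>c\<close>.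
\<close>

definition induced :: "('o, 'm, 'z) cat_scheme \<Rightarrow> 'i set \<Rightarrow> 'o \<Rightarrow> ('i \<Rightarrow> 'm) \<Rightarrow> 'o \<Rightarrow> ('i \<Rightarrow> 'm) \<Rightarrow> 'm" where
  "induced C X c \<nu> a \<pi> = (THE m. m \<in> hom C c a \<and> (\<forall>x\<in>X. Cmp C (\<pi> x) m = \<nu> x))"

text \<open>
  A choice of limit cones as in the definition of cellularity: \<open>a X\<close> is the apex and \<open>\<pi> X x\<close>
  (\<open>x \<in> X\<close>) are the projections of the cone chosen for the sieve \<open>X\<close>. For sieves \<open>X \<subseteq> Y\<close> the
  arrow \<open>m Y X\<close> is the canonical arrow \<open>a Y \<rightarrow> a X\<close>.
\<close>

definition cellular_choice :: "('o, 'm) precat \<Rightarrow> 'p set \<Rightarrow> ('p \<Rightarrow> 'p \<Rightarrow> bool) \<Rightarrow> ('p \<Rightarrow> 'p \<Rightarrow> bool)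
    \<Rightarrow> ('p, 'p \<times> 'p, 'o, 'm) ftr \<Rightarrow> ('p set \<Rightarrow> 'o) \<Rightarrow> ('p set \<Rightarrow> 'p \<Rightarrow> 'm) \<Rightarrow> bool" where
  "cellular_choice C P le lin F a \<pi> \<longleftrightarrow>
     (let m = (\<lambda>Y X. induced C X (a Y) (\<pi> Y) (a X) (\<pi> X)) in
        (\<forall>X. sieve P le X \<longrightarrow> limit_cone C le F X (a X) (\<pi> X)) \<and>
        a {} = unit_ob C \<and>
        (\<forall>x\<in>P. a (down P le x) = fob F x \<and>
           (\<forall>y\<in>down P le x. \<pi> (down P le x) y = far F (x, y))) \<and>
        (\<forall>X Y y. sieve P le X \<and> sieve P le Y \<and> X \<subseteq> Y \<and> Y - X = {y} \<and> (\<forall>x\<in>X. lin x y) \<longrightarrow>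
           display C (a Y) (a X) (m Y X) \<and> len C (a Y) = len C (a X) + 1) \<and>
        (\<forall>X Y X' Y' y. sieve P le X \<and> sieve P le Y \<and> sieve P le X' \<and> sieve P le Y' \<and>
           X \<subseteq> X' \<and> Y \<subseteq> Y' \<and> X \<subseteq> Y \<and> X' \<subseteq> Y' \<and> Y - X = {y} \<and> Y' - X' = {y} \<and>
           (\<forall>x\<in>X'. lin x y) \<longrightarrow>
           distinguished C (m Y' Y, m Y' X', m Y X, m X' X)))"

text \<open>
  The notion is meant for finite posets \<open>(P, le)\<close> with \<open>linearization P le lin\<close>. It is only
  applied to the elements below a given one in a poset with a local linearization; that the
  lexicographic order used for multimorphisms is one is shown in
  \<open>lex_lin_local_linearization\<close>.
\<close>

definition cellular :: "('o, 'm) precat \<Rightarrow> 'p set \<Rightarrow> ('p \<Rightarrow> 'p \<Rightarrow> bool) \<Rightarrow> ('p \<Rightarrow> 'p \<Rightarrow> bool)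
    \<Rightarrow> ('p, 'p \<times> 'p, 'o, 'm) ftr \<Rightarrow> bool" where
  "cellular C P le lin F \<longleftrightarrow> is_functor (poset_op P le) C F \<and>
     (\<exists>a \<pi>. cellular_choice C P le lin F a \<pi>)"

text \<open>
  The choice is unique on sieves \<open>X\<close> (and on the projections indexed by elements of \<open>X\<close>), so the
  values used below do not depend on which choice is selected.
\<close>

definition the_choice :: "('o, 'm) precat \<Rightarrow> 'p set \<Rightarrow> ('p \<Rightarrow> 'p \<Rightarrow> bool) \<Rightarrow> ('p \<Rightarrow> 'p \<Rightarrow> bool)
    \<Rightarrow> ('p, 'p \<times> 'p, 'o, 'm) ftr \<Rightarrow> ('p set \<Rightarrow> 'o) \<times> ('p set \<Rightarrow> 'p \<Rightarrow> 'm)" where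
  "the_choice C P le lin F = (SOME c. cellular_choice C P le lin F (fst c) (snd c))"

definition locally_cellular :: "('o, 'm) precat \<Rightarrow> 'p set \<Rightarrow> ('p \<Rightarrow> 'p \<Rightarrow> bool)
    \<Rightarrow> ('p \<Rightarrow> 'p \<Rightarrow> bool) \<Rightarrow> ('p, 'p \<times> 'p, 'o, 'm) ftr \<Rightarrow> bool" where
  "locally_cellular C P le lin F \<longleftrightarrow> is_functor (poset_op P le) C F \<and>
     (\<forall>x\<in>P. cellular C (down P le x) le lin F)"

text \<open>
  The object \<open>F[\<partial>x]\<close> and its projections, for the restriction of \<open>F\<close> to the elements below \<open>x\<close>.
\<close>

definition latch :: "('o, 'm) precat \<Rightarrow> 'p set \<Rightarrow> ('p \<Rightarrow> 'p \<Rightarrow> bool) \<Rightarrow> ('p \<Rightarrow> 'p \<Rightarrow> bool)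
    \<Rightarrow> ('p, 'p \<times> 'p, 'o, 'm) ftr \<Rightarrow> 'p \<Rightarrow> 'o" where
  "latch C P le lin F x = fst (the_choice C (down P le x) le lin F) (sdown P le x)"

definition latch_proj :: "('o, 'm) precat \<Rightarrow> 'p set \<Rightarrow> ('p \<Rightarrow> 'p \<Rightarrow> bool) \<Rightarrow> ('p \<Rightarrow> 'p \<Rightarrow> bool)
    \<Rightarrow> ('p, 'p \<times> 'p, 'o, 'm) ftr \<Rightarrow> 'p \<Rightarrow> 'p \<Rightarrow> 'm" where
  "latch_proj C P le lin F x = snd (the_choice C (down P le x) le lin F) (sdown P le x)"


section \<open>Multimorphisms\<close>

definition tob :: "('o, 'm) precat \<Rightarrow> 'o set" where
  "tob A = {x \<in> Obj A. len A x \<ge> 1}"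

definition tle :: "('o, 'm) precat \<Rightarrow> 'o \<Rightarrow> 'o \<Rightarrow> bool" where
  "tle A x y \<longleftrightarrow> (\<exists>m. display A y x m)"

definition ptob :: "nat \<Rightarrow> (nat \<Rightarrow> ('o, 'm) precat) \<Rightarrow> (nat \<Rightarrow> 'o) set" where
  "ptob n A = (\<Pi>\<^sub>E i\<in>{1..n}. tob (A i))"

definition ptle :: "nat \<Rightarrow> (nat \<Rightarrow> ('o, 'm) precat) \<Rightarrow> (nat \<Rightarrow> 'o) \<Rightarrow> (nat \<Rightarrow> 'o) \<Rightarrow> bool" where
  "ptle n A x y \<longleftrightarrow> (\<forall>i\<in>{1..n}. tle (A i) (x i) (y i))"

definition lex_lin :: "nat \<Rightarrow> (nat \<Rightarrow> ('o, 'm) precat) \<Rightarrow> (nat \<Rightarrow> 'o) \<Rightarrow> (nat \<Rightarrow> 'o) \<Rightarrow> bool" where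
  "lex_lin n A x y \<longleftrightarrow> x = y \<or>
     (\<exists>i\<in>{1..n}. (\<forall>j\<in>{1..<i}. x j = y j) \<and> tle (A i) (x i) (y i) \<and> x i \<noteq> y i \<and>
        (\<forall>j\<in>{i<..n}. tle (A j) (x j) (y j) \<or> tle (A j) (y j) (x j)))"

lemma display_len:
  assumes "precontextual A" "display A y x m"
  shows "y \<in> Obj A \<and> x \<in> Obj A \<and> len A x \<le> len A y \<and> x = (bd A ^^ (len A y - len A x)) y"
  using assms(2)
proof induction
  case (display_step a b m)
  have l: "len A a = Suc (len A (bd A a))"
    using assms(1) display_step.hyps unfolding precontextual_def
    by (metis One_nat_def Suc_pred less_eq_Suc_le)
  then have "len A a - len A b = Suc (len A (bd A a) - len A b)"
    using display_step.IH by (simp add: Suc_diff_le)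
  then have "(bd A ^^ (len A a - len A b)) a = (bd A ^^ (len A (bd A a) - len A b)) (bd A a)"
    by (simp only: funpow_Suc_right comp_apply)
  then show ?case using display_step l by simp
qed auto

lemma display_bd:
  assumes "precontextual A" "y \<in> Obj A" "k \<le> len A y"
  shows "len A ((bd A ^^ k) y) = len A y - k \<and> (\<exists>m. display A y ((bd A ^^ k) y) m)"
  using assms(2,3)
proof (induction k arbitrary: y)
  case (Suc k)
  have b: "bd A y \<in> Obj A" "len A (bd A y) = len A y - 1"
    using assms(1) Suc.prems unfolding precontextual_def by auto
  with Suc.IH[of "bd A y"] Suc.prems
  obtain m where m: "len A ((bd A ^^ k) (bd A y)) = len A (bd A y) - k"
      "display A (bd A y) ((bd A ^^ k) (bd A y)) m"
    by fastforce
  have "display A y ((bd A ^^ k) (bd A y)) (Cmp A m (proj A y))"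
    using m(2) Suc.prems by (intro display_step) auto
  then show ?case using m(1) b(2) unfolding funpow_Suc_right comp_apply by auto
qed (auto intro: display_id)

lemma tle_iff:
  assumes "precontextual A"
  shows "tle A x y \<longleftrightarrow> y \<in> Obj A \<and> len A x \<le> len A y \<and> x = (bd A ^^ (len A y - len A x)) y"
  using display_len[OF assms] display_bd[OF assms, of y "len A y - len A x"]
  unfolding tle_def by (metis diff_le_self)

lemma poset_tle: "precontextual A \<Longrightarrow> poset (tob A) (tle A)"
  unfolding poset_def
proof (intro conjI ballI impI)
  fix x y z assume A: "precontextual A"
  { assume "x \<in> tob A" then show "tle A x x" using A by (simp add: tle_iff tob_def) }
  { assume "tle A x y \<and> tle A y x" then show "x = y" using A by (auto simp: tle_iff) }
  { assume *: "tle A x y \<and> tle A y z"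
    then have le: "len A x \<le> len A y" "len A y \<le> len A z" using A by (auto simp: tle_iff)
    have "x = (bd A ^^ (len A y - len A x)) ((bd A ^^ (len A z - len A y)) z)"
      using * A by (simp add: tle_iff)
    also have "\<dots> = (bd A ^^ (len A z - len A x)) z"
      using le by (simp add: funpow_add[symmetric, THEN fun_cong, unfolded comp_apply])
    finally show "tle A x z" using * A le by (simp add: tle_iff) }
qed

lemma tle_chain:
  assumes A: "precontextual A" and "tle A x z" "tle A y z"
  shows "tle A x y \<or> tle A y x"
proof -
  have *: "tle A u v" if "tle A u z" "tle A v z" "len A u \<le> len A v" for u v
  proof -
    have l: "len A v \<le> len A z" "v \<in> Obj A"
      using that A by (auto simp: tle_iff dest: display_len[OF A] simp: tle_def)
    have "u = (bd A ^^ (len A z - len A u)) z" using that A by (simp add: tle_iff)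
    also have "len A z - len A u = (len A v - len A u) + (len A z - len A v)" using that l by simp
    also have "(bd A ^^ \<dots>) z = (bd A ^^ (len A v - len A u)) ((bd A ^^ (len A z - len A v)) z)"
      by (simp add: funpow_add)
    also have "(bd A ^^ (len A z - len A v)) z = v" using that A by (simp add: tle_iff)
    finally show ?thesis using that l A by (simp add: tle_iff)
  qed
  show ?thesis using *[of x y] *[of y x] assms by linarith
qed

lemma finite_tle_down: "precontextual A \<Longrightarrow> finite {x \<in> tob A. tle A x y}"
  by (rule finite_subset[where B = "(\<lambda>k. (bd A ^^ k) y) ` {..len A y}"])
     (auto simp: tle_iff image_iff intro!: bexI[where x = "len A y - len A _"])

lemma lex_lin_local_linearization:
  fixes A :: "nat \<Rightarrow> ('o, 'm) precat"
  assumes "\<And>i. i \<in> {1..n} \<Longrightarrow> precontextual (A i)"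
  shows "local_linearization (ptob n A) (ptle n A) (lex_lin n A)"
proof -
  have mem: "x i \<in> tob (A i)" if "x \<in> ptob n A" "i \<in> {1..n}" for x i
    using that by (auto simp: ptob_def PiE_def Pi_def)
  have ext: "x = y" if "x \<in> ptob n A" "y \<in> ptob n A" "\<And>i. i \<in> {1..n} \<Longrightarrow> x i = y i" for x y
    using that PiE_ext unfolding ptob_def by blast
  have refl: "tle (A i) u u" if "i \<in> {1..n}" "u \<in> tob (A i)" for i u
    using poset_tle[OF assms[OF that(1)]] that(2) unfolding poset_def by blast
  have antisym: "u = v"
    if "i \<in> {1..n}" "u \<in> tob (A i)" "v \<in> tob (A i)" "tle (A i) u v" "tle (A i) v u" for i u v
    using poset_tle[OF assms[OF that(1)]] that(2-) unfolding poset_def by blast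
  have trans: "tle (A i) u w"
    if "i \<in> {1..n}" "u \<in> tob (A i)" "v \<in> tob (A i)" "w \<in> tob (A i)"
      "tle (A i) u v" "tle (A i) v w" for i u v w
    using poset_tle[OF assms[OF that(1)]] that(2-) unfolding poset_def by blast
  have least: "\<exists>i\<in>{1..n}. x i \<noteq> y i \<and> (\<forall>j\<in>{1..<i}. x j = y j)"
    if "x \<in> ptob n A" "y \<in> ptob n A" "x \<noteq> y" for x y
  proof -
    have "\<exists>i. i \<in> {1..n} \<and> x i \<noteq> y i" using ext that by blast
    then have "(LEAST i. i \<in> {1..n} \<and> x i \<noteq> y i) \<in> {1..n} \<and>
        x (LEAST i. i \<in> {1..n} \<and> x i \<noteq> y i) \<noteq> y (LEAST i. i \<in> {1..n} \<and> x i \<noteq> y i)"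
      by (rule LeastI_ex)
    moreover have "x j = y j" if "j \<in> {1..<LEAST i. i \<in> {1..n} \<and> x i \<noteq> y i}" for j
      using not_less_Least[of j "\<lambda>i. i \<in> {1..n} \<and> x i \<noteq> y i"] that calculation by auto
    ultimately show ?thesis by blast
  qed
  have "poset (ptob n A) (ptle n A)"
    unfolding poset_def ptle_def by (meson mem ext refl antisym trans)
  moreover have "finite (down (ptob n A) (ptle n A) x)" for x
  proof (rule finite_subset)
    show "down (ptob n A) (ptle n A) x \<subseteq> (\<Pi>\<^sub>E i\<in>{1..n}. {u \<in> tob (A i). tle (A i) u (x i)})"
      by (auto simp: down_def ptob_def ptle_def PiE_iff extensional_def)
    show "finite (\<Pi>\<^sub>E i\<in>{1..n}. {u \<in> tob (A i). tle (A i) u (x i)})"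
      using assms by (intro finite_PiE finite_tle_down) auto
  qed
  moreover have "\<exists>z\<in>ptob n A. ptle n A x z \<and> ptle n A y z"
    if x: "x \<in> ptob n A" and y: "y \<in> ptob n A" and "lex_lin n A x y" for x y
  proof -
    have c: "tle (A i) (x i) (y i) \<or> tle (A i) (y i) (x i)" if i: "i \<in> {1..n}" for i
    proof (cases "x = y")
      case True
      then show ?thesis using refl[OF i mem[OF x i]] by simp
    next
      case False
      with \<open>lex_lin n A x y\<close> obtain k where "\<forall>j\<in>{1..<k}. x j = y j"
        "tle (A k) (x k) (y k)" "\<forall>j\<in>{k<..n}. tle (A j) (x j) (y j) \<or> tle (A j) (y j) (x j)"
        unfolding lex_lin_def by blast
      moreover have "i \<in> {1..<k} \<or> i = k \<or> i \<in> {k<..n}" using i by auto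
      ultimately show ?thesis using refl[OF i mem[OF x i]] by metis
    qed
    define z where "z = (\<lambda>i\<in>{1..n}. if tle (A i) (x i) (y i) then y i else x i)"
    have "z \<in> ptob n A" using mem[OF x] mem[OF y] by (auto simp: z_def ptob_def)
    moreover have "ptle n A x z" "ptle n A y z"
      unfolding ptle_def
    proof safe
      fix i assume i: "i \<in> {1..n}"
      show "tle (A i) (x i) (z i)" using refl[OF i mem[OF x i]] i by (simp add: z_def)
      show "tle (A i) (y i) (z i)" using refl[OF i mem[OF y i]] c[OF i] i by (auto simp: z_def)
    qed
    ultimately show ?thesis by blast
  qed
  moreover have "linearization (down (ptob n A) (ptle n A) w) (ptle n A) (lex_lin n A)"
    if w: "w \<in> ptob n A" for w
  proof -
    let ?D = "down (ptob n A) (ptle n A) w"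
    have D: "x \<in> ptob n A" if "x \<in> ?D" for x
      using that by (simp add: down_def)
    have chain: "tle (A i) (x i) (y i) \<or> tle (A i) (y i) (x i)"
      if "x \<in> ?D" "y \<in> ?D" "i \<in> {1..n}" for x y i
      using tle_chain[OF assms[OF that(3)], of "x i" "w i" "y i"] that
      by (auto simp: down_def ptle_def)
    have lexD: "lex_lin n A x y \<longleftrightarrow> x = y \<or>
        (\<exists>i\<in>{1..n}. (\<forall>j\<in>{1..<i}. x j = y j) \<and> tle (A i) (x i) (y i) \<and> x i \<noteq> y i)"
      if "x \<in> ?D" "y \<in> ?D" for x y
    proof -
      have "\<forall>j\<in>{i<..n}. tle (A j) (x j) (y j) \<or> tle (A j) (y j) (x j)" if "i \<in> {1..n}" for i
        using that chain[OF \<open>x \<in> ?D\<close> \<open>y \<in> ?D\<close>] by auto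
      then show ?thesis unfolding lex_lin_def by blast
    qed
    have "x = y" if x: "x \<in> ?D" and y: "y \<in> ?D" and l: "lex_lin n A x y" "lex_lin n A y x" for x y
    proof (rule ccontr)
      assume "x \<noteq> y"
      then obtain i k where i: "i \<in> {1..n}" "\<forall>j\<in>{1..<i}. x j = y j" "tle (A i) (x i) (y i)" "x i \<noteq> y i"
        and k: "k \<in> {1..n}" "\<forall>j\<in>{1..<k}. y j = x j" "tle (A k) (y k) (x k)" "y k \<noteq> x k"
        using l lexD[OF x y] lexD[OF y x] by metis
      have "\<not> i < k" "\<not> k < i" using i k by (metis atLeastAtMost_iff atLeastLessThan_iff)+
      then have "i = k" by simp
      then show False using i k antisym mem D x y by metis
    qed
    moreover have "lex_lin n A x z"
      if x: "x \<in> ?D" and y: "y \<in> ?D" and z: "z \<in> ?D"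
        and l: "lex_lin n A x y" "lex_lin n A y z" for x y z
    proof (cases "x = y \<or> y = z")
      case True
      then show ?thesis using l by auto
    next
      case False
      then obtain i k where i: "i \<in> {1..n}" "\<forall>j\<in>{1..<i}. x j = y j" "tle (A i) (x i) (y i)" "x i \<noteq> y i"
        and k: "k \<in> {1..n}" "\<forall>j\<in>{1..<k}. y j = z j" "tle (A k) (y k) (z k)" "y k \<noteq> z k"
        using l lexD[OF x y] lexD[OF y z] by metis
      have pre: "\<forall>j\<in>{1..<min i k}. x j = z j" using i(2) k(2) by simp
      consider "i < k" | "k < i" | "i = k" by linarith
      then have "tle (A (min i k)) (x (min i k)) (z (min i k)) \<and> x (min i k) \<noteq> z (min i k)"
      proof cases
        case 1
        then have "y i = z i" using i k by simp
        then show ?thesis using 1 i by (simp add: min_def)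
      next
        case 2
        then have "x k = y k" using i k by simp
        then show ?thesis using 2 k by (simp add: min_def)
      next
        case 3
        have m: "x i \<in> tob (A i)" "y i \<in> tob (A i)" "z i \<in> tob (A i)"
          using mem D x y z i(1) by blast+
        have "tle (A i) (x i) (z i)" using trans[OF i(1) m] i k 3 by simp
        moreover have "x i \<noteq> z i" using antisym[OF i(1) m(1,2)] i k 3 by auto
        ultimately show ?thesis using 3 by simp
      qed
      moreover have "min i k \<in> {1..n}" using i(1) k(1) by (simp add: min_def)
      ultimately show ?thesis using pre lexD[OF x z] by blast
    qed
    moreover have "lex_lin n A x y \<or> lex_lin n A y x" if x: "x \<in> ?D" and y: "y \<in> ?D" for x y
    proof (cases "x = y")
      case False
      then obtain i where i: "i \<in> {1..n}" "x i \<noteq> y i" "\<forall>j\<in>{1..<i}. x j = y j"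
        using least D x y by blast
      then show ?thesis using lexD[OF x y] lexD[OF y x] chain[OF x y i(1)] by metis
    qed (simp add: lex_lin_def)
    moreover have "lex_lin n A x y" if x: "x \<in> ?D" and y: "y \<in> ?D" and le: "ptle n A x y" for x y
    proof (cases "x = y")
      case False
      then obtain i where i: "i \<in> {1..n}" "x i \<noteq> y i" "\<forall>j\<in>{1..<i}. x j = y j"
        using least D x y by blast
      then show ?thesis using lexD[OF x y] le unfolding ptle_def by blast
    qed (simp add: lex_lin_def)
    moreover have "lex_lin n A x x" for x by (simp add: lex_lin_def)
    ultimately show ?thesis unfolding linearization_def poset_def by blast
  qed
  ultimately show ?thesis unfolding local_linearization_def by blast
qed

definition tdiag :: "nat \<Rightarrow> (nat \<Rightarrow> ('o, 'm) precat) \<Rightarrow> (nat \<Rightarrow> 'o, nat \<Rightarrow> 'm, 'c, 'd) ftr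
    \<Rightarrow> (nat \<Rightarrow> 'o, (nat \<Rightarrow> 'o) \<times> (nat \<Rightarrow> 'o), 'c, 'd) ftr" where
  "tdiag n A F =
     \<lparr>fob = fob F, far = \<lambda>(y, x). far F (\<lambda>i\<in>{1..n}. disp (A i) (y i) (x i))\<rparr>"

definition bnd :: "nat \<Rightarrow> (nat \<Rightarrow> ('o, 'm) precat) \<Rightarrow> ('c, 'd) precat
    \<Rightarrow> (nat \<Rightarrow> 'o, nat \<Rightarrow> 'm, 'c, 'd) ftr \<Rightarrow> (nat \<Rightarrow> 'o) \<Rightarrow> 'c" where
  "bnd n A C F x = latch C (ptob n A) (ptle n A) (lex_lin n A) (tdiag n A F) x"

definition bnd_proj :: "nat \<Rightarrow> (nat \<Rightarrow> ('o, 'm) precat) \<Rightarrow> ('c, 'd) precat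
    \<Rightarrow> (nat \<Rightarrow> 'o, nat \<Rightarrow> 'm, 'c, 'd) ftr \<Rightarrow> (nat \<Rightarrow> 'o) \<Rightarrow> (nat \<Rightarrow> 'o) \<Rightarrow> 'd" where
  "bnd_proj n A C F x = latch_proj C (ptob n A) (ptle n A) (lex_lin n A) (tdiag n A F) x"

text \<open>
  \<open>bnd n A C F x = F[\<partial>x]\<close> as the limit of the punctured cube of the objects
  \<open>F (cube n A x I)\<close>, \<open>I \<noteq> {}\<close>: the projection to a vertex that is not in \<open>ptob n A\<close> is the
  unique arrow to \<open>F (cube n A x I) = unit_ob C\<close>.
\<close>

definition cube :: "nat \<Rightarrow> (nat \<Rightarrow> ('o, 'm) precat) \<Rightarrow> (nat \<Rightarrow> 'o) \<Rightarrow> nat set \<Rightarrow> nat \<Rightarrow> 'o" where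
  "cube n A x I = (\<lambda>i\<in>{1..n}. if i \<in> I then bd (A i) (x i) else x i)"

definition cube_proj :: "nat \<Rightarrow> (nat \<Rightarrow> ('o, 'm) precat) \<Rightarrow> ('c, 'd) precat
    \<Rightarrow> (nat \<Rightarrow> 'o, nat \<Rightarrow> 'm, 'c, 'd) ftr \<Rightarrow> (nat \<Rightarrow> 'o) \<Rightarrow> nat set \<Rightarrow> 'd" where
  "cube_proj n A C F x I =
     (if cube n A x I \<in> ptob n A then bnd_proj n A C F x (cube n A x I)
      else (THE m. m \<in> hom C (bnd n A C F x) (unit_ob C)))"

text \<open>
  In the last clause \<open>(f0 i, proj x\<^sub>i, proj y\<^sub>i, f1 i)\<close> is a length-1 distinguished square of
  \<open>A i\<close> with \<open>x\<^sub>i\<close> and \<open>y\<^sub>i\<close> the source and target of \<open>f0 i\<close>. By cellularity the length-1 display map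
  \<open>proj C (F x)\<close> has target \<open>F[\<partial>x]\<close>.
\<close>

definition multimorphism :: "nat \<Rightarrow> (nat \<Rightarrow> ('o, 'm) precat) \<Rightarrow> ('c, 'd) precat
    \<Rightarrow> (nat \<Rightarrow> 'o, nat \<Rightarrow> 'm, 'c, 'd) ftr \<Rightarrow> bool" where
  "multimorphism n A C F \<longleftrightarrow>
     ext_ftr (prod_cat n A) F \<and>
     is_functor (prod_cat n A) C F \<and>
     (\<forall>x\<in>Obj (prod_cat n A). (\<exists>i\<in>{1..n}. len (A i) (x i) = 0) \<longrightarrow> fob F x = unit_ob C) \<and>
     locally_cellular C (ptob n A) (ptle n A) (lex_lin n A) (tdiag n A F) \<and>
     (\<forall>x\<in>ptob n A. \<forall>y\<in>ptob n A. \<forall>f0\<in>hom (prod_cat n A) x y.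
        \<forall>f1\<in>Arr (prod_cat n A).
        (\<forall>i\<in>{1..n}. (f0 i, proj (A i) (x i), proj (A i) (y i), f1 i) \<in> Sq (A i)) \<longrightarrow>
        distinguished C
          (far F f0, proj C (fob F x), proj C (fob F y),
           induced C {I. I \<noteq> {} \<and> I \<subseteq> {1..n}}
             (bnd n A C F x)
             (\<lambda>I. Cmp C (far F (\<lambda>i\<in>{1..n}. if i \<in> I then f1 i else f0 i)) (cube_proj n A C F x I))
             (bnd n A C F y) (cube_proj n A C F y)))"

definition Hom :: "nat \<Rightarrow> (nat \<Rightarrow> ('o, 'm) precat) \<Rightarrow> ('c, 'd) precat
    \<Rightarrow> (nat \<Rightarrow> 'o, nat \<Rightarrow> 'm, 'c, 'd) ftr set" where
  "Hom n A C = {F. multimorphism n A C F}"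


text \<open>
  \<open>Hom n A\<close> acts on a contextual functor \<open>G : C \<rightarrow> D\<close> by \<open>comp_ftr (prod_cat n A) G\<close>; this
  respects identities and composition.
\<close>

lemma comp_ftr_id:
  "ext_ftr A F \<Longrightarrow> is_functor A C F \<Longrightarrow> comp_ftr A \<lparr>fob = \<lambda>a. a, far = \<lambda>f. f\<rparr> F = F"
  by (cases F) (simp add: comp_ftr_def ext_ftr_def extensional_restrict)

lemma comp_ftr_comp:
  "is_functor A B F \<Longrightarrow> comp_ftr A (comp_ftr B H G) F = comp_ftr A H (comp_ftr A G F)"
  by (auto simp: comp_ftr_def is_functor_def hom_def)


section \<open>Shuffling diagrams\<close>

definition nat_iso :: "('o, 'm, 'y) cat_scheme \<Rightarrow> ('p, 'q, 'z) cat_scheme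
    \<Rightarrow> ('o, 'm, 'p, 'q) ftr \<Rightarrow> ('o, 'm, 'p, 'q) ftr \<Rightarrow> ('o \<Rightarrow> 'q) \<Rightarrow> bool" where
  "nat_iso A B F G \<phi> \<longleftrightarrow>
     (\<forall>a\<in>Obj A. \<phi> a \<in> hom B (fob F a) (fob G a) \<and> iso_arr B (\<phi> a)) \<and>
     (\<forall>f\<in>Arr A. Cmp B (\<phi> (Trg A f)) (far F f) = Cmp B (far G f) (\<phi> (Src A f)))"

text \<open>
  \<open>A \<circ> \<sigma>\<close> is the family \<open>A\<^bsub>\<sigma> 1\<^esub>, \<dots>, A\<^bsub>\<sigma> n\<^esub>\<close>, so \<open>F\<close> is cellular for the lexicographic
  local linearization of the permuted product.
\<close>

definition shuffling_diagram :: "nat \<Rightarrow> (nat \<Rightarrow> ('o, 'm) precat) \<Rightarrow> (nat \<Rightarrow> nat) \<Rightarrow> ('c, 'd) precat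
    \<Rightarrow> (nat \<Rightarrow> 'o, nat \<Rightarrow> 'm, 'c, 'd) ftr \<Rightarrow> (nat \<Rightarrow> 'o, nat \<Rightarrow> 'm, 'c, 'd) ftr
    \<Rightarrow> ((nat \<Rightarrow> 'o) \<Rightarrow> 'd) \<Rightarrow> bool" where
  "shuffling_diagram n A \<sigma> C F F' \<phi> \<longleftrightarrow>
     multimorphism n (A \<circ> \<sigma>) C F \<and>
     multimorphism n A C F' \<and>
     nat_iso (prod_cat n A) C F' (comp_ftr (prod_cat n A) F (perm_ftr n \<sigma>)) \<phi> \<and>
     (\<forall>a\<in>ptob n A.
        (let s = fob (perm_ftr n \<sigma> :: (nat \<Rightarrow> 'o, nat \<Rightarrow> 'm, nat \<Rightarrow> 'o, nat \<Rightarrow> 'm) ftr) in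
         distinguished C
          (\<phi> a, proj C (fob F' a), proj C (fob F (s a)),
           induced C (sdown (ptob n A) (ptle n A) a)
             (bnd n A C F' a)
             (\<lambda>b. Cmp C (\<phi> b) (bnd_proj n A C F' a b))
             (bnd n (A \<circ> \<sigma>) C F (s a))
             (\<lambda>b. bnd_proj n (A \<circ> \<sigma>) C F (s a) (s b)))))"

definition shuffle :: "nat \<Rightarrow> (nat \<Rightarrow> ('o, 'm) precat) \<Rightarrow> (nat \<Rightarrow> nat) \<Rightarrow> ('c, 'd) precat
    \<Rightarrow> (nat \<Rightarrow> 'o, nat \<Rightarrow> 'm, 'c, 'd) ftr \<Rightarrow> (nat \<Rightarrow> 'o, nat \<Rightarrow> 'm, 'c, 'd) ftr" where
  "shuffle n A \<sigma> C F = (THE F'. \<exists>\<phi>. shuffling_diagram n A \<sigma> C F F' \<phi>)"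

end

theory Submission
  imports Defs
begin

text \<open>
  Given a multimorphism \<open>F\<close> on the permuted product, pull it back along the permutation \<open>\<sigma>\<close> to a
  diagram \<open>G\<close> on the poset \<open>ptob n A\<close>. Its canonical maps \<open>G y \<rightarrow> F[\<partial>(\<sigma> y)]\<close> are display maps of
  length 1, but \<open>G\<close> is cellular for the wrong linearization. Along the lexicographic linearization
  of the original product one can nevertheless choose limits of \<open>G\<close> over all bounded sieves
  recursively: the limit over \<open>X\<close> with largest element \<open>y\<close> is the distinguished pullback of
  \<open>G y \<rightarrow> F[\<partial>(\<sigma> y)]\<close> along the canonical map from the limit over \<open>X - {y}\<close>. Uniqueness of
  distinguished squares makes this choice unique and makes all the squares required for cellularity
  distinguished. The limits over the principal sieves are the values of \<open>F'\<close>, their projections to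
  \<open>G\<close> form \<open>\<phi>\<close>, and \<open>F'\<close> acts on arrows by conjugating \<open>F\<close> with \<open>\<phi>\<close>. Conversely the choice
  of limits belonging to any shuffling diagram is of this form, which gives uniqueness.
  Inverting \<open>\<phi>\<close> in a shuffling diagram gives a shuffling diagram for \<open>\<sigma>\<^sup>-\<^sup>1\<close>, so the passage from
  \<open>F\<close> to \<open>F'\<close> is bijective, and it is natural because contextual functors carry shuffling diagrams
  to shuffling diagrams.
\<close>

section \<open>Arrow calculus, and limits of poset diagrams up to natural isomorphism\<close>

section \<open>Categories and limits\<close>

text \<open>What survives a permutation of the factors is the componentwise order \<open>le\<close>,
  together with the boundary data \<open>g\<close>, \<open>\<rho>\<close> of the values of
  \<open>F\<close>; the lexicographic order \<open>lin\<close> does not. Hence the recursion takes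
  \<open>g\<close> and \<open>\<rho>\<close> as fixed input and uses \<open>lin\<close> only to fix
  the sequence in which elements are adjoined. Cellularity is local, with a separate choice over
  each principal sieve, so constructions over different principal sieves have to be shown to agree
  on common sieves; the uniqueness lemma for towers therefore compares two posets. The other
  difficulty is the clause on squares: its bottom arrow is a map between limits of punctured cubes,
  whereas boundary objects are defined as limits over all elements strictly below. The two are
  linked by cofinality, and vertices of the cube with an entry of length 0 are handled by
  terminality. Bottom arrows are treated throughout as witnesses characterized by their projections,
  so that squares can be pasted, cancelled and mapped by functors without evaluating definite
  descriptions.\<close>

locale category_of =
  fixes C :: "('o, 'm, 'z) cat_scheme"
  assumes category: "category C"
begin

abbreviation comp (infixr "\<cdot>" 70) where "g \<cdot> f \<equiv> Cmp C g f"

lemma comp_hom: "f \<in> hom C a b \<Longrightarrow> g \<in> hom C b c \<Longrightarrow> g \<cdot> f \<in> hom C a c"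
  using category unfolding category_def hom_def by auto

lemma assoc:
  "f \<in> hom C a b \<Longrightarrow> g \<in> hom C b c \<Longrightarrow> h \<in> hom C c d \<Longrightarrow> (h \<cdot> g) \<cdot> f = h \<cdot> g \<cdot> f"
  using category unfolding category_def hom_def by auto

lemma id_hom: "a \<in> Obj C \<Longrightarrow> Idn C a \<in> hom C a a"
  using category unfolding category_def by auto

lemma id_left: "f \<in> hom C a b \<Longrightarrow> Idn C b \<cdot> f = f"
  and id_right: "f \<in> hom C a b \<Longrightarrow> f \<cdot> Idn C a = f"
  using category unfolding category_def hom_def by auto

lemma hom_Obj: "f \<in> hom C a b \<Longrightarrow> a \<in> Obj C \<and> b \<in> Obj C"
  using category unfolding category_def hom_def by auto

lemma hom_Arr: "f \<in> hom C a b \<Longrightarrow> f \<in> Arr C \<and> Src C f = a \<and> Trg C f = b"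
  unfolding hom_def by auto

lemma Arr_hom: "f \<in> Arr C \<Longrightarrow> f \<in> hom C (Src C f) (Trg C f)"
  unfolding hom_def by auto

definition inv_arr :: "'m \<Rightarrow> 'm" where
  "inv_arr f = (SOME g. g \<in> hom C (Trg C f) (Src C f) \<and>
     g \<cdot> f = Idn C (Src C f) \<and> f \<cdot> g = Idn C (Trg C f))"

lemma inv_arr:
  assumes "iso_arr C f" "f \<in> hom C a b"
  shows "inv_arr f \<in> hom C b a" "inv_arr f \<cdot> f = Idn C a" "f \<cdot> inv_arr f = Idn C b"
proof -
  have "\<exists>g. g \<in> hom C (Trg C f) (Src C f) \<and> g \<cdot> f = Idn C (Src C f) \<and> f \<cdot> g = Idn C (Trg C f)"
    using assms(1) unfolding iso_arr_def by auto
  from someI_ex[OF this] show "inv_arr f \<in> hom C b a" "inv_arr f \<cdot> f = Idn C a"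
    "f \<cdot> inv_arr f = Idn C b"
    using hom_Arr[OF assms(2)] unfolding inv_arr_def by auto
qed

lemma iso_arrI:
  "f \<in> hom C a b \<Longrightarrow> g \<in> hom C b a \<Longrightarrow> g \<cdot> f = Idn C a \<Longrightarrow> f \<cdot> g = Idn C b \<Longrightarrow> iso_arr C f"
  unfolding iso_arr_def hom_def by auto

lemma iso_inv_arr: "iso_arr C f \<Longrightarrow> f \<in> hom C a b \<Longrightarrow> iso_arr C (inv_arr f)"
  using inv_arr iso_arrI by blast

lemma iso_id: "a \<in> Obj C \<Longrightarrow> iso_arr C (Idn C a)"
  by (rule iso_arrI[of _ a a "Idn C a"]) (auto intro: id_hom id_left[OF id_hom])

lemma inv_comp_cancel:
  assumes "iso_arr C f" "f \<in> hom C b c" "u \<in> hom C a b"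
  shows "inv_arr f \<cdot> f \<cdot> u = u"
  using assoc[OF assms(3,2) inv_arr(1)[OF assms(1,2)]] inv_arr(2)[OF assms(1,2)] id_left[OF assms(3)]
  by simp

lemma comp_inv_cancel:
  assumes "iso_arr C f" "f \<in> hom C b c" "u \<in> hom C a c"
  shows "f \<cdot> inv_arr f \<cdot> u = u"
  using assoc[OF assms(3) inv_arr(1)[OF assms(1,2)] assms(2)] inv_arr(3)[OF assms(1,2)] id_left[OF assms(3)]
  by simp

lemma iso_mono:
  assumes "iso_arr C f" "f \<in> hom C b c" "u \<in> hom C a b" "v \<in> hom C a b" "f \<cdot> u = f \<cdot> v"
  shows "u = v"
  using inv_comp_cancel[OF assms(1,2,3)] inv_comp_cancel[OF assms(1,2,4)] assms(5) by metis

lemma limit_coneD: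
  assumes "limit_cone C le F X a \<pi>"
  shows "a \<in> Obj C" "x \<in> X \<Longrightarrow> \<pi> x \<in> hom C a (fob F x)"
    "x \<in> X \<Longrightarrow> y \<in> X \<Longrightarrow> le x y \<Longrightarrow> far F (y, x) \<cdot> \<pi> y = \<pi> x" "cone C le F X a \<pi>"
  using assms unfolding limit_cone_def cone_def by auto

lemma induced:
  assumes "limit_cone C le F X a \<pi>" "cone C le F X c \<nu>"
  shows "induced C X c \<nu> a \<pi> \<in> hom C c a" "x \<in> X \<Longrightarrow> \<pi> x \<cdot> induced C X c \<nu> a \<pi> = \<nu> x"
proof -
  have "\<exists>!m. m \<in> hom C c a \<and> (\<forall>x\<in>X. \<pi> x \<cdot> m = \<nu> x)"
    using assms unfolding limit_cone_def by blast
  from theI'[OF this] show "induced C X c \<nu> a \<pi> \<in> hom C c a"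
    "x \<in> X \<Longrightarrow> \<pi> x \<cdot> induced C X c \<nu> a \<pi> = \<nu> x"
    unfolding induced_def by auto
qed

lemma cone_comp:
  assumes F: "\<And>x y. x \<in> X \<Longrightarrow> y \<in> X \<Longrightarrow> le x y \<Longrightarrow> far F (y, x) \<in> hom C (fob F y) (fob F x)"
    and "cone C le F X a \<pi>" and m: "m \<in> hom C c a"
  shows "cone C le F X c (\<lambda>x. \<pi> x \<cdot> m)"
proof -
  have "far F (y, x) \<cdot> \<pi> y \<cdot> m = \<pi> x \<cdot> m" if "x \<in> X" "y \<in> X" "le x y" for x y
    using assms(2) that assoc[OF m _ F[OF that], of "\<pi> y"] unfolding cone_def by auto
  then show ?thesis using assms comp_hom[OF m] hom_Obj[OF m] unfolding cone_def by auto
qed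

lemma cone_cong: "(\<And>x. x \<in> X \<Longrightarrow> \<nu> x = \<nu>' x) \<Longrightarrow> cone C le F X c \<nu> = cone C le F X c \<nu>'"
  unfolding cone_def by auto

lemma limit_cone_cong:
  assumes "\<And>x. x \<in> X \<Longrightarrow> \<pi> x = \<pi>' x"
  shows "limit_cone C le F X c \<pi> = limit_cone C le F X c \<pi>'"
  using cone_cong[of X \<pi> \<pi>' le F c, OF assms] assms unfolding limit_cone_def by auto

lemma induced_cong:
  "(\<And>x. x \<in> X \<Longrightarrow> \<nu> x = \<nu>' x) \<Longrightarrow> (\<And>x. x \<in> X \<Longrightarrow> \<pi> x = \<pi>' x) \<Longrightarrow>
   induced C X c \<nu> a \<pi> = induced C X c \<nu>' a \<pi>'"
  unfolding induced_def by (rule arg_cong[where f = The]) auto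

end

definition diagram_on :: "('o, 'm, 'z) cat_scheme \<Rightarrow> 'p set \<Rightarrow> ('p \<Rightarrow> 'p \<Rightarrow> bool)
    \<Rightarrow> ('p, 'p \<times> 'p, 'o, 'm) ftr \<Rightarrow> bool" where
  "diagram_on C X le F \<longleftrightarrow> is_functor (poset_op X le) C F"

context category_of
begin

lemma diagram_onD:
  assumes "diagram_on C X le F"
  shows "x \<in> X \<Longrightarrow> fob F x \<in> Obj C"
    "x \<in> X \<Longrightarrow> y \<in> X \<Longrightarrow> le x y \<Longrightarrow> far F (y, x) \<in> hom C (fob F y) (fob F x)"
    "x \<in> X \<Longrightarrow> far F (x, x) = Idn C (fob F x)"
    "x \<in> X \<Longrightarrow> y \<in> X \<Longrightarrow> z \<in> X \<Longrightarrow> le x y \<Longrightarrow> le y z \<Longrightarrow> far F (y, x) \<cdot> far F (z, y) = far F (z, x)"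
  using assms unfolding diagram_on_def is_functor_def poset_op_def by force+

lemma diagram_on_subset: "diagram_on C Y le F \<Longrightarrow> X \<subseteq> Y \<Longrightarrow> diagram_on C X le F"
  unfolding diagram_on_def is_functor_def poset_op_def by (auto simp: subset_iff)

text \<open>Joint monicity of the projections. The diagram hypothesis ensures that
  \<open>\<pi> x \<cdot> m\<close> is again a cone, so that the uniqueness part of the limit
  property applies.\<close>

lemma limit_mono:
  assumes "diagram_on C X le F" "limit_cone C le F X a \<pi>" "m \<in> hom C c a" "m' \<in> hom C c a"
    "\<And>x. x \<in> X \<Longrightarrow> \<pi> x \<cdot> m = \<pi> x \<cdot> m'"
  shows "m = m'"
proof -
  have "cone C le F X c (\<lambda>x. \<pi> x \<cdot> m)"
    by (rule cone_comp[OF diagram_onD(2)[OF assms(1)] limit_coneD(4)[OF assms(2)] assms(3)])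
  then have "\<exists>!w. w \<in> hom C c a \<and> (\<forall>x\<in>X. \<pi> x \<cdot> w = \<pi> x \<cdot> m)"
    using assms(2) unfolding limit_cone_def by blast
  then show ?thesis using assms(3-5) by metis
qed

text \<open>The usual way to evaluate the definite description in \<open>induced\<close>: exhibit an
  arrow with the right projections.\<close>

lemma induced_eqI:
  assumes "diagram_on C X le F" "limit_cone C le F X a \<pi>" "m \<in> hom C c a"
    "\<And>x. x \<in> X \<Longrightarrow> \<pi> x \<cdot> m = \<nu> x"
  shows "induced C X c \<nu> a \<pi> = m"
  unfolding induced_def
  by (rule the_equality) (use assms limit_mono[OF assms(1,2)] in auto)

lemma limit_cone_subset_induced:
  assumes "limit_cone C le F Y a \<pi>" "limit_cone C le F X b \<rho>" "X \<subseteq> Y"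
  shows "induced C X a \<pi> b \<rho> \<in> hom C a b" "x \<in> X \<Longrightarrow> \<rho> x \<cdot> induced C X a \<pi> b \<rho> = \<pi> x"
proof -
  have "cone C le F X a \<pi>" using limit_coneD(4)[OF assms(1)] assms(3) unfolding cone_def by auto
  then show "induced C X a \<pi> b \<rho> \<in> hom C a b" "x \<in> X \<Longrightarrow> \<rho> x \<cdot> induced C X a \<pi> b \<rho> = \<pi> x"
    using induced[OF assms(2)] by auto
qed

text \<open>Composing with the inverses of \<open>\<phi>\<close> turns cones on \<open>G\<close>
  into cones on \<open>F\<close> with the same mediating arrows, so the universal property of
  \<open>a\<close> carries over.\<close>

lemma limit_cone_iso:
  assumes F: "diagram_on C X le F" and G: "diagram_on C X le G"
    and \<phi>: "\<And>x. x \<in> X \<Longrightarrow> \<phi> x \<in> hom C (fob F x) (fob G x)" "\<And>x. x \<in> X \<Longrightarrow> iso_arr C (\<phi> x)"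
    and nat: "\<And>x y. x \<in> X \<Longrightarrow> y \<in> X \<Longrightarrow> le x y \<Longrightarrow> \<phi> x \<cdot> far F (y, x) = far G (y, x) \<cdot> \<phi> y"
    and lim: "limit_cone C le F X a \<pi>"
  shows "limit_cone C le G X a (\<lambda>x. \<phi> x \<cdot> \<pi> x)"
proof -
  note inv = inv_arr[OF \<phi>(2,1)]
  note \<pi> = limit_coneD[OF lim]
  have 1: "far G (y, x) \<cdot> \<phi> y \<cdot> \<pi> y = \<phi> x \<cdot> \<pi> x" if "x \<in> X" "y \<in> X" "le x y" for x y
  proof -
    have "far G (y, x) \<cdot> \<phi> y \<cdot> \<pi> y = (far G (y, x) \<cdot> \<phi> y) \<cdot> \<pi> y"
      using assoc[OF \<pi>(2) \<phi>(1) diagram_onD(2)[OF G]] that by simp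
    also have "\<dots> = \<phi> x \<cdot> far F (y, x) \<cdot> \<pi> y"
      using assoc[OF \<pi>(2) diagram_onD(2)[OF F] \<phi>(1)] nat that by simp
    finally show ?thesis using \<pi>(3) that by simp
  qed
  then have c: "cone C le G X a (\<lambda>x. \<phi> x \<cdot> \<pi> x)"
    using \<pi>(1) comp_hom[OF \<pi>(2) \<phi>(1)] unfolding cone_def by auto
  have "\<exists>!m. m \<in> hom C c a \<and> (\<forall>x\<in>X. (\<phi> x \<cdot> \<pi> x) \<cdot> m = \<nu> x)" if \<nu>: "cone C le G X c \<nu>" for c \<nu>
  proof -
    have \<nu>h: "\<nu> x \<in> hom C c (fob G x)" if "x \<in> X" for x using \<nu> that unfolding cone_def by auto
    have "far F (y, x) \<cdot> inv_arr (\<phi> y) \<cdot> \<nu> y = inv_arr (\<phi> x) \<cdot> \<nu> x"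
      if x: "x \<in> X" and y: "y \<in> X" and le: "le x y" for x y
    proof -
      have h: "inv_arr (\<phi> y) \<cdot> \<nu> y \<in> hom C c (fob F y)"
        using comp_hom[OF \<nu>h inv(1)] y by simp
      \<comment> \<open>Naturality of the inverses is checked after composing with the isomorphism
        \<open>\<phi> x\<close>.\<close>
      have "\<phi> x \<cdot> far F (y, x) \<cdot> inv_arr (\<phi> y) \<cdot> \<nu> y = far G (y, x) \<cdot> \<phi> y \<cdot> inv_arr (\<phi> y) \<cdot> \<nu> y"
        using assoc[OF h diagram_onD(2)[OF F x y le] \<phi>(1)[OF x]]
          assoc[OF h \<phi>(1)[OF y] diagram_onD(2)[OF G x y le]] nat[OF x y le] by simp
      also have "\<dots> = \<nu> x"
        using comp_inv_cancel[OF \<phi>(2,1)[OF y] \<nu>h[OF y]] \<nu> x y le unfolding cone_def by simp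
      finally have "inv_arr (\<phi> x) \<cdot> \<nu> x = inv_arr (\<phi> x) \<cdot> \<phi> x \<cdot> far F (y, x) \<cdot> inv_arr (\<phi> y) \<cdot> \<nu> y"
        by simp
      then show ?thesis
        using inv_comp_cancel[OF \<phi>(2,1)[OF x] comp_hom[OF h diagram_onD(2)[OF F x y le]]] by simp
    qed
    then have "cone C le F X c (\<lambda>x. inv_arr (\<phi> x) \<cdot> \<nu> x)"
      using \<nu> comp_hom[OF \<nu>h inv(1)] unfolding cone_def by auto
    then have *: "\<exists>!m. m \<in> hom C c a \<and> (\<forall>x\<in>X. \<pi> x \<cdot> m = inv_arr (\<phi> x) \<cdot> \<nu> x)"
      using lim unfolding limit_cone_def by blast
    have "\<pi> x \<cdot> m = inv_arr (\<phi> x) \<cdot> \<nu> x \<longleftrightarrow> (\<phi> x \<cdot> \<pi> x) \<cdot> m = \<nu> x"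
      if "x \<in> X" "m \<in> hom C c a" for x m
      using assoc[OF that(2) \<pi>(2)[OF that(1)] \<phi>(1)[OF that(1)]]
        inv_comp_cancel[OF \<phi>(2,1)[OF that(1)] comp_hom[OF that(2) \<pi>(2)[OF that(1)]]]
        comp_inv_cancel[OF \<phi>(2,1)[OF that(1)] \<nu>h[OF that(1)]] by metis
    then have "(m \<in> hom C c a \<and> (\<forall>x\<in>X. \<pi> x \<cdot> m = inv_arr (\<phi> x) \<cdot> \<nu> x)) \<longleftrightarrow>
        (m \<in> hom C c a \<and> (\<forall>x\<in>X. (\<phi> x \<cdot> \<pi> x) \<cdot> m = \<nu> x))" for m by blast
    then show ?thesis using * by simp
  qed
  then show ?thesis using c unfolding limit_cone_def by blast
qed

text \<open>The new direction is \<open>limit_cone_iso\<close> for the inverse isomorphism, whose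
  composite with \<open>\<phi>\<close> cancels on the projections.\<close>

lemma limit_cone_iso_iff:
  assumes F: "diagram_on C X le F" and G: "diagram_on C X le G"
    and \<phi>: "\<And>x. x \<in> X \<Longrightarrow> \<phi> x \<in> hom C (fob F x) (fob G x)" "\<And>x. x \<in> X \<Longrightarrow> iso_arr C (\<phi> x)"
    and nat: "\<And>x y. x \<in> X \<Longrightarrow> y \<in> X \<Longrightarrow> le x y \<Longrightarrow> \<phi> x \<cdot> far F (y, x) = far G (y, x) \<cdot> \<phi> y"
    and \<pi>: "\<And>x. x \<in> X \<Longrightarrow> \<pi> x \<in> hom C a (fob F x)"
  shows "limit_cone C le G X a (\<lambda>x. \<phi> x \<cdot> \<pi> x) \<longleftrightarrow> limit_cone C le F X a \<pi>"
proof
  assume lim: "limit_cone C le G X a (\<lambda>x. \<phi> x \<cdot> \<pi> x)"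
  note inv = inv_arr[OF \<phi>(2,1)]
  have "inv_arr (\<phi> x) \<cdot> far G (y, x) = far F (y, x) \<cdot> inv_arr (\<phi> y)"
    if x: "x \<in> X" and y: "y \<in> X" and le: "le x y" for x y
  proof -
    note Fh = diagram_onD(2)[OF F x y le] and Gh = diagram_onD(2)[OF G x y le]
    have "\<phi> x \<cdot> far F (y, x) \<cdot> inv_arr (\<phi> y) = (far G (y, x) \<cdot> \<phi> y) \<cdot> inv_arr (\<phi> y)"
      using assoc[OF inv(1)[OF y y] Fh \<phi>(1)[OF x]] nat[OF x y le] by simp
    also have "\<dots> = far G (y, x)"
      using assoc[OF inv(1)[OF y y] \<phi>(1)[OF y] Gh] inv(3)[OF y y] id_right[OF Gh] by simp
    finally show ?thesis
      using inv_comp_cancel[OF \<phi>(2,1)[OF x] comp_hom[OF inv(1)[OF y y] Fh]] by simp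
  qed
  with G F \<phi> inv lim have "limit_cone C le F X a (\<lambda>x. inv_arr (\<phi> x) \<cdot> \<phi> x \<cdot> \<pi> x)"
    by (intro limit_cone_iso[of X le G F]) (auto intro: iso_inv_arr)
  then show "limit_cone C le F X a \<pi>"
    using limit_cone_cong[of X \<pi> "\<lambda>x. inv_arr (\<phi> x) \<cdot> \<phi> x \<cdot> \<pi> x"] inv_comp_cancel[OF \<phi>(2,1) \<pi>]
    by simp
qed (use assms in \<open>auto intro!: limit_cone_iso\<close>)

end

section \<open>Calculus of chosen pullback squares: uniqueness, cancellation, inversion\<close>

section \<open>Distinguished squares\<close>

locale precontextual_category =
  fixes C :: "('o, 'm) precat"
  assumes precontextual: "precontextual C"

sublocale precontextual_category \<subseteq> category_of C
  using precontextual unfolding precontextual_def by unfold_locales auto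

context precontextual_category
begin

lemma bd_Obj: "a \<in> Obj C \<Longrightarrow> bd C a \<in> Obj C"
  and len_bd: "a \<in> Obj C \<Longrightarrow> len C a \<ge> 1 \<Longrightarrow> len C (bd C a) = len C a - 1"
  and proj_hom: "a \<in> Obj C \<Longrightarrow> len C a \<ge> 1 \<Longrightarrow> proj C a \<in> hom C a (bd C a)"
  using precontextual unfolding precontextual_def by auto

lemma Src_proj: "a \<in> Obj C \<Longrightarrow> len C a \<ge> 1 \<Longrightarrow> Src C (proj C a) = a"
  using hom_Arr[OF proj_hom] by blast

text \<open>Squares record arrows only. As a projection has its object as source, it determines that
  object, and the corners of a square can be recovered from its sides.\<close>

lemma proj_inj:
  "a \<in> Obj C \<Longrightarrow> b \<in> Obj C \<Longrightarrow> len C a \<ge> 1 \<Longrightarrow> len C b \<ge> 1 \<Longrightarrow> proj C a = proj C b \<Longrightarrow> a = b"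
  by (metis Src_proj)

lemma SqD:
  assumes "(t, l, r, b) \<in> Sq C"
  shows "Src C t \<in> Obj C" "len C (Src C t) \<ge> 1" "l = proj C (Src C t)"
    "l \<in> hom C (Src C t) (bd C (Src C t))"
    "Trg C t \<in> Obj C" "len C (Trg C t) \<ge> 1" "r = proj C (Trg C t)" "r \<in> hom C (Trg C t) (bd C (Trg C t))"
    "t \<in> hom C (Src C t) (Trg C t)" "b \<in> hom C (bd C (Src C t)) (bd C (Trg C t))"
    "r \<cdot> t = b \<cdot> l"
proof -
  have "\<exists>x\<in>Obj C. \<exists>y\<in>Obj C. len C x \<ge> 1 \<and> len C y \<ge> 1 \<and>
        l = proj C x \<and> r = proj C y \<and> t \<in> hom C x y \<and> b \<in> hom C (bd C x) (bd C y) \<and>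
        r \<cdot> t = b \<cdot> l"
    using precontextual assms unfolding precontextual_def by fastforce
  then obtain x y where *: "x\<in>Obj C" "y\<in>Obj C" "len C x \<ge> 1" "len C y \<ge> 1"
        "l = proj C x" "r = proj C y" "t \<in> hom C x y" "b \<in> hom C (bd C x) (bd C y)"
        "r \<cdot> t = b \<cdot> l" by blast
  have "Src C t = x" "Trg C t = y" using hom_Arr[OF *(7)] by auto
  then show "Src C t \<in> Obj C" "len C (Src C t) \<ge> 1" "l = proj C (Src C t)"
    "l \<in> hom C (Src C t) (bd C (Src C t))"
    "Trg C t \<in> Obj C" "len C (Trg C t) \<ge> 1" "r = proj C (Trg C t)" "r \<in> hom C (Trg C t) (bd C (Trg C t))"
    "t \<in> hom C (Src C t) (Trg C t)" "b \<in> hom C (bd C (Src C t)) (bd C (Trg C t))"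
    "r \<cdot> t = b \<cdot> l"
    using * proj_hom by auto
qed

lemma Sq_proj:
  assumes "(t, l, proj C y, b) \<in> Sq C" "y \<in> Obj C" "len C y \<ge> 1"
  shows "Trg C t = y" "t \<in> hom C (Src C t) y" "b \<in> hom C (bd C (Src C t)) (bd C y)"
proof -
  note D = SqD[OF assms(1)]
  show y: "Trg C t = y" using proj_inj[OF D(5) assms(2) D(6) assms(3)] D(7) by simp
  show "t \<in> hom C (Src C t) y" "b \<in> hom C (bd C (Src C t)) (bd C y)"
    using D(9,10) unfolding y by auto
qed

end

locale contextual_category =
  fixes C :: "('o, 'm) precat"
  assumes contextual: "contextual C"

sublocale contextual_category \<subseteq> precontextual_category C
  using contextual unfolding contextual_def by unfold_locales auto

context contextual_category
begin

lemma unit_ob: "unit_ob C \<in> Obj C" "len C (unit_ob C) = 0" "terminal C (unit_ob C)"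
    "a \<in> Obj C \<Longrightarrow> len C a = 0 \<Longrightarrow> a = unit_ob C"
proof -
  have ex: "\<exists>!a. a \<in> Obj C \<and> len C a = 0" using contextual unfolding contextual_def by auto
  from theI'[OF this] show 1: "unit_ob C \<in> Obj C" "len C (unit_ob C) = 0"
    unfolding unit_ob_def by auto
  show "terminal C (unit_ob C)" using contextual 1 unfolding contextual_def by auto
  show "a \<in> Obj C \<Longrightarrow> len C a = 0 \<Longrightarrow> a = unit_ob C" using ex 1 by auto
qed

lemma unit_hom_eq: "f \<in> hom C a (unit_ob C) \<Longrightarrow> g \<in> hom C a (unit_ob C) \<Longrightarrow> f = g"
  using unit_ob(3) hom_Obj unfolding terminal_def by blast

lemma unit_hom_ex: "a \<in> Obj C \<Longrightarrow> \<exists>f. f \<in> hom C a (unit_ob C)"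
  using unit_ob(3) unfolding terminal_def by blast

lemma Sq_ex1:
  assumes "a \<in> Obj C" "len C a \<ge> 1" "f \<in> Arr C" "Trg C f = bd C a"
  shows "\<exists>!q. q \<in> Sq C \<and> (\<exists>t l. q = (t, l, proj C a, f))"
proof -
  have "\<forall>a\<in>Obj C. \<forall>f\<in>Arr C. len C a \<ge> 1 \<and> Trg C f = bd C a \<longrightarrow>
        (\<exists>!q. q \<in> Sq C \<and> (\<exists>t l. q = (t, l, proj C a, f)))"
    using contextual unfolding contextual_def by (elim conjE)
  then show ?thesis using assms by simp
qed

lemma Sq_ex:
  assumes "y \<in> Obj C" "len C y \<ge> 1" "b \<in> hom C c (bd C y)"
  shows "\<exists>t l. (t, l, proj C y, b) \<in> Sq C"
  using ex1_implies_ex[OF Sq_ex1[OF assms(1,2), of b]] hom_Arr[OF assms(3)] by auto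

text \<open>Equality on the nose and not up to isomorphism; all later uniqueness statements rest on
  this.\<close>

lemma Sq_unique:
  assumes "(t, l, r, b) \<in> Sq C" "(t', l', r, b) \<in> Sq C"
  shows "t = t'" "l = l'"
proof -
  note D = SqD[OF assms(1)]
  have "b \<in> Arr C" "Trg C b = bd C (Trg C t)" using hom_Arr[OF D(10)] by auto
  from Sq_ex1[OF D(5,6) this, folded D(7)]
  have "(t, l, r, b) = (t', l', r, b)" using assms by (elim ex1E) (metis (no_types, lifting))
  then show "t = t'" "l = l'" by auto
qed

lemma Sq_comp:
  assumes "(t, l, m, b) \<in> Sq C" "(t', m, r, b') \<in> Sq C"
  shows "(t' \<cdot> t, l, r, b' \<cdot> b) \<in> Sq C"
proof -
  have "\<forall>t l m b t' r b'. (t, l, m, b) \<in> Sq C \<and> (t', m, r, b') \<in> Sq C \<longrightarrow>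
        (t' \<cdot> t, l, r, b' \<cdot> b) \<in> Sq C"
    using contextual unfolding contextual_def by (elim conjE)
  then show ?thesis using assms by blast
qed

lemma Sq_id: "a \<in> Obj C \<Longrightarrow> len C a \<ge> 1 \<Longrightarrow> (Idn C a, proj C a, proj C a, Idn C (bd C a)) \<in> Sq C"
  using contextual unfolding contextual_def by (elim conjE) simp

lemma Sq_pullback:
  assumes "(t, l, r, b) \<in> Sq C" "u \<in> hom C c (Src C r)" "v \<in> hom C c (Src C b)" "r \<cdot> u = b \<cdot> v"
  shows "\<exists>!w. w \<in> hom C c (Src C t) \<and> t \<cdot> w = u \<and> l \<cdot> w = v"
proof -
  have "pullback C (t, l, r, b)"
    using contextual assms(1) unfolding contextual_def by (elim conjE) (rule bspec)
  then show ?thesis using assms(2-4) hom_Obj[OF assms(2)] by auto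
qed

text \<open>The square over \<open>c\<close> with right side \<open>m\<close> exists. Pasted with
  the first square it has the same right side and bottom as the second, so uniqueness identifies the
  two.\<close>

lemma Sq_cancel:
  assumes "(t, m, r, b) \<in> Sq C" "(s, l, r, b \<cdot> c) \<in> Sq C" "c \<in> hom C d (Trg C m)"
  shows "\<exists>u. (u, l, m, c) \<in> Sq C \<and> s = t \<cdot> u"
proof -
  note D = SqD[OF assms(1)]
  have "Trg C m = bd C (Src C t)" using hom_Arr[OF D(4)] by simp
  then obtain u k where u: "(u, k, m, c) \<in> Sq C"
    using Sq_ex[OF D(1,2), of c d] assms(3) unfolding D(3)[symmetric] by auto
  then show ?thesis using Sq_unique[OF Sq_comp[OF u assms(1)] assms(2)] by auto
qed

text \<open>Pulling back along \<open>inv_arr b\<close> gives a square whose pastings with the given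
  one, on either side, lie over identities. By uniqueness these are identity squares, so the two
  tops are mutually inverse.\<close>

lemma Sq_iso:
  assumes "(t, l, r, b) \<in> Sq C" "iso_arr C b"
  shows "iso_arr C t" "(inv_arr t, r, l, inv_arr b) \<in> Sq C"
proof -
  note D = SqD[OF assms(1)]
  note bi = inv_arr[OF assms(2) D(10)]
  obtain s k where s: "(s, k, l, inv_arr b) \<in> Sq C"
    using Sq_ex[OF D(1,2) bi(1)] unfolding D(3)[symmetric] by auto
  have "(t \<cdot> s, k, r, Idn C (bd C (Trg C t))) \<in> Sq C"
    using Sq_comp[OF s assms(1)] unfolding bi(3) .
  from Sq_unique[OF this] Sq_id[OF D(5,6)]
  have ts: "t \<cdot> s = Idn C (Trg C t)" and k: "k = r" unfolding D(7)[symmetric] by blast+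
  have "(s \<cdot> t, l, l, Idn C (bd C (Src C t))) \<in> Sq C"
    using Sq_comp[OF assms(1)] s unfolding bi(2)[symmetric] k by blast
  from Sq_unique[OF this] Sq_id[OF D(1,2)]
  have st: "s \<cdot> t = Idn C (Src C t)" unfolding D(3)[symmetric] by blast
  note E = SqD[OF s]
  have "proj C (Src C s) = proj C (Trg C t)" "proj C (Trg C s) = proj C (Src C t)"
    using E(3,7) D(3,7) k by simp_all
  then have "Src C s = Trg C t" "Trg C s = Src C t"
    using proj_inj[OF E(1) D(5) E(2) D(6)] proj_inj[OF E(5) D(1) E(6) D(2)] by blast+
  then have sh: "s \<in> hom C (Trg C t) (Src C t)" using SqD(9)[OF s] by simp
  show iso: "iso_arr C t" using iso_arrI[OF D(9) sh st ts] .
  have "inv_arr t = s"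
    using iso_mono[OF iso D(9) inv_arr(1)[OF iso D(9)] sh] inv_arr(3)[OF iso D(9)] ts by simp
  then show "(inv_arr t, r, l, inv_arr b) \<in> Sq C" using s k by simp
qed

text \<open>Classification by the number of squares in the vertical composite: none, one, or at
  least two. In the last case only the drop in length along the right side is recorded, which
  suffices to exclude it later.\<close>

lemma distinguished_cases:
  assumes "distinguished C (t, l, r, b)"
  shows "r = Idn C (Trg C t) \<and> l = Idn C (Src C t) \<and> t = b \<and> t \<in> Arr C \<or>
     (t, l, r, b) \<in> Sq C \<or> (\<exists>x y. r \<in> hom C x y \<and> len C y + 2 \<le> len C x)"
proof -
  \<comment> \<open>\<open>Src C r = Trg C t\<close> is added to the induction claim: it locates the
    source of the right side of the lower composite, so that the drops in length add up.\<close>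
  have "case q of (t, l, r, b) \<Rightarrow> Src C r = Trg C t \<and> (r = Idn C (Trg C t) \<and> l = Idn C (Src C t) \<and> t = b \<and> t \<in> Arr C \<or>
     (t, l, r, b) \<in> Sq C \<or> (\<exists>x y. r \<in> hom C x y \<and> len C y + 2 \<le> len C x))"
    if "distinguished C q" for q
    using that
  proof induction
    case (distinguished_step t l r m l' r' b)
    note D = SqD[OF distinguished_step(1)]
    have len: "len C (Trg C t) = len C (bd C (Trg C t)) + 1" using len_bd[OF D(5,6)] D(6) by simp
    have e: "Trg C m = bd C (Trg C t)" using hom_Arr[OF D(10)] by simp
    consider "r' = Idn C (Trg C m)" "l' = Idn C (Src C m)" "m = b" | "(m, l', r', b) \<in> Sq C"
      | x y where "r' \<in> hom C x y" "len C y + 2 \<le> len C x" "Src C r' = Trg C m"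
      using distinguished_step.IH by auto
    then show ?case
    proof cases
      case 1
      then have "r' \<cdot> r = r" "l' \<cdot> l = l"
        using id_left[OF D(4)] id_left[OF D(8)] hom_Arr[OF D(10)] by simp_all
      then show ?thesis using distinguished_step(1) 1 hom_Arr[OF D(8)] by simp
    next
      case 2
      note E = SqD[OF 2]
      have h: "r' \<cdot> r \<in> hom C (Trg C t) (bd C (bd C (Trg C t)))" using comp_hom D(8) E(8) e by auto
      moreover have "len C (bd C (bd C (Trg C t))) + 2 \<le> len C (Trg C t)"
        using len len_bd[OF E(5,6)] E(6) e by simp
      ultimately show ?thesis using hom_Arr[OF h] by auto
    next
      case 3
      then have h: "r' \<cdot> r \<in> hom C (Trg C t) y"
        using comp_hom[OF D(8), of r' y] hom_Arr[OF 3(1)] e by auto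
      moreover have "len C y + 2 \<le> len C (Trg C t)"
        using 3 len hom_Arr[OF 3(1)] e by simp
      ultimately show ?thesis using hom_Arr[OF h] by auto
    qed
  next
    case (distinguished_id f)
    then show ?case using hom_Arr[OF id_hom] hom_Obj[OF Arr_hom] by simp
  qed
  from this[OF assms] show ?thesis by simp
qed

text \<open>A projection drops the length by exactly one, which rules out identities and longer
  composites as right side.\<close>

lemma distinguished_iff:
  assumes "a \<in> Obj C" "len C a \<ge> 1"
  shows "distinguished C (t, l, proj C a, b) \<longleftrightarrow> (t, l, proj C a, b) \<in> Sq C"
proof
  assume d: "distinguished C (t, l, proj C a, b)"
  have "False" if "proj C a \<in> hom C x y" "len C y + 1 \<noteq> len C x" for x y
  proof -
    have "x = a" "y = bd C a" using hom_Arr[OF that(1)] hom_Arr[OF proj_hom[OF assms]] by auto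
    then show False using that(2) len_bd[OF assms] assms(2) by simp
  qed
  moreover have "Idn C (Trg C t) \<in> hom C (Trg C t) (Trg C t)" if "t \<in> Arr C"
    using id_hom hom_Obj[OF Arr_hom[OF that]] by blast
  ultimately show "(t, l, proj C a, b) \<in> Sq C"
    using distinguished_cases[OF d] by fastforce
next
  assume Sq: "(t, l, proj C a, b) \<in> Sq C"
  note D = SqD[OF Sq]
  have "distinguished C (b, Idn C (Src C b), Idn C (Trg C b), b)"
    using hom_Arr[OF D(10)] by (intro distinguished_id) simp
  from distinguished_step[OF Sq this] show "distinguished C (t, l, proj C a, b)"
    using id_left[OF D(4)] id_left[OF D(8)] hom_Arr[OF D(10)] by simp
qed

text \<open>Lengths leave room for exactly one factor: the identity drops nothing, and a second step
  would lower the length twice.\<close>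

lemma display_length_1:
  assumes "display C a b m" "len C a = len C b + 1"
  shows "a \<in> Obj C" "len C a \<ge> 1" "b = bd C a" "m = proj C a"
proof -
  have *: "a \<in> Obj C \<and> len C a \<ge> 1 \<and> b = bd C a \<and> m = proj C a"
    using assms
  proof cases
    case (display_step m')
    have "display C (bd C a) b m'" using display_step by simp
    then show ?thesis
    proof cases
      case display_id
      then show ?thesis using display_step id_left[OF proj_hom] by auto
    next
      case (display_step m'')
      then have "len C b \<le> len C (bd C (bd C a))" using display_len[OF precontextual] by blast
      then show ?thesis using display_step \<open>1 \<le> len C a\<close> \<open>a \<in> Obj C\<close> assms(2) len_bd bd_Obj by simp
    qed
  qed simp
  then show "a \<in> Obj C" "len C a \<ge> 1" "b = bd C a" "m = proj C a" by auto
qed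

lemma display_proj: "a \<in> Obj C \<Longrightarrow> len C a \<ge> 1 \<Longrightarrow> display C a (bd C a) (proj C a)"
  using display_step[of a C "bd C a" "Idn C (bd C a)"] display_id[OF bd_Obj] id_left[OF proj_hom]
  by simp

end

section \<open>Limits over finite sieves, built by adjoining one largest element at a time\<close>

section \<open>Towers of limits over sieves\<close>

lemma sdown_down: "poset P le \<Longrightarrow> y \<in> P \<Longrightarrow> x \<in> down P le y \<Longrightarrow> sdown (down P le y) le x = sdown P le x"
  and down_down: "poset P le \<Longrightarrow> y \<in> P \<Longrightarrow> x \<in> down P le y \<Longrightarrow> down (down P le y) le x = down P le x"
  unfolding poset_def down_def sdown_def by blast+

locale linearized_poset =
  fixes P :: "'p set" and le lin :: "'p \<Rightarrow> 'p \<Rightarrow> bool"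
  assumes fin: "finite P" and poset: "poset P le" and linearization: "linearization P le lin"
begin

lemma le_refl: "x \<in> P \<Longrightarrow> le x x"
  and le_antisym: "x \<in> P \<Longrightarrow> y \<in> P \<Longrightarrow> le x y \<Longrightarrow> le y x \<Longrightarrow> x = y"
  and le_trans: "x \<in> P \<Longrightarrow> y \<in> P \<Longrightarrow> z \<in> P \<Longrightarrow> le x y \<Longrightarrow> le y z \<Longrightarrow> le x z"
  using poset unfolding poset_def by blast+

lemma lin_refl: "x \<in> P \<Longrightarrow> lin x x"
  and lin_antisym: "x \<in> P \<Longrightarrow> y \<in> P \<Longrightarrow> lin x y \<Longrightarrow> lin y x \<Longrightarrow> x = y"
  and lin_trans: "x \<in> P \<Longrightarrow> y \<in> P \<Longrightarrow> z \<in> P \<Longrightarrow> lin x y \<Longrightarrow> lin y z \<Longrightarrow> lin x z"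
  and lin_total: "x \<in> P \<Longrightarrow> y \<in> P \<Longrightarrow> lin x y \<or> lin y x"
  and le_lin: "x \<in> P \<Longrightarrow> y \<in> P \<Longrightarrow> le x y \<Longrightarrow> lin x y"
  using linearization unfolding linearization_def poset_def by blast+

text \<open>A nonempty sieve \<open>X\<close> arises from \<open>X - {y}\<close> by adjoining its
  \<open>lin\<close>-largest element, which is the shape of extension occurring in the cellularity
  axioms.\<close>

definition top_of :: "'p set \<Rightarrow> 'p \<Rightarrow> bool" where
  "top_of X y \<longleftrightarrow> sieve P le X \<and> y \<in> X \<and> (\<forall>x\<in>X. lin x y)"

lemma sieveD: "sieve P le X \<Longrightarrow> X \<subseteq> P" "sieve P le X \<Longrightarrow> x \<in> X \<Longrightarrow> y \<in> P \<Longrightarrow> le y x \<Longrightarrow> y \<in> X"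
  unfolding sieve_def by blast+

lemma top_ex:
  assumes "sieve P le X" "X \<noteq> {}"
  shows "\<exists>y. top_of X y"
proof -
  have "finite X" "X \<subseteq> P" using assms fin finite_subset unfolding sieve_def by auto
  from this(1) assms(2) this(2) have "\<exists>y\<in>X. \<forall>x\<in>X. lin x y"
  proof (induction rule: finite_ne_induct)
    case (singleton x)
    then show ?case using lin_refl by auto
  next
    case (insert x F)
    then obtain y where y: "y \<in> F" "\<forall>z\<in>F. lin z y" by blast
    show ?case
    proof (cases "lin x y")
      case True
      then show ?thesis using y by blast
    next
      case False
      then have "lin y x" using lin_total insert.prems y by blast
      then have "\<forall>z\<in>F. lin z x" using y insert.prems lin_trans by (meson insert_subset subset_iff)
      then show ?thesis using lin_refl insert.prems by blast
    qed
  qed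
  then show ?thesis using assms unfolding top_of_def by blast
qed

lemma top_unique: "top_of X y \<Longrightarrow> top_of X z \<Longrightarrow> y = z"
  unfolding top_of_def using lin_antisym sieveD(1) by blast

text \<open>As \<open>lin\<close> refines \<open>le\<close>, the last element of the linear order is
  maximal in the partial one; this is what keeps \<open>X - {y}\<close> a sieve.\<close>

lemma top_maximal: "top_of X y \<Longrightarrow> x \<in> X \<Longrightarrow> le y x \<Longrightarrow> x = y"
  unfolding top_of_def using lin_antisym le_lin sieveD(1) by (meson subsetD)

lemma sieve_minus: "top_of X y \<Longrightarrow> sieve P le (X - {y})"
  using top_maximal[of X y] unfolding top_of_def sieve_def by blast

lemma sdown_subset: "top_of X y \<Longrightarrow> sdown P le y \<subseteq> X - {y}"
  unfolding top_of_def sieve_def sdown_def by blast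

lemma down_subset: "sieve P le X \<Longrightarrow> y \<in> X \<Longrightarrow> down P le y \<subseteq> X"
  unfolding sieve_def down_def by blast

lemma sieve_down: "y \<in> P \<Longrightarrow> sieve P le (down P le y)"
  unfolding sieve_def down_def using le_trans by blast

lemma top_down: "y \<in> P \<Longrightarrow> top_of (down P le y) y"
  using sieve_down le_refl le_lin unfolding top_of_def by (auto simp: down_def)

lemma down_minus: "down P le y - {y} = sdown P le y"
  unfolding down_def sdown_def by blast

lemma sieve_sdown: "y \<in> P \<Longrightarrow> sieve P le (sdown P le y)"
  using sieve_minus[OF top_down] down_minus by simp

lemma down_self: "y \<in> P \<Longrightarrow> y \<in> down P le y"
  using le_refl unfolding down_def by blast

lemma top_insert:
  assumes "sieve P le X" "sieve P le Y" "X \<subseteq> Y" "Y - X = {y}" "\<forall>x\<in>X. lin x y"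
  shows "top_of Y y" "X = Y - {y}"
proof -
  have "y \<in> Y" "Y = insert y X" "y \<notin> X" using assms by blast+
  moreover have "y \<in> P" using \<open>y \<in> Y\<close> assms(2) sieveD(1) by blast
  ultimately show "top_of Y y" "X = Y - {y}" using assms lin_refl unfolding top_of_def by auto
qed

text \<open>Two smaller sieves enter: \<open>X - {y}\<close> carries the limit to be extended, and
  \<open>sdown P le y\<close> carries the boundary of \<open>y\<close>. Both omit \<open>y\<close>
  and are proper subsets of \<open>X\<close>.\<close>

lemma sieve_induct [consumes 1, case_names empty top]:
  assumes "sieve P le X" "Q {}"
    and "\<And>X y. top_of X y \<Longrightarrow> Q (X - {y}) \<Longrightarrow> Q (sdown P le y) \<Longrightarrow> Q X"
  shows "Q X"
proof -
  have "finite X" using assms(1) fin finite_subset unfolding sieve_def by auto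
  then show ?thesis using assms(1)
  proof (induction X rule: finite_psubset_induct)
    case (psubset X)
    show ?case
    proof (cases "X = {}")
      case False
      then obtain y where y: "top_of X y" using top_ex psubset.prems by blast
      then have "y \<in> X" "y \<in> P" unfolding top_of_def using sieveD(1) by blast+
      then show ?thesis
        using assms(3)[OF y] psubset.IH[of "X - {y}"] psubset.IH[of "sdown P le y"]
          sieve_minus[OF y] sdown_subset[OF y] sieve_sdown by blast
    qed (use assms in simp)
  qed
qed

end

text \<open>The input needed to adjoin \<open>y\<close>: the boundary of \<open>G y\<close> is a
  limit over everything strictly below, and the projection of \<open>G y\<close> is the canonical
  arrow to it. No linear order occurs, so the notion is stable under permutation of factors.\<close>

definition latching :: "('o, 'm) precat \<Rightarrow> 'p set \<Rightarrow> ('p \<Rightarrow> 'p \<Rightarrow> bool)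
    \<Rightarrow> ('p, 'p \<times> 'p, 'o, 'm) ftr \<Rightarrow> ('p \<Rightarrow> 'o) \<Rightarrow> ('p \<Rightarrow> 'p \<Rightarrow> 'm) \<Rightarrow> bool" where
  "latching C P le G g \<rho> \<longleftrightarrow> (\<forall>y\<in>P. len C (fob G y) \<ge> 1 \<and> bd C (fob G y) = g y \<and>
     limit_cone C le G (sdown P le y) (g y) (\<rho> y) \<and>
     (\<forall>x\<in>sdown P le y. Cmp C (\<rho> y x) (proj C (fob G y)) = far G (y, x)))"

text \<open>
  The diagram \<open>G\<close> may be cellular for a linearization other than \<open>lin\<close>, so the limit chosen for the
  principal sieve of \<open>y\<close> need not be \<open>G y\<close>, but is only isomorphic to it.
\<close>

definition tower :: "('o, 'm) precat \<Rightarrow> 'p set \<Rightarrow> ('p \<Rightarrow> 'p \<Rightarrow> bool) \<Rightarrow> ('p \<Rightarrow> 'p \<Rightarrow> bool)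
    \<Rightarrow> ('p, 'p \<times> 'p, 'o, 'm) ftr \<Rightarrow> ('p \<Rightarrow> 'o) \<Rightarrow> ('p \<Rightarrow> 'p \<Rightarrow> 'm)
    \<Rightarrow> ('p set \<Rightarrow> 'o) \<Rightarrow> ('p set \<Rightarrow> 'p \<Rightarrow> 'm) \<Rightarrow> bool" where
  "tower C P le lin G g \<rho> a \<pi> \<longleftrightarrow>
     (\<forall>X. sieve P le X \<longrightarrow> limit_cone C le G X (a X) (\<pi> X)) \<and> a {} = unit_ob C \<and>
     (\<forall>X y. sieve P le X \<and> y \<in> X \<and> (\<forall>x\<in>X. lin x y) \<longrightarrow>
        (\<pi> X y, induced C (X - {y}) (a X) (\<pi> X) (a (X - {y})) (\<pi> (X - {y})), proj C (fob G y),
         induced C (sdown P le y) (a (X - {y})) (\<pi> (X - {y})) (g y) (\<rho> y)) \<in> Sq C)"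

context contextual_category
begin

text \<open>A cone on \<open>Y\<close> is a cone on \<open>X\<close> together with an arrow to
  \<open>G y\<close> that is compatible over \<open>S\<close>, the part of \<open>X\<close> below
  the maximal element \<open>y\<close>. So the limit over \<open>Y\<close> is the pullback of
  \<open>G y\<close> and the limit over \<open>X\<close> over the limit over
  \<open>S\<close>.\<close>

lemma limit_cone_step:
  assumes G: "diagram_on C Y le G" and y: "y \<in> Y" and X: "X = Y - {y}"
    and max: "\<And>x. x \<in> Y \<Longrightarrow> le y x \<Longrightarrow> x = y"
    and S: "S = {x \<in> X. le x y}"
    and a: "limit_cone C le G X a \<pi>" and g: "limit_cone C le G S g \<rho>"
    and p: "p \<in> hom C (fob G y) g" "\<And>x. x \<in> S \<Longrightarrow> \<rho> x \<cdot> p = far G (y, x)"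
    and Sq: "(t, l, p, induced C S a \<pi> g \<rho>) \<in> Sq C"
    and \<pi>': "\<pi>' y = t" "\<And>x. x \<in> X \<Longrightarrow> \<pi>' x = \<pi> x \<cdot> l"
  shows "limit_cone C le G Y (Src C t) \<pi>'"
proof -
  let ?b = "induced C S a \<pi> g \<rho>"
  note D = SqD[OF Sq]
  have SX: "S \<subseteq> X" and SY: "S \<subseteq> Y" and XY: "X \<subseteq> Y" using S X by auto
  note b = limit_cone_subset_induced[OF a g SX]
  note GX = diagram_on_subset[OF G XY] and GS = diagram_on_subset[OF G SY]
  have T: "Trg C t = fob G y" using hom_Arr[OF D(8)] hom_Arr[OF p(1)] by simp
  have "bd C (Src C t) = a" using hom_Arr[OF D(10)] hom_Arr[OF b(1)] by simp
  then have th: "t \<in> hom C (Src C t) (fob G y)" and lh: "l \<in> hom C (Src C t) a"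
    using D(4,9) T by simp_all
  note \<pi> = limit_coneD[OF a] and \<rho> = limit_coneD[OF g]
  note Gh = diagram_onD(2)[OF G]
  have ph: "\<pi>' x \<in> hom C (Src C t) (fob G x)" if "x \<in> Y" for x
    using that comp_hom[OF lh \<pi>(2)] th \<pi>' X by (cases "x = y") auto
  have c: "cone C le G Y (Src C t) \<pi>'"
    unfolding cone_def
  proof (intro conjI ballI impI)
    fix x z assume x: "x \<in> Y" and z: "z \<in> Y" and le: "le x z"
    \<comment> \<open>By maximality of \<open>y\<close>, apart from reflexivity the only relations
      involving \<open>y\<close> come from elements of \<open>S\<close>.\<close>
    consider "x = y" | "x \<in> X" "z \<in> X" | "x \<in> S" "z = y" using x z le max[of z] X S by auto
    then show "far G (z, x) \<cdot> \<pi>' z = \<pi>' x"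
    proof cases
      case 1
      then have "z = y" using max[OF z] le by simp
      then show ?thesis using 1 \<pi>'(1) diagram_onD(3)[OF G y] id_left[OF th] by simp
    next
      case 2
      then show ?thesis using \<pi>'(2) \<pi>(3)[OF 2 le] assoc[OF lh \<pi>(2)[OF 2(2)] Gh[OF x z le]] by simp
    next
      case 3
      then have xX: "x \<in> X" using SX by blast
      have "far G (z, x) \<cdot> \<pi>' z = (\<rho> x \<cdot> p) \<cdot> t" using 3 p(2) \<pi>'(1) by simp
      also have "\<dots> = \<rho> x \<cdot> ?b \<cdot> l" using assoc[OF th p(1) \<rho>(2)] 3 D(11) by simp
      also have "\<dots> = \<pi> x \<cdot> l" using assoc[OF lh b(1) \<rho>(2)[OF 3(1)]] b(2)[OF 3(1)] by simp
      finally show ?thesis using \<pi>'(2)[OF xX] by simp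
    qed
  qed (use ph hom_Obj[OF th] in auto)
  have "\<exists>!m. m \<in> hom C c (Src C t) \<and> (\<forall>x\<in>Y. \<pi>' x \<cdot> m = \<nu> x)" if \<nu>: "cone C le G Y c \<nu>" for c \<nu>
  proof -
    have \<nu>X: "cone C le G X c \<nu>" using \<nu> XY unfolding cone_def by blast
    have \<nu>y: "\<nu> y \<in> hom C c (fob G y)" using \<nu> y unfolding cone_def by blast
    let ?u = "induced C X c \<nu> a \<pi>"
    note u = induced[OF a \<nu>X]
    \<comment> \<open>The compatibility that the pullback property asks for; it is tested on the
      projections \<open>\<rho>\<close>.\<close>
    have "p \<cdot> \<nu> y = ?b \<cdot> ?u"
    proof (rule limit_mono[OF GS g comp_hom[OF \<nu>y p(1)] comp_hom[OF u(1) b(1)]])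
      fix x assume x: "x \<in> S"
      then have xX: "x \<in> X" and xY: "x \<in> Y" and xy: "le x y" using SX SY S by auto
      have "\<rho> x \<cdot> p \<cdot> \<nu> y = \<nu> x"
        using assoc[OF \<nu>y p(1) \<rho>(2)[OF x]] p(2)[OF x] \<nu> xY y xy unfolding cone_def by simp
      also have "\<nu> x = \<rho> x \<cdot> ?b \<cdot> ?u"
        using assoc[OF u(1) b(1) \<rho>(2)[OF x]] b(2)[OF x] u(2)[OF xX] by simp
      finally show "\<rho> x \<cdot> p \<cdot> \<nu> y = \<rho> x \<cdot> ?b \<cdot> ?u" .
    qed
    then have ex: "\<exists>!w. w \<in> hom C c (Src C t) \<and> t \<cdot> w = \<nu> y \<and> l \<cdot> w = ?u"
      using Sq_pullback[OF Sq, of "\<nu> y" c ?u] \<nu>y u(1) hom_Arr[OF p(1)] hom_Arr[OF b(1)] by simp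
    \<comment> \<open>The equations indexed by \<open>X\<close> amount to the single equation
      \<open>l \<cdot> w = ?u\<close>, because the projections of the limit over \<open>X\<close>
      are jointly monic.\<close>
    have "(\<forall>x\<in>Y. \<pi>' x \<cdot> w = \<nu> x) \<longleftrightarrow> t \<cdot> w = \<nu> y \<and> l \<cdot> w = ?u" if w: "w \<in> hom C c (Src C t)" for w
    proof -
      have e: "\<pi>' x \<cdot> w = \<pi> x \<cdot> l \<cdot> w" if "x \<in> X" for x
        using assoc[OF w lh \<pi>(2)[OF that]] \<pi>'(2)[OF that] by simp
      have "l \<cdot> w = ?u" if "\<forall>x\<in>X. \<pi>' x \<cdot> w = \<nu> x"
        by (rule limit_mono[OF GX a comp_hom[OF w lh] u(1)]) (use that e u(2) in simp)
      then show ?thesis using \<pi>'(1) e u(2) y X by (metis Diff_iff singletonD)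
    qed
    then have "(w \<in> hom C c (Src C t) \<and> (\<forall>x\<in>Y. \<pi>' x \<cdot> w = \<nu> x)) \<longleftrightarrow>
        (w \<in> hom C c (Src C t) \<and> t \<cdot> w = \<nu> y \<and> l \<cdot> w = ?u)" for w by blast
    then show ?thesis using ex by simp
  qed
  then show ?thesis using c unfolding limit_cone_def by blast
qed

lemma limit_cone_empty: "limit_cone C le G {} (unit_ob C) \<nu>"
  using unit_ob(1,3) unfolding limit_cone_def cone_def terminal_def by auto

end

locale linearized_diagrams = contextual_category C + linearized_poset P le lin
  for C :: "('o, 'm) precat" and P :: "'p set" and le lin
begin

lemma towerD:
  assumes "tower C P le lin G g \<rho> a \<pi>"
  shows "sieve P le X \<Longrightarrow> limit_cone C le G X (a X) (\<pi> X)" "a {} = unit_ob C"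
    "top_of X y \<Longrightarrow>
       (\<pi> X y, induced C (X - {y}) (a X) (\<pi> X) (a (X - {y})) (\<pi> (X - {y})), proj C (fob G y),
        induced C (sdown P le y) (a (X - {y})) (\<pi> (X - {y})) (g y) (\<rho> y)) \<in> Sq C"
  using assms unfolding tower_def top_of_def by blast+

lemma latchingD:
  assumes "latching C P le G g \<rho>" "y \<in> P"
  shows "len C (fob G y) \<ge> 1" "bd C (fob G y) = g y" "limit_cone C le G (sdown P le y) (g y) (\<rho> y)"
    "x \<in> sdown P le y \<Longrightarrow> \<rho> y x \<cdot> proj C (fob G y) = far G (y, x)"
  using assms unfolding latching_def by blast+

lemma sdown_Int_sieve: "sieve P le X \<Longrightarrow> y \<in> X \<Longrightarrow> sdown P le y = {x \<in> X - {y}. le x y}"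
  unfolding sieve_def sdown_def by blast

lemma tower_unique:
  assumes "linearized_poset P' le lin"
    and T: "tower C P le lin G g \<rho> a \<pi>" and T': "tower C P' le lin G g' \<rho>' a' \<pi>'"
    and g: "\<And>y. y \<in> P \<Longrightarrow> y \<in> P' \<Longrightarrow> sdown P' le y = sdown P le y \<Longrightarrow>
        a (sdown P le y) = a' (sdown P le y) \<Longrightarrow>
        (\<And>x. x \<in> sdown P le y \<Longrightarrow> \<pi> (sdown P le y) x = \<pi>' (sdown P le y) x) \<Longrightarrow>
        g y = g' y \<and> (\<forall>x\<in>sdown P le y. \<rho> y x = \<rho>' y x)"
    and X: "sieve P le X" "sieve P' le X"
  shows "a X = a' X \<and> (\<forall>x\<in>X. \<pi> X x = \<pi>' X x)"
  using X
proof (induction X rule: sieve_induct)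
  case empty
  then show ?case using towerD(2)[OF T] T' unfolding tower_def by simp
next
  case (top X y)
  interpret P': linearized_diagrams C P' le lin
    using assms(1) contextual_category_axioms unfolding linearized_diagrams_def by blast
  have X: "sieve P le X" and y: "y \<in> X" "y \<in> P" using top.hyps sieveD(1) unfolding top_of_def by blast+
  have y': "y \<in> P'" using top.prems y P'.sieveD(1) by blast
  have top': "P'.top_of X y" using top.hyps top.prems unfolding top_of_def P'.top_of_def by blast
  let ?X = "X - {y}" and ?S = "sdown P le y"
  have S': "sdown P' le y = ?S"
    using sdown_Int_sieve[OF X y(1)] P'.sdown_Int_sieve[OF top.prems y(1)] by simp
  have IX: "a ?X = a' ?X" "\<And>x. x \<in> ?X \<Longrightarrow> \<pi> ?X x = \<pi>' ?X x"
    using top.IH(1) P'.sieve_minus[OF top'] by auto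
  have "sieve P' le ?S" using P'.sieve_sdown[OF y'] S' by simp
  then have IS: "g y = g' y" "\<And>x. x \<in> ?S \<Longrightarrow> \<rho> y x = \<rho>' y x"
    using top.IH(2) g[OF y(2) y' S'] by auto
  have SX: "?S \<subseteq> ?X" using sdown_subset[OF top.hyps] .
  have "induced C ?S (a ?X) (\<pi> ?X) (g y) (\<rho> y) = induced C ?S (a' ?X) (\<pi>' ?X) (g' y) (\<rho>' y)"
    unfolding IX(1) IS(1) by (rule induced_cong) (use IX(2) IS(2) SX in auto)
  with towerD(3)[OF T top.hyps] P'.towerD(3)[OF T' top']
  have t: "\<pi> X y = \<pi>' X y"
    and l: "induced C ?X (a X) (\<pi> X) (a ?X) (\<pi> ?X) = induced C ?X (a' X) (\<pi>' X) (a' ?X) (\<pi>' ?X)"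
    using Sq_unique unfolding S' by metis+
  note L = towerD(1)[OF T X] and L' = P'.towerD(1)[OF T' top.prems]
  \<comment> \<open>The apex is recovered as the source of the projection to
    \<open>y\<close>.\<close>
  have "a X = a' X"
    using limit_coneD(2)[OF L y(1)] limit_coneD(2)[OF L' y(1)] t unfolding hom_def by auto
  \<comment> \<open>The projections at \<open>x \<noteq> y\<close> factor through the left side of
    the square, which is already known to agree.\<close>
  moreover have "\<pi> X x = \<pi>' X x" if "x \<in> X" for x
  proof (cases "x = y")
    case False
    then have x: "x \<in> ?X" using that by simp
    show ?thesis
      using limit_cone_subset_induced(2)[OF L towerD(1)[OF T sieve_minus[OF top.hyps]] _ x]
        limit_cone_subset_induced(2)[OF L' P'.towerD(1)[OF T' P'.sieve_minus[OF top']] _ x]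
        l IX(2)[OF x] by auto
  qed (use t in simp)
  ultimately show ?case by blast
qed

lemma cellular_choiceD:
  assumes "cellular_choice C P le lin F a \<pi>"
  defines "m \<equiv> \<lambda>Y X. induced C X (a Y) (\<pi> Y) (a X) (\<pi> X)"
  shows "sieve P le X \<Longrightarrow> limit_cone C le F X (a X) (\<pi> X)" "a {} = unit_ob C"
    "x \<in> P \<Longrightarrow> a (down P le x) = fob F x"
    "x \<in> P \<Longrightarrow> y \<in> down P le x \<Longrightarrow> \<pi> (down P le x) y = far F (x, y)"
    "top_of Y y \<Longrightarrow> display C (a Y) (a (Y - {y})) (m Y (Y - {y}))"
    "top_of Y y \<Longrightarrow> len C (a Y) = len C (a (Y - {y})) + 1"
    "sieve P le X \<Longrightarrow> sieve P le Y \<Longrightarrow> sieve P le X' \<Longrightarrow> sieve P le Y' \<Longrightarrow> X \<subseteq> X' \<Longrightarrow> Y \<subseteq> Y' \<Longrightarrow>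
       X \<subseteq> Y \<Longrightarrow> X' \<subseteq> Y' \<Longrightarrow> Y - X = {y} \<Longrightarrow> Y' - X' = {y} \<Longrightarrow> (\<forall>x\<in>X'. lin x y) \<Longrightarrow>
       distinguished C (m Y' Y, m Y' X', m Y X, m X' X)"
proof -
  note D = assms(1)[unfolded cellular_choice_def Let_def]
  note D1 = conjunct1[OF D] and D2 = conjunct1[OF conjunct2[OF D]]
    and D3 = conjunct1[OF conjunct2[OF conjunct2[OF D]]]
    and D4 = conjunct1[OF conjunct2[OF conjunct2[OF conjunct2[OF D]]]]
    and D5 = conjunct2[OF conjunct2[OF conjunct2[OF conjunct2[OF D]]]]
  show "sieve P le X \<Longrightarrow> limit_cone C le F X (a X) (\<pi> X)" using D1 by blast
  show "a {} = unit_ob C" using D2 .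
  show "x \<in> P \<Longrightarrow> a (down P le x) = fob F x"
    "x \<in> P \<Longrightarrow> y \<in> down P le x \<Longrightarrow> \<pi> (down P le x) y = far F (x, y)"
    using D3 by blast+
  { assume t: "top_of Y y"
    then have *: "sieve P le (Y - {y}) \<and> sieve P le Y \<and> Y - {y} \<subseteq> Y \<and> Y - (Y - {y}) = {y} \<and>
        (\<forall>x\<in>Y-{y}. lin x y)"
      using sieve_minus unfolding top_of_def by blast
    from D4[rule_format, OF this]
    show "display C (a Y) (a (Y - {y})) (m Y (Y - {y}))" "len C (a Y) = len C (a (Y - {y})) + 1"
      unfolding m_def by auto }
  show "distinguished C (m Y' Y, m Y' X', m Y X, m X' X)"
    if "sieve P le X" "sieve P le Y" "sieve P le X'" "sieve P le Y'" "X \<subseteq> X'" "Y \<subseteq> Y'"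
       "X \<subseteq> Y" "X' \<subseteq> Y'" "Y - X = {y}" "Y' - X' = {y}" "\<forall>x\<in>X'. lin x y"
    using D5[rule_format, of X Y X' Y' y] that unfolding m_def by blast
qed

text \<open>The square axiom is applied to \<open>sdown P le y\<close> and
  \<open>down P le y\<close> inside \<open>X - {y}\<close> and \<open>X\<close>. Its right side is
  then the display map \<open>F y \<rightarrow> F[\<partial>y]\<close>, so cellularity already
  contains the recursion defining a tower.\<close>

lemma cellular_choice_tower:
  assumes F: "diagram_on C P le F" and ch: "cellular_choice C P le lin F a \<pi>"
  defines "g \<equiv> \<lambda>y. a (sdown P le y)" and "\<rho> \<equiv> \<lambda>y. \<pi> (sdown P le y)"
  shows "latching C P le F g \<rho>" "tower C P le lin F g \<rho> a \<pi>"
proof -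
  let ?m = "\<lambda>Y X. induced C X (a Y) (\<pi> Y) (a X) (\<pi> X)"
  note D = cellular_choiceD[OF ch]
  have p: "len C (fob F y) \<ge> 1" "bd C (fob F y) = g y" "proj C (fob F y) = ?m (down P le y) (sdown P le y)"
    if y: "y \<in> P" for y
    using display_length_1[OF D(5)[OF top_down[OF y]] D(6)[OF top_down[OF y]]] D(3)[OF y]
    unfolding down_minus g_def by auto
  show "latching C P le F g \<rho>"
    unfolding latching_def
  proof (intro ballI conjI)
    fix y assume y: "y \<in> P"
    show "len C (fob F y) \<ge> 1" "bd C (fob F y) = g y" using p[OF y] by auto
    show "limit_cone C le F (sdown P le y) (g y) (\<rho> y)"
      using D(1)[OF sieve_sdown[OF y]] unfolding g_def \<rho>_def .
    fix x assume x: "x \<in> sdown P le y"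
    then have x': "x \<in> down P le y" unfolding sdown_def down_def by blast
    show "\<rho> y x \<cdot> proj C (fob F y) = far F (y, x)"
      using limit_cone_subset_induced(2)[OF D(1)[OF sieve_down[OF y]] D(1)[OF sieve_sdown[OF y]] _ x]
        D(4)[OF y x'] p(3)[OF y] down_minus[of y] unfolding \<rho>_def by auto
  qed
  show "tower C P le lin F g \<rho> a \<pi>"
    unfolding tower_def
  proof (intro conjI allI impI)
    fix X y assume "sieve P le X \<and> y \<in> X \<and> (\<forall>x\<in>X. lin x y)"
    then have t: "top_of X y" and X: "sieve P le X" and yX: "y \<in> X" unfolding top_of_def by auto
    then have y: "y \<in> P" using sieveD(1) by blast
    note sX = sieve_minus[OF t]
    note dX = down_subset[OF X yX]
    have "distinguished C (?m X (down P le y), ?m X (X - {y}), ?m (down P le y) (sdown P le y),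
        ?m (X - {y}) (sdown P le y))"
      by (rule D(7)[OF sieve_sdown[OF y] sieve_down[OF y] sX X sdown_subset[OF t] dX, of y])
         (use t y yX down_minus[of y] down_self[OF y] in \<open>auto simp: top_of_def sdown_def down_def\<close>)
    then have "(?m X (down P le y), ?m X (X - {y}), proj C (fob F y), ?m (X - {y}) (sdown P le y)) \<in> Sq C"
      using distinguished_iff[OF diagram_onD(1)[OF F y] p(1)[OF y]] p(3)[OF y] by simp
    \<comment> \<open>The cone on a principal sieve is given by \<open>F\<close>, so its projection
      at \<open>y\<close> is an identity and the canonical arrow to \<open>F y\<close> is the
      projection itself.\<close>
    moreover have "?m X (down P le y) = \<pi> X y"
    proof -
      note I = limit_cone_subset_induced[OF D(1)[OF X] D(1)[OF sieve_down[OF y]] dX]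
      have "Idn C (fob F y) \<cdot> ?m X (down P le y) = \<pi> X y"
        using I(2)[OF down_self[OF y]] D(4)[OF y down_self[OF y]] diagram_onD(3)[OF F y] by simp
      then show ?thesis using id_left[of "?m X (down P le y)"] I(1) D(3)[OF y] by simp
    qed
    ultimately show "(\<pi> X y, ?m X (X - {y}), proj C (fob F y),
        induced C (sdown P le y) (a (X - {y})) (\<pi> (X - {y})) (g y) (\<rho> y)) \<in> Sq C"
      unfolding g_def \<rho>_def by simp
  qed (use D in auto)
qed

text \<open>Makes \<open>F[X]\<close> independent of the principal sieve in which it is computed.
  Here \<open>g\<close> and \<open>\<rho>\<close> are values of the two choices, so the hypothesis
  of \<open>tower_unique\<close> on them is trivially met.\<close>

lemma cellular_choice_unique:
  assumes P': "linearized_poset P' le lin"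
    and F: "diagram_on C P le F" "diagram_on C P' le F"
    and ch: "cellular_choice C P le lin F a \<pi>" "cellular_choice C P' le lin F a' \<pi>'"
    and X: "sieve P le X" "sieve P' le X"
  shows "a X = a' X \<and> (\<forall>x\<in>X. \<pi> X x = \<pi>' X x)"
proof -
  interpret P': linearized_diagrams C P' le lin
    using P' contextual_category_axioms unfolding linearized_diagrams_def by blast
  have T: "tower C P le lin F (\<lambda>y. a (sdown P le y)) (\<lambda>y. \<pi> (sdown P le y)) a \<pi>"
    "tower C P' le lin F (\<lambda>y. a' (sdown P' le y)) (\<lambda>y. \<pi>' (sdown P' le y)) a' \<pi>'"
    using cellular_choice_tower(2)[OF F(1) ch(1)] P'.cellular_choice_tower(2)[OF F(2) ch(2)] by auto
  show ?thesis by (rule tower_unique[OF P' T _ X]) auto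
qed

end

context linearized_diagrams
begin

lemma down_sieve_top:
  assumes "top_of X y"
  shows "sieve P le X" "y \<in> X" "y \<in> P" "X \<subseteq> P"
  using assms sieveD(1) unfolding top_of_def by blast+

text \<open>Each tower square for \<open>G\<close> is a tower square for the cellular diagram
  \<open>G'\<close> pasted with the given square for \<open>\<phi> y\<close>. This converts a
  shuffling diagram into a tower, from which uniqueness is read off.\<close>

lemma tower_transport:
  assumes G: "diagram_on C P le G" and G': "diagram_on C P le G'"
    and L: "latching C P le G g \<rho>" and ch: "cellular_choice C P le lin G' a \<pi>"
    and \<phi>: "\<And>x. x \<in> P \<Longrightarrow> \<phi> x \<in> hom C (fob G' x) (fob G x)" "\<And>x. x \<in> P \<Longrightarrow> iso_arr C (\<phi> x)"
    and nat: "\<And>x y. x \<in> P \<Longrightarrow> y \<in> P \<Longrightarrow> le x y \<Longrightarrow> \<phi> x \<cdot> far G' (y, x) = far G (y, x) \<cdot> \<phi> y"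
    and Sq: "\<And>y. y \<in> P \<Longrightarrow> (\<phi> y, proj C (fob G' y), proj C (fob G y),
        induced C (sdown P le y) (a (sdown P le y)) (\<lambda>x. \<phi> x \<cdot> \<pi> (sdown P le y) x) (g y) (\<rho> y)) \<in> Sq C"
  shows "tower C P le lin G g \<rho> a (\<lambda>X x. \<phi> x \<cdot> \<pi> X x)"
proof -
  note T = cellular_choice_tower(2)[OF G' ch]
  have lim: "limit_cone C le G X (a X) (\<lambda>x. \<phi> x \<cdot> \<pi> X x)" if X: "sieve P le X" for X
  proof -
    have "X \<subseteq> P" using X sieveD(1) by blast
    then show ?thesis
      by (intro limit_cone_iso[of X le G' G] diagram_on_subset[OF G] diagram_on_subset[OF G']
          \<phi> nat cellular_choiceD(1)[OF ch X]) auto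
  qed
  show ?thesis
    unfolding tower_def
  proof (intro conjI allI impI)
    fix X y assume "sieve P le X \<and> y \<in> X \<and> (\<forall>x\<in>X. lin x y)"
    then have t: "top_of X y" unfolding top_of_def by auto
    note X = down_sieve_top[OF t]
    let ?X = "X - {y}" and ?S = "sdown P le y"
    note sX = sieve_minus[OF t] and SX = sdown_subset[OF t] and sS = sieve_sdown[OF X(3)]
    note L' = latchingD[OF L X(3)]
    let ?m = "induced C ?X (a X) (\<pi> X) (a ?X) (\<pi> ?X)"
    let ?i = "induced C ?S (a ?X) (\<pi> ?X) (a ?S) (\<pi> ?S)"
    let ?k = "induced C ?S (a ?S) (\<lambda>x. \<phi> x \<cdot> \<pi> ?S x) (g y) (\<rho> y)"
    note lX = cellular_choiceD(1)[OF ch X(1)] and lX' = cellular_choiceD(1)[OF ch sX]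
      and lS = cellular_choiceD(1)[OF ch sS]
    note m = limit_cone_subset_induced[OF lX lX' Diff_subset]
      and i = limit_cone_subset_induced[OF lX' lS SX]
      and k = induced[OF L'(3) limit_coneD(4)[OF lim[OF sS]]]
    have "(\<phi> y \<cdot> \<pi> X y, ?m, proj C (fob G y), ?k \<cdot> ?i) \<in> Sq C"
      using Sq_comp[OF towerD(3)[OF T t] Sq[OF X(3)]] .
    \<comment> \<open>Canonical arrows between apexes do not change when all projections are
      composed with \<open>\<phi>\<close>.\<close>
    moreover have "induced C ?X (a X) (\<lambda>x. \<phi> x \<cdot> \<pi> X x) (a ?X) (\<lambda>x. \<phi> x \<cdot> \<pi> ?X x) = ?m"
    proof (rule induced_eqI[OF diagram_on_subset[OF G] lim[OF sX] m(1)])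
      fix x assume x: "x \<in> ?X"
      then have xP: "x \<in> P" using X(4) by blast
      show "(\<phi> x \<cdot> \<pi> ?X x) \<cdot> ?m = \<phi> x \<cdot> \<pi> X x"
        using assoc[OF m(1) limit_coneD(2)[OF lX' x] \<phi>(1)[OF xP]] m(2)[OF x] by simp
    qed (use X(4) in auto)
    moreover have "induced C ?S (a ?X) (\<lambda>x. \<phi> x \<cdot> \<pi> ?X x) (g y) (\<rho> y) = ?k \<cdot> ?i"
    proof (rule induced_eqI[OF diagram_on_subset[OF G] L'(3) comp_hom[OF i(1) k(1)]])
      fix x assume x: "x \<in> ?S"
      then have xP: "x \<in> P" using SX X(4) by blast
      have "\<rho> y x \<cdot> ?k \<cdot> ?i = (\<phi> x \<cdot> \<pi> ?S x) \<cdot> ?i"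
        using assoc[OF i(1) k(1) limit_coneD(2)[OF L'(3) x]] k(2)[OF x] by simp
      also have "\<dots> = \<phi> x \<cdot> \<pi> ?X x"
        using assoc[OF i(1) limit_coneD(2)[OF lS x] \<phi>(1)[OF xP]] i(2)[OF x] by simp
      finally show "\<rho> y x \<cdot> ?k \<cdot> ?i = \<phi> x \<cdot> \<pi> ?X x" .
    qed (use SX X(4) in auto)
    ultimately show "(\<phi> y \<cdot> \<pi> X y, induced C ?X (a X) (\<lambda>x. \<phi> x \<cdot> \<pi> X x) (a ?X) (\<lambda>x. \<phi> x \<cdot> \<pi> ?X x),
       proj C (fob G y), induced C ?S (a ?X) (\<lambda>x. \<phi> x \<cdot> \<pi> ?X x) (g y) (\<rho> y)) \<in> Sq C"
      by simp
  qed (use lim cellular_choiceD(2)[OF ch] in auto)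
qed

text \<open>The left side of a square in \<open>Sq\<close> is always the projection of its upper
  left corner, so tower squares automatically yield the length-1 display maps that cellularity
  demands.\<close>

lemma tower_proj:
  assumes G: "diagram_on C P le G" and T: "tower C P le lin G g \<rho> a \<pi>" and t: "top_of X y"
  shows "a X \<in> Obj C" "len C (a X) \<ge> 1" "bd C (a X) = a (X - {y})"
    "induced C (X - {y}) (a X) (\<pi> X) (a (X - {y})) (\<pi> (X - {y})) = proj C (a X)"
proof -
  note X = down_sieve_top[OF t]
  note Sq = towerD(3)[OF T t] and lX = towerD(1)[OF T X(1)]
  note S = SqD[OF Sq]
  have s: "Src C (\<pi> X y) = a X" using hom_Arr[OF limit_coneD(2)[OF lX X(2)]] by simp
  show "a X \<in> Obj C" "len C (a X) \<ge> 1"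
    "induced C (X - {y}) (a X) (\<pi> X) (a (X - {y})) (\<pi> (X - {y})) = proj C (a X)"
    using S s by simp_all
  show "bd C (a X) = a (X - {y})"
    using S(4) limit_cone_subset_induced(1)[OF lX towerD(1)[OF T sieve_minus[OF t]] Diff_subset] s
    unfolding hom_def by simp
qed

text \<open>\<open>x\<close> is the greatest element of its principal sieve, so \<open>G x\<close>
  with its structure maps is a cone there, and the arrow it induces to the apex inverts the
  projection.\<close>

lemma tower_iso:
  assumes G: "diagram_on C P le G" and T: "tower C P le lin G g \<rho> a \<pi>" and x: "x \<in> P"
  shows "\<pi> (down P le x) x \<in> hom C (a (down P le x)) (fob G x)" "iso_arr C (\<pi> (down P le x) x)"
proof -
  let ?D = "down P le x"
  note lim = towerD(1)[OF T sieve_down[OF x]]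
  note D = limit_coneD[OF lim]
  have DP: "y \<in> P" "le y x" if "y \<in> ?D" for y using that unfolding down_def by auto
  note xD = down_self[OF x]
  note Gx = diagram_onD[OF G]
  show h: "\<pi> ?D x \<in> hom C (a ?D) (fob G x)" using D(2)[OF xD] .
  have c: "cone C le G ?D (fob G x) (\<lambda>y. far G (x, y))"
    unfolding cone_def using Gx(1)[OF x] Gx(2)[OF DP(1) x DP(2)] Gx(4)[OF DP(1) DP(1) x _ DP(2)] by blast
  let ?i = "induced C ?D (fob G x) (\<lambda>y. far G (x, y)) (a ?D) (\<pi> ?D)"
  note i = induced[OF lim c]
  have 1: "\<pi> ?D x \<cdot> ?i = Idn C (fob G x)" using i(2)[OF xD] Gx(3)[OF x] by simp
  have "?i \<cdot> \<pi> ?D x = Idn C (a ?D)"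
  proof (rule limit_mono[OF diagram_on_subset[OF G] lim comp_hom[OF h i(1)] id_hom[OF D(1)]])
    fix y assume y: "y \<in> ?D"
    have "\<pi> ?D y \<cdot> ?i \<cdot> \<pi> ?D x = far G (x, y) \<cdot> \<pi> ?D x"
      using assoc[OF h i(1) D(2)[OF y]] i(2)[OF y] by simp
    then show "\<pi> ?D y \<cdot> ?i \<cdot> \<pi> ?D x = \<pi> ?D y \<cdot> Idn C (a ?D)"
      using D(3)[OF y xD DP(2)[OF y]] id_right[OF D(2)[OF y]] by simp
  qed (use DP in auto)
  then show "iso_arr C (\<pi> ?D x)" using iso_arrI[OF h i(1)] 1 by simp
qed

lemma tower_Sq_down:
  assumes G: "diagram_on C P le G" and T: "tower C P le lin G g \<rho> a \<pi>" and y: "y \<in> P"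
  defines "D \<equiv> down P le y" and "S \<equiv> sdown P le y"
  shows "(\<pi> D y, proj C (a D), proj C (fob G y), induced C S (a S) (\<pi> S) (g y) (\<rho> y)) \<in> Sq C"
  using towerD(3)[OF T top_down[OF y]] tower_proj(4)[OF G T top_down[OF y]]
  unfolding down_minus D_def S_def by simp

text \<open>\<open>G'\<close> takes the apexes over principal sieves as values and is conjugate to
  \<open>G\<close> by the top projections. Correcting all projections by the inverse isomorphisms
  makes the cone of a principal sieve consist of the structure maps of \<open>G'\<close>. The
  squares for nested sieves come from cancelling one tower square against another with the same
  right side.\<close>

lemma tower_cellular_choice:
  assumes G: "diagram_on C P le G" and G': "diagram_on C P le G'"
    and L: "latching C P le G g \<rho>" and T: "tower C P le lin G g \<rho> a \<pi>"
    and ob: "\<And>x. x \<in> P \<Longrightarrow> fob G' x = a (down P le x)"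
    and nat: "\<And>x y. x \<in> P \<Longrightarrow> y \<in> P \<Longrightarrow> le x y \<Longrightarrow>
        \<pi> (down P le x) x \<cdot> far G' (y, x) = far G (y, x) \<cdot> \<pi> (down P le y) y"
  defines "\<pi>' \<equiv> \<lambda>X x. inv_arr (\<pi> (down P le x) x) \<cdot> \<pi> X x"
  shows "cellular_choice C P le lin G' a \<pi>'"
proof -
  let ?\<phi> = "\<lambda>x. \<pi> (down P le x) x"
  have \<phi>: "?\<phi> x \<in> hom C (fob G' x) (fob G x)" "iso_arr C (?\<phi> x)" if "x \<in> P" for x
    using tower_iso[OF G T that] ob[OF that] by simp_all
  note limT = towerD(1)[OF T]
  have \<pi>'h: "\<pi>' X x \<in> hom C (a X) (fob G' x)" and \<phi>\<pi>': "?\<phi> x \<cdot> \<pi>' X x = \<pi> X x"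
    if X: "sieve P le X" and x: "x \<in> X" for X x
  proof -
    have xP: "x \<in> P" using X x sieveD(1) by blast
    show "\<pi>' X x \<in> hom C (a X) (fob G' x)" "?\<phi> x \<cdot> \<pi>' X x = \<pi> X x"
      using comp_hom[OF limit_coneD(2)[OF limT[OF X] x] inv_arr(1)[OF \<phi>(2,1)[OF xP]]]
        comp_inv_cancel[OF \<phi>(2,1)[OF xP] limit_coneD(2)[OF limT[OF X] x]] unfolding \<pi>'_def by auto
  qed
  have lim: "limit_cone C le G' X (a X) (\<pi>' X)" if X: "sieve P le X" for X
  proof -
    have XP: "X \<subseteq> P" using X sieveD(1) by blast
    have "limit_cone C le G X (a X) (\<lambda>x. ?\<phi> x \<cdot> \<pi>' X x)"
      using limit_cone_cong[of X "\<lambda>x. ?\<phi> x \<cdot> \<pi>' X x" "\<pi> X" le G "a X"] \<phi>\<pi>'[OF X] limT[OF X] by simp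
    moreover have "limit_cone C le G X (a X) (\<lambda>x. ?\<phi> x \<cdot> \<pi>' X x) = limit_cone C le G' X (a X) (\<pi>' X)"
      using XP by (intro limit_cone_iso_iff[of X le G' G] diagram_on_subset[OF G]
        diagram_on_subset[OF G'] \<phi> nat \<pi>'h[OF X]) auto
    ultimately show ?thesis by simp
  qed
  let ?m = "\<lambda>Y X. induced C X (a Y) (\<pi> Y) (a X) (\<pi> X)"
  \<comment> \<open>The correction cancels in canonical arrows between apexes, so these can still be
    computed in the tower for \<open>G\<close>.\<close>
  have ind: "induced C X (a Y) (\<pi>' Y) (a X) (\<pi>' X) = ?m Y X"
    if X: "sieve P le X" and Y: "sieve P le Y" and XY: "X \<subseteq> Y" for X Y
  proof -
    have XP: "X \<subseteq> P" using X sieveD(1) by blast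
    note i = limit_cone_subset_induced[OF limT[OF Y] limT[OF X] XY]
    show ?thesis
    proof (rule induced_eqI[OF diagram_on_subset[OF G' XP] lim[OF X] i(1)])
      fix x assume x: "x \<in> X"
      then have xP: "x \<in> P" and xY: "x \<in> Y" using XP XY by auto
      have "?\<phi> x \<cdot> \<pi>' X x \<cdot> ?m Y X = ?\<phi> x \<cdot> \<pi>' Y x"
        using assoc[OF i(1) \<pi>'h[OF X x] \<phi>(1)[OF xP]] \<phi>\<pi>'[OF X x] \<phi>\<pi>'[OF Y xY] i(2)[OF x] by simp
      then show "\<pi>' X x \<cdot> ?m Y X = \<pi>' Y x"
        using iso_mono[OF \<phi>(2,1)[OF xP] comp_hom[OF i(1) \<pi>'h[OF X x]] \<pi>'h[OF Y xY]] by simp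
    qed
  qed
  show ?thesis
    unfolding cellular_choice_def Let_def
  proof (intro conjI allI ballI impI; (elim conjE)?)
    show "a {} = unit_ob C" using towerD(2)[OF T] .
    show "\<And>X. sieve P le X \<Longrightarrow> limit_cone C le G' X (a X) (\<pi>' X)" by (fact lim)
    show "\<And>x. x \<in> P \<Longrightarrow> a (down P le x) = fob G' x" by (simp add: ob)
    fix x y assume x: "x \<in> P" and y: "y \<in> down P le x"
    then have yP: "y \<in> P" and le: "le y x" unfolding down_def by auto
    note D = sieve_down[OF x]
    have "?\<phi> y \<cdot> \<pi>' (down P le x) y = ?\<phi> y \<cdot> far G' (x, y)"
      using \<phi>\<pi>'[OF D y] nat[OF yP x le] limit_coneD(3)[OF limT[OF D] y down_self[OF x] le] by simp
    then show "\<pi>' (down P le x) y = far G' (x, y)"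
      using iso_mono[OF \<phi>(2,1)[OF yP] _ diagram_onD(2)[OF G' yP x le]] \<pi>'h[OF D y] ob[OF x] by simp
  next
    fix X Y y assume A: "sieve P le X" "sieve P le Y" "X \<subseteq> Y" "Y - X = {y}" "\<forall>x\<in>X. lin x y"
    note t = top_insert[OF A]
    note p = tower_proj[OF G T t(1), folded t(2)]
    show "display C (a Y) (a X) (induced C X (a Y) (\<pi>' Y) (a X) (\<pi>' X))"
      using display_proj[OF p(1,2)] p(3,4) ind[OF A(1,2,3)] by simp
    show "len C (a Y) = len C (a X) + 1" using len_bd[OF p(1,2)] p(2,3) by simp
  next
    fix X Y X' Y' y
    assume s: "sieve P le X" "sieve P le Y" "sieve P le X'" "sieve P le Y'"
      and c: "X \<subseteq> X'" "Y \<subseteq> Y'" "X \<subseteq> Y" "X' \<subseteq> Y'" and y: "Y - X = {y}" "Y' - X' = {y}"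
      and l: "\<forall>x\<in>X'. lin x y"
    have t: "top_of Y y" "X = Y - {y}" using top_insert[OF s(1,2) c(3) y(1)] l c(1) by blast+
    note t' = top_insert[OF s(3,4) c(4) y(2) l]
    note p = tower_proj[OF G T t(1), folded t(2)]
    note Y = down_sieve_top[OF t(1)]
    let ?S = "sdown P le y"
    note S = sieve_sdown[OF Y(3)] and SX = sdown_subset[OF t(1), folded t(2)]
    note L' = latchingD[OF L Y(3)]
    let ?b = "induced C ?S (a X) (\<pi> X) (g y) (\<rho> y)"
    note b = limit_cone_subset_induced[OF limT[OF s(1)] L'(3) SX]
      and c1 = limit_cone_subset_induced[OF limT[OF s(3)] limT[OF s(1)] c(1)]
      and c2 = limit_cone_subset_induced[OF limT[OF s(4)] limT[OF s(2)] c(2)]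
      and m = limit_cone_subset_induced[OF limT[OF s(2)] limT[OF s(1)] c(3)]
      and m' = limit_cone_subset_induced[OF limT[OF s(4)] limT[OF s(3)] c(4)]
    \<comment> \<open>The bottom of the tower square for \<open>Y'\<close> factors through that for
      \<open>Y\<close>, the configuration required by \<open>Sq_cancel\<close>.\<close>
    have "induced C ?S (a X') (\<pi> X') (g y) (\<rho> y) = ?b \<cdot> ?m X' X"
    proof (rule induced_eqI[OF diagram_on_subset[OF G] L'(3) comp_hom[OF c1(1) b(1)]])
      fix x assume x: "x \<in> ?S"
      then show "\<rho> y x \<cdot> ?b \<cdot> ?m X' X = \<pi> X' x"
        using assoc[OF c1(1) b(1) limit_coneD(2)[OF L'(3) x]] b(2)[OF x] c1(2)[of x] SX by auto
    qed (use S sieveD in auto)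
    with towerD(3)[OF T t'(1), folded t'(2)]
    have "(\<pi> Y' y, ?m Y' X', proj C (fob G y), ?b \<cdot> ?m X' X) \<in> Sq C" by simp
    from Sq_cancel[OF towerD(3)[OF T t(1), folded t(2)] this, of "a X'"] c1(1) m(1)
    obtain u where u: "(u, ?m Y' X', ?m Y X, ?m X' X) \<in> Sq C" "\<pi> Y' y = \<pi> Y y \<cdot> u"
      by (auto simp: hom_def)
    note U = SqD[OF u(1)]
    have "Src C u = a Y'" using hom_Arr[OF U(4)] hom_Arr[OF m'(1)] by simp
    moreover have "Trg C u = a Y" using hom_Arr[OF U(8)] hom_Arr[OF m(1)] by simp
    ultimately have uh: "u \<in> hom C (a Y') (a Y)" using U(9) by simp
    \<comment> \<open>Cancellation fixes the projection of \<open>u\<close> at \<open>y\<close>; the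
      other projections follow from commutativity of the cancelled square.\<close>
    have "u = ?m Y' Y"
    proof (rule limit_mono[OF diagram_on_subset[OF G Y(4)] limT[OF s(2)] uh c2(1)])
      fix x assume x: "x \<in> Y"
      show "\<pi> Y x \<cdot> u = \<pi> Y x \<cdot> ?m Y' Y"
      proof (cases "x = y")
        case False
        then have xX: "x \<in> X" using x t(2) by simp
        have "\<pi> Y x \<cdot> u = \<pi> X x \<cdot> ?m Y X \<cdot> u"
          using assoc[OF uh m(1) limit_coneD(2)[OF limT[OF s(1)] xX]] m(2)[OF xX] by simp
        also have "\<dots> = \<pi> X x \<cdot> ?m X' X \<cdot> ?m Y' X'" using U(11) by simp
        also have "\<dots> = \<pi> Y' x"
          using assoc[OF m'(1) c1(1) limit_coneD(2)[OF limT[OF s(1)] xX]] c1(2)[OF xX] m'(2)[of x] xX c(1)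
          by auto
        finally show ?thesis using c2(2)[OF x] by simp
      qed (use u(2) c2(2)[OF x] in simp)
    qed
    moreover have "distinguished C (u, ?m Y' X', ?m Y X, ?m X' X)"
      using distinguished_iff[OF p(1,2)] u(1) p(4) by simp
    ultimately show "distinguished C (induced C Y (a Y') (\<pi>' Y') (a Y) (\<pi>' Y),
        induced C X' (a Y') (\<pi>' Y') (a X') (\<pi>' X'), induced C X (a Y) (\<pi>' Y) (a X) (\<pi>' X),
        induced C X (a X') (\<pi>' X') (a X) (\<pi>' X))"
      using ind s c by simp
  qed
qed

end

locale tower_data = linearized_diagrams C P le lin
  for C :: "('o, 'm) precat" and P :: "'p set" and le lin +
  fixes G :: "('p, 'p \<times> 'p, 'o, 'm) ftr" and g :: "'p \<Rightarrow> 'o" and \<rho> :: "'p \<Rightarrow> 'p \<Rightarrow> 'm"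
  assumes diagram: "diagram_on C P le G" and latching: "latching C P le G g \<rho>"
begin

text \<open>Apex and projections are computed together because each step needs both.
  \<open>q\<close> is the pair of top and left side; choosing it by \<open>SOME\<close> is harmless
  since the square is unique. Sets without a \<open>lin\<close>-largest element, in particular the
  empty sieve, get the terminal object.\<close>

function tow :: "'p set \<Rightarrow> 'o \<times> ('p \<Rightarrow> 'm)" where
  "tow X = (if \<exists>y. top_of X y then
     (let y = (THE y. top_of X y); c = tow (X - {y});
        q = (SOME q. (fst q, snd q, proj C (fob G y), induced C (sdown P le y) (fst c) (snd c) (g y) (\<rho> y)) \<in> Sq C)
      in (Src C (fst q), \<lambda>x. if x = y then fst q else snd c x \<cdot> snd q))
     else (unit_ob C, \<lambda>_. undefined))"
  by pat_completeness auto
termination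
proof (relation "measure card")
  fix X y assume "\<exists>y. top_of X y" and y: "y = (THE y. top_of X y)"
  then obtain z where z: "top_of X z" by blast
  then have "y = z" using y top_unique by blast
  moreover have "finite X" using down_sieve_top(4)[OF z] fin finite_subset by blast
  ultimately show "(X - {y}, X) \<in> measure card"
    using card_Diff1_less[of X z] down_sieve_top(2)[OF z] by simp
qed simp

declare tow.simps [simp del]

lemma tow_empty: "tow {} = (unit_ob C, \<lambda>_. undefined)"
  unfolding tow.simps[of "{}"] top_of_def by simp

lemma tow_step:
  assumes t: "top_of X y"
    and ex: "\<exists>t l. (t, l, proj C (fob G y),
      induced C (sdown P le y) (fst (tow (X - {y}))) (snd (tow (X - {y}))) (g y) (\<rho> y)) \<in> Sq C"
  obtains t l where "(t, l, proj C (fob G y),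
      induced C (sdown P le y) (fst (tow (X - {y}))) (snd (tow (X - {y}))) (g y) (\<rho> y)) \<in> Sq C"
    "tow X = (Src C t, \<lambda>x. if x = y then t else snd (tow (X - {y})) x \<cdot> l)"
proof -
  define q where "q = (SOME q. (fst q, snd q, proj C (fob G y),
      induced C (sdown P le y) (fst (tow (X - {y}))) (snd (tow (X - {y}))) (g y) (\<rho> y)) \<in> Sq C)"
  have y: "(THE y. top_of X y) = y" using t top_unique by blast
  have "tow X = (Src C (fst q), \<lambda>x. if x = y then fst q else snd (tow (X - {y})) x \<cdot> snd q)"
    using t unfolding tow.simps[of X] Let_def y q_def by auto
  moreover have "\<exists>q. (fst q, snd q, proj C (fob G y),
      induced C (sdown P le y) (fst (tow (X - {y}))) (snd (tow (X - {y}))) (g y) (\<rho> y)) \<in> Sq C"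
    using ex by force
  from someI_ex[OF this, folded q_def] have "(fst q, snd q, proj C (fob G y),
      induced C (sdown P le y) (fst (tow (X - {y}))) (snd (tow (X - {y}))) (g y) (\<rho> y)) \<in> Sq C" .
  ultimately show thesis using that by blast
qed

text \<open>The limit property is assumed for \<open>X - {y}\<close> only, so that this serves as
  the inductive step of \<open>tow_limit\<close> and afterwards supplies the tower squares.\<close>

lemma tow_spec:
  assumes t: "top_of X y" and lim: "limit_cone C le G (X - {y}) (fst (tow (X - {y}))) (snd (tow (X - {y})))"
  shows "limit_cone C le G X (fst (tow X)) (snd (tow X))"
    "(snd (tow X) y, induced C (X - {y}) (fst (tow X)) (snd (tow X)) (fst (tow (X - {y}))) (snd (tow (X - {y}))),
      proj C (fob G y),
      induced C (sdown P le y) (fst (tow (X - {y}))) (snd (tow (X - {y}))) (g y) (\<rho> y)) \<in> Sq C"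
proof -
  note X = down_sieve_top[OF t]
  let ?X = "X - {y}" and ?S = "sdown P le y"
  let ?a = "fst (tow ?X)" and ?\<pi> = "snd (tow ?X)"
  note L = latchingD[OF latching X(3)]
  note Gy = diagram_onD(1)[OF diagram X(3)]
  have p: "proj C (fob G y) \<in> hom C (fob G y) (g y)" using proj_hom[OF Gy L(1)] L(2) by simp
  note SX = sdown_subset[OF t]
  note b = limit_cone_subset_induced[OF lim L(3) SX]
  obtain t l where Sq: "(t, l, proj C (fob G y), induced C ?S ?a ?\<pi> (g y) (\<rho> y)) \<in> Sq C"
    and tX: "tow X = (Src C t, \<lambda>x. if x = y then t else ?\<pi> x \<cdot> l)"
    by (rule tow_step[OF assms(1)]) (use Sq_ex[OF Gy L(1), of _ ?a] b(1) L(2) in auto)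
  show limX: "limit_cone C le G X (fst (tow X)) (snd (tow X))"
    unfolding tX fst_conv snd_conv
    by (rule limit_cone_step[OF diagram_on_subset[OF diagram X(4)] X(2) refl _ _ lim L(3) p _ Sq])
      (use top_maximal[OF assms(1)] sdown_Int_sieve[OF X(1,2)] L(4) in auto)
  note D = SqD[OF Sq]
  have "bd C (Src C t) = ?a" using hom_Arr[OF D(10)] hom_Arr[OF b(1)] by simp
  then have lh: "l \<in> hom C (fst (tow X)) ?a" using D(4) tX by simp
  have "induced C ?X (fst (tow X)) (snd (tow X)) ?a ?\<pi> = l"
    by (rule induced_eqI[OF diagram_on_subset[OF diagram] lim lh]) (use X(4) tX in auto)
  then show "(snd (tow X) y, induced C ?X (fst (tow X)) (snd (tow X)) ?a ?\<pi>,
      proj C (fob G y), induced C ?S ?a ?\<pi> (g y) (\<rho> y)) \<in> Sq C"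
    using Sq tX by simp
qed

lemma tow_limit: "sieve P le X \<Longrightarrow> limit_cone C le G X (fst (tow X)) (snd (tow X))"
proof (induction X rule: sieve_induct)
  case empty
  then show ?case using limit_cone_empty by (simp add: tow_empty)
next
  case (top X y)
  then show ?case using tow_spec(1) by blast
qed

lemma tower_tow: "tower C P le lin G g \<rho> (\<lambda>X. fst (tow X)) (\<lambda>X. snd (tow X))"
  unfolding tower_def
proof (intro conjI allI impI)
  fix X y assume "sieve P le X \<and> y \<in> X \<and> (\<forall>x\<in>X. lin x y)"
  then have t: "top_of X y" unfolding top_of_def by auto
  show "(snd (tow X) y, induced C (X - {y}) (fst (tow X)) (snd (tow X)) (fst (tow (X - {y}))) (snd (tow (X - {y}))),
      proj C (fob G y),
      induced C (sdown P le y) (fst (tow (X - {y}))) (snd (tow (X - {y}))) (g y) (\<rho> y)) \<in> Sq C"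
    by (rule tow_spec(2)[OF t tow_limit[OF sieve_minus[OF t]]])
qed (use tow_limit tow_empty in auto)

end

lemma (in linearized_diagrams) tower_ex:
  assumes "diagram_on C P le G" "latching C P le G g \<rho>"
  shows "\<exists>a \<pi>. tower C P le lin G g \<rho> a \<pi>"
proof -
  interpret tower_data C P le lin G g \<rho> by unfold_locales (use assms in auto)
  show ?thesis using tower_tow by blast
qed

section \<open>Transport of cellular choices along poset isomorphisms and contextual
  functors\<close>

section \<open>Reindexing and images of cellular diagrams\<close>

lemma limit_cone_reindex:
  assumes inj: "inj_on u X"
    and le: "\<And>x y. x \<in> X \<Longrightarrow> y \<in> X \<Longrightarrow> le x y \<longleftrightarrow> le' (u x) (u y)"
    and G: "\<And>x. x \<in> X \<Longrightarrow> fob G x = fob F (u x)"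
      "\<And>x y. x \<in> X \<Longrightarrow> y \<in> X \<Longrightarrow> le x y \<Longrightarrow> far G (y, x) = far F (u y, u x)"
    and lim: "limit_cone C le' F (u ` X) c \<pi>"
  shows "limit_cone C le G X c (\<lambda>x. \<pi> (u x))"
  unfolding limit_cone_def
proof (intro conjI allI impI)
  have 1: "cone C le G X d (\<lambda>x. \<nu> (u x)) \<longleftrightarrow> cone C le' F (u ` X) d \<nu>" for d \<nu>
    unfolding cone_def using le G by auto
  show "cone C le G X c (\<lambda>x. \<pi> (u x))" using lim 1 unfolding limit_cone_def by blast
  fix d \<nu> assume \<nu>: "cone C le G X d \<nu>"
  let ?\<nu> = "\<lambda>z. \<nu> (inv_into X u z)"
  have e: "?\<nu> (u x) = \<nu> x" if "x \<in> X" for x using inj that by simp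
  have "cone C le G X d (\<lambda>x. ?\<nu> (u x))" using \<nu> e unfolding cone_def by simp
  then have "cone C le' F (u ` X) d ?\<nu>" using 1[of d ?\<nu>] by blast
  then have "\<exists>!m. m \<in> hom C d c \<and> (\<forall>z\<in>u ` X. Cmp C (\<pi> z) m = ?\<nu> z)"
    using lim unfolding limit_cone_def by blast
  then show "\<exists>!m. m \<in> hom C d c \<and> (\<forall>x\<in>X. Cmp C (\<pi> (u x)) m = \<nu> x)" using e by simp
qed

lemma induced_reindex: "induced C (u ` X) c \<nu> a \<pi> = induced C X c (\<lambda>x. \<nu> (u x)) a (\<lambda>x. \<pi> (u x))"
  unfolding induced_def by simp

text \<open>Here \<open>u\<close> must respect \<open>lin\<close> as well as \<open>le\<close>.
  Contextual functors on the factors do so below a fixed element, whereas a permutation of the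
  factors in general does not.\<close>

lemma cellular_choice_reindex:
  assumes u: "bij_betw u P P'"
    and le: "\<And>x y. x \<in> P \<Longrightarrow> y \<in> P \<Longrightarrow> le x y \<longleftrightarrow> le' (u x) (u y)"
    and lin: "\<And>x y. x \<in> P \<Longrightarrow> y \<in> P \<Longrightarrow> lin x y \<longleftrightarrow> lin' (u x) (u y)"
    and G: "\<And>x. x \<in> P \<Longrightarrow> fob G x = fob F (u x)"
      "\<And>x y. x \<in> P \<Longrightarrow> y \<in> P \<Longrightarrow> le x y \<Longrightarrow> far G (y, x) = far F (u y, u x)"
    and ch: "cellular_choice C P' le' lin' F a \<pi>"
  shows "cellular_choice C P le lin G (\<lambda>X. a (u ` X)) (\<lambda>X x. \<pi> (u ` X) (u x))"
proof -
  have inj: "inj_on u P" and im: "u ` P = P'" using u unfolding bij_betw_def by auto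
  have sv: "sieve P' le' (u ` X) \<and> X \<subseteq> P" if "sieve P le X" for X
  proof -
    have X: "X \<subseteq> P" "\<And>x v. x \<in> X \<Longrightarrow> v \<in> P \<Longrightarrow> le v x \<Longrightarrow> v \<in> X"
      using that unfolding sieve_def by auto
    have "w \<in> u ` X" if "x \<in> X" "w \<in> P'" "le' w (u x)" for x w
    proof -
      obtain v where v: "v \<in> P" "w = u v" using \<open>w \<in> P'\<close> im by blast
      then have "le v x" using le[of v x] that X(1) by blast
      then show ?thesis using X(2)[OF that(1) v(1)] v(2) by blast
    qed
    then show ?thesis using X(1) im unfolding sieve_def by blast
  qed
  have dn: "u ` down P le x = down P' le' (u x)" if "x \<in> P" for x
  proof -
    have "le' (u v) (u x) \<longleftrightarrow> le v x" if "v \<in> P" for v using le[OF that \<open>x \<in> P\<close>] by blast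
    then show ?thesis unfolding down_def im[symmetric] by blast
  qed
  note D = ch[unfolded cellular_choice_def Let_def]
  note D1 = conjunct1[OF D] and D2 = conjunct1[OF conjunct2[OF D]]
    and D3 = conjunct1[OF conjunct2[OF conjunct2[OF D]]]
    and D4 = conjunct1[OF conjunct2[OF conjunct2[OF conjunct2[OF D]]]]
    and D5 = conjunct2[OF conjunct2[OF conjunct2[OF conjunct2[OF D]]]]
  have diff: "u ` Y - u ` X = {u y}" if "Y \<subseteq> P" "X \<subseteq> Y" "Y - X = {y}" for X Y y
    using inj_on_image_set_diff[OF inj, of Y X] that by auto
  have low: "\<forall>x\<in>u ` X. lin' x (u y)" if "X \<subseteq> P" "y \<in> P" "\<forall>x\<in>X. lin x y" for X y
    using that lin by auto
  show ?thesis
    unfolding cellular_choice_def Let_def induced_reindex[symmetric]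
  proof (intro conjI allI ballI impI; (elim conjE)?)
    fix X assume X: "sieve P le X"
    then have XP: "X \<subseteq> P" using sv by blast
    show "limit_cone C le G X (a (u ` X)) (\<lambda>x. \<pi> (u ` X) (u x))"
    proof (rule limit_cone_reindex[where le' = le' and F = F])
      show "inj_on u X" using inj_on_subset[OF inj XP] .
      show "limit_cone C le' F (u ` X) (a (u ` X)) (\<pi> (u ` X))" using D1 sv[OF X] by blast
      show "le x y \<longleftrightarrow> le' (u x) (u y)" if "x \<in> X" "y \<in> X" for x y
        using le[of x y] that XP by blast
      show "fob G x = fob F (u x)" if "x \<in> X" for x using G(1)[of x] that XP by blast
      show "far G (y, x) = far F (u y, u x)" if "x \<in> X" "y \<in> X" "le x y" for x y
        using G(2)[of x y] that XP by blast
    qed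
  next
    show "a (u ` {}) = unit_ob C" using D2 by simp
  next
    fix x assume x: "x \<in> P"
    then have ux: "u x \<in> P'" using im by blast
    show "a (u ` down P le x) = fob G x" using dn[OF x] D3 ux G(1)[OF x] by simp
    fix y assume y: "y \<in> down P le x"
    then have "u y \<in> down P' le' (u x)" using dn[OF x] by blast
    then show "\<pi> (u ` down P le x) (u y) = far G (x, y)"
      using dn[OF x] D3 ux G(2)[of y x] x y unfolding down_def by auto
  next
    fix X Y y assume A: "sieve P le X" "sieve P le Y" "X \<subseteq> Y" "Y - X = {y}" "\<forall>x\<in>X. lin x y"
    have "y \<in> P" using A sv by blast
    then have "sieve P' le' (u ` X) \<and> sieve P' le' (u ` Y) \<and> u ` X \<subseteq> u ` Y \<and> u ` Y - u ` X = {u y} \<and>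
        (\<forall>x\<in>u ` X. lin' x (u y))"
      by (intro conjI low[OF _ _ A(5)] diff[OF _ A(3,4)] image_mono[OF A(3)])
         (use sv[OF A(1)] sv[OF A(2)] in blast)+
    from D4[rule_format, OF this]
    show "display C (a (u ` Y)) (a (u ` X)) (induced C (u ` X) (a (u ` Y)) (\<pi> (u ` Y)) (a (u ` X)) (\<pi> (u ` X)))"
      "len C (a (u ` Y)) = len C (a (u ` X)) + 1" by auto
  next
    fix X Y X' Y' y
    assume A: "sieve P le X" "sieve P le Y" "sieve P le X'" "sieve P le Y'"
      "X \<subseteq> X'" "Y \<subseteq> Y'" "X \<subseteq> Y" "X' \<subseteq> Y'" "Y - X = {y}" "Y' - X' = {y}" "\<forall>x\<in>X'. lin x y"
    have "y \<in> P" using A sv by blast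
    then have "sieve P' le' (u ` X) \<and> sieve P' le' (u ` Y) \<and> sieve P' le' (u ` X') \<and> sieve P' le' (u ` Y') \<and>
        u ` X \<subseteq> u ` X' \<and> u ` Y \<subseteq> u ` Y' \<and> u ` X \<subseteq> u ` Y \<and> u ` X' \<subseteq> u ` Y' \<and>
        u ` Y - u ` X = {u y} \<and> u ` Y' - u ` X' = {u y} \<and> (\<forall>x\<in>u ` X'. lin' x (u y))"
      by (intro conjI low[OF _ _ A(11)] diff[OF _ A(7,9)] diff[OF _ A(8,10)]
            image_mono[OF A(5)] image_mono[OF A(6)] image_mono[OF A(7)] image_mono[OF A(8)])
         (use sv[OF A(1)] sv[OF A(2)] sv[OF A(3)] sv[OF A(4)] in blast)+
    from D5[rule_format, OF this]
    show "distinguished C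
        (induced C (u ` Y) (a (u ` Y')) (\<pi> (u ` Y')) (a (u ` Y)) (\<pi> (u ` Y)),
         induced C (u ` X') (a (u ` Y')) (\<pi> (u ` Y')) (a (u ` X')) (\<pi> (u ` X')),
         induced C (u ` X) (a (u ` Y)) (\<pi> (u ` Y)) (a (u ` X)) (\<pi> (u ` X)),
         induced C (u ` X) (a (u ` X')) (\<pi> (u ` X')) (a (u ` X)) (\<pi> (u ` X)))" .
  qed
qed

text \<open>Kept apart from the contextual case because functors between the sources of
  multimorphisms connect merely precontextual categories.\<close>

locale precontextual_functor = precontextual_category C + D: precontextual_category D
  for C :: "('o, 'm) precat" and D :: "('r, 's) precat" +
  fixes H :: "('o, 'm, 'r, 's) ftr"
  assumes contextual_functor: "contextual_functor C D H"
begin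

lemma H_functor: "is_functor C D H"
  using contextual_functor unfolding contextual_functor_def by blast

lemma H_hom: "f \<in> hom C a b \<Longrightarrow> far H f \<in> hom D (fob H a) (fob H b)"
  using H_functor unfolding is_functor_def hom_def by auto

lemma H_Obj: "a \<in> Obj C \<Longrightarrow> fob H a \<in> Obj D"
  and H_id: "a \<in> Obj C \<Longrightarrow> far H (Idn C a) = Idn D (fob H a)"
  using H_functor unfolding is_functor_def by auto

lemma H_comp: "f \<in> hom C a b \<Longrightarrow> g \<in> hom C b c \<Longrightarrow> far H (Cmp C g f) = Cmp D (far H g) (far H f)"
  using H_functor unfolding is_functor_def hom_def by auto

lemma H_len: "a \<in> Obj C \<Longrightarrow> len D (fob H a) = len C a"
  and H_bd: "a \<in> Obj C \<Longrightarrow> bd D (fob H a) = fob H (bd C a)"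
  and H_proj: "a \<in> Obj C \<Longrightarrow> len C a \<ge> 1 \<Longrightarrow> far H (proj C a) = proj D (fob H a)"
  and H_Sq: "(t, l, r, b) \<in> Sq C \<Longrightarrow> (far H t, far H l, far H r, far H b) \<in> Sq D"
  using contextual_functor unfolding contextual_functor_def by auto

end

locale contextual_functor_on = contextual_category C + D: contextual_category D
  for C :: "('o, 'm) precat" and D :: "('r, 's) precat" +
  fixes H :: "('o, 'm, 'r, 's) ftr"
  assumes contextual_functor: "contextual_functor C D H"

sublocale contextual_functor_on \<subseteq> precontextual_functor C D H
  by unfold_locales (rule contextual_functor)

context contextual_functor_on
begin

lemma H_unit: "fob H (unit_ob C) = unit_ob D"
  using D.unit_ob(4)[OF H_Obj[OF unit_ob(1)]] H_len[OF unit_ob(1)] unit_ob(2) by simp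

lemma H_iso: "f \<in> hom C a b \<Longrightarrow> iso_arr C f \<Longrightarrow> iso_arr D (far H f)"
  using inv_arr[of f a b] H_comp[of f a b "inv_arr f" a] H_comp[of "inv_arr f" b a f b] H_id hom_Obj
  by (intro D.iso_arrI[OF H_hom H_hom, of f a b "inv_arr f"]) auto

end

locale cellular_image = contextual_functor_on C D H + linearized_poset P le lin
  for C :: "('o, 'm) precat" and D :: "('r, 's) precat" and H and P :: "'p set" and le lin
begin

sublocale linearized_diagrams C P le lin ..

text \<open>A contextual functor is not assumed to preserve limits. It does preserve the tower
  squares, whose images are pullbacks in \<open>D\<close>, so the limit property over each sieve is
  rebuilt there by the same one-element steps.\<close>

lemma cellular_choice_image:
  assumes F: "diagram_on C P le F" and F': "diagram_on D P le F'"
    and ob: "\<And>x. x \<in> P \<Longrightarrow> fob F' x = fob H (fob F x)"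
    and ar: "\<And>x y. x \<in> P \<Longrightarrow> y \<in> P \<Longrightarrow> le x y \<Longrightarrow> far F' (y, x) = far H (far F (y, x))"
    and ch: "cellular_choice C P le lin F a \<pi>"
  shows "cellular_choice D P le lin F' (\<lambda>X. fob H (a X)) (\<lambda>X x. far H (\<pi> X x))"
proof -
  note ch' = cellular_choiceD[OF ch]
  note T = cellular_choice_tower[OF F ch]
  let ?a = "\<lambda>X. fob H (a X)" and ?\<pi> = "\<lambda>X x. far H (\<pi> X x)"
  let ?m = "\<lambda>Y X. induced C X (a Y) (\<pi> Y) (a X) (\<pi> X)"
  have mH: "far H (\<pi> X x) = Cmp D (far H (\<pi> X' x)) (far H (?m X X'))"
    if "sieve P le X" "sieve P le X'" "X' \<subseteq> X" "x \<in> X'" for X X' x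
    using limit_cone_subset_induced[OF ch'(1)[OF that(1)] ch'(1)[OF that(2)] that(3)]
      H_comp limit_coneD(2)[OF ch'(1)[OF that(2)] that(4)] that(4) by metis
  \<comment> \<open>The limit property in \<open>D\<close> is a premise because this is used inside
    the induction that establishes it.\<close>
  have ind: "induced D X' (?a X) (?\<pi> X) (?a X') (?\<pi> X') = far H (?m X X')"
    if X: "sieve P le X" and X': "sieve P le X'" and XX: "X' \<subseteq> X"
      and lim: "limit_cone D le F' X' (?a X') (?\<pi> X')" for X X'
    by (rule D.induced_eqI[OF D.diagram_on_subset[OF F'] lim])
      (use H_hom[OF limit_cone_subset_induced(1)[OF ch'(1)[OF X] ch'(1)[OF X'] XX]] mH[OF X X' XX]
         sieveD(1)[OF X'] in auto)
  have lim: "limit_cone D le F' X (?a X) (?\<pi> X)" if "sieve P le X" for X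
    using that
  proof (induction X rule: sieve_induct)
    case empty
    then show ?case using D.limit_cone_empty H_unit ch'(2) by simp
  next
    case (top X y)
    note X = down_sieve_top[OF top.hyps]
    let ?X = "X - {y}" and ?S = "sdown P le y"
    note sX = sieve_minus[OF top.hyps] and SX = sdown_subset[OF top.hyps] and sS = sieve_sdown[OF X(3)]
    note L = latchingD[OF T(1) X(3)]
    note Fy = diagram_onD(1)[OF F X(3)]
    have Sq: "(?\<pi> X y, far H (?m X ?X), proj D (fob F' y),
        induced D ?S (?a ?X) (?\<pi> ?X) (?a ?S) (?\<pi> ?S)) \<in> Sq D"
      using H_Sq[OF towerD(3)[OF T(2) top.hyps]] H_proj[OF Fy L(1)] ob[OF X(3)]
        ind[OF sX sS SX top.IH(2)] by simp
    have "proj C (fob F y) \<in> hom C (fob F y) (a ?S)" using proj_hom[OF Fy L(1)] L(2) by simp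
    then have p: "proj D (fob F' y) \<in> hom D (fob F' y) (?a ?S)"
      "\<And>x. x \<in> ?S \<Longrightarrow> Cmp D (?\<pi> ?S x) (proj D (fob F' y)) = far H (far F (y, x))"
      using H_hom H_proj[OF Fy L(1)] ob[OF X(3)] L(4) H_comp limit_coneD(2)[OF L(3)] by metis+
    have Sx: "x \<in> P \<and> le x y" if "x \<in> ?S" for x using that unfolding sdown_def by blast
    have "limit_cone D le F' X (Src D (?\<pi> X y)) (?\<pi> X)"
    proof (rule D.limit_cone_step[OF D.diagram_on_subset[OF F' X(4)] X(2) refl _ _ top.IH p(1) _ Sq])
      show "\<And>x. x \<in> X \<Longrightarrow> le y x \<Longrightarrow> x = y" by (rule top_maximal[OF top.hyps])
      show "?S = {x \<in> ?X. le x y}" by (rule sdown_Int_sieve[OF X(1,2)])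
      show "Cmp D (?\<pi> ?S x) (proj D (fob F' y)) = far F' (y, x)" if "x \<in> ?S" for x
        using p(2)[OF that] ar[OF _ X(3), of x] Sx[OF that] by simp
      show "?\<pi> X x = Cmp D (?\<pi> ?X x) (far H (?m X ?X))" if "x \<in> ?X" for x
        by (rule mH[OF X(1) sX Diff_subset that])
    qed simp
    moreover have "Src D (?\<pi> X y) = ?a X"
      using D.hom_Arr[OF H_hom[OF limit_coneD(2)[OF ch'(1)[OF X(1)] X(2)]]] by simp
    ultimately show ?case by simp
  qed
  have ind': "induced D X' (?a X) (?\<pi> X) (?a X') (?\<pi> X') = far H (?m X X')"
    if "sieve P le X" "sieve P le X'" "X' \<subseteq> X" for X X' using ind lim that by simp
  show ?thesis
    unfolding cellular_choice_def Let_def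
  proof (intro conjI allI ballI impI; (elim conjE)?)
    show "?a {} = unit_ob D" using ch'(2) H_unit by simp
    show "\<And>X. sieve P le X \<Longrightarrow> limit_cone D le F' X (?a X) (?\<pi> X)" by (fact lim)
    show "\<And>x. x \<in> P \<Longrightarrow> ?a (down P le x) = fob F' x" using ch'(3) ob by simp
    fix x y assume "x \<in> P" "y \<in> down P le x"
    then show "far H (\<pi> (down P le x) y) = far F' (x, y)"
      using ch'(4) ar unfolding down_def by simp
  next
    fix X Y y assume A: "sieve P le X" "sieve P le Y" "X \<subseteq> Y" "Y - X = {y}" "\<forall>x\<in>X. lin x y"
    note t = top_insert[OF A]
    note p = display_length_1[OF ch'(5)[OF t(1), folded t(2)] ch'(6)[OF t(1), folded t(2)]]
    note HY = H_Obj[OF p(1)]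
    show "display D (?a Y) (?a X) (induced D X (?a Y) (?\<pi> Y) (?a X) (?\<pi> X))"
      "len D (?a Y) = len D (?a X) + 1"
      using D.display_proj[OF HY] H_len[OF p(1)] H_bd[OF p(1)] H_proj[OF p(1,2)] p ind'[OF A(2,1,3)]
        D.len_bd[OF HY] by auto
  next
    fix X Y X' Y' y
    assume s: "sieve P le X" "sieve P le Y" "sieve P le X'" "sieve P le Y'"
      and c: "X \<subseteq> X'" "Y \<subseteq> Y'" "X \<subseteq> Y" "X' \<subseteq> Y'" and y: "Y - X = {y}" "Y' - X' = {y}"
      and l: "\<forall>x\<in>X'. lin x y"
    have t: "top_of Y y" "X = Y - {y}" using top_insert[OF s(1,2) c(3) y(1)] l c(1) by blast+
    note p = display_length_1[OF ch'(5)[OF t(1), folded t(2)] ch'(6)[OF t(1), folded t(2)]]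
    have "(?m Y' Y, ?m Y' X', ?m Y X, ?m X' X) \<in> Sq C"
      using ch'(7)[OF s c y l] distinguished_iff[OF p(1,2)] p(4) by simp
    from H_Sq[OF this]
    show "distinguished D (induced D Y (?a Y') (?\<pi> Y') (?a Y) (?\<pi> Y),
        induced D X' (?a Y') (?\<pi> Y') (?a X') (?\<pi> X'), induced D X (?a Y) (?\<pi> Y) (?a X) (?\<pi> X),
        induced D X (?a X') (?\<pi> X') (?a X) (?\<pi> X))"
      using D.distinguished_iff[OF H_Obj[OF p(1)]] H_len[OF p(1)] H_proj[OF p(1,2)] p(2,4) ind' s c by simp
  qed
qed

end

section \<open>Display maps in products\<close>

context precontextual_category
begin

lemma display_hom: "display C y x m \<Longrightarrow> m \<in> hom C y x"
proof (induction rule: display.induct)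
  case (display_step a b m)
  then show ?case using comp_hom[OF proj_hom] by blast
qed (rule id_hom)

text \<open>Lengths decide whether the composite is empty, and each further factor is forced by its
  source.\<close>

lemma display_unique: "display C y x m \<Longrightarrow> display C y x m' \<Longrightarrow> m = m'"
proof (induction arbitrary: m' rule: display.induct)
  case (display_id a)
  from display_id(2) show ?case
  proof cases
    case (display_step k)
    then show ?thesis using display_len[OF precontextual display_step(4)] len_bd by fastforce
  qed simp
next
  case (display_step a b m)
  from display_step(5) show ?case
  proof cases
    case display_id
    then show ?thesis using display_len[OF precontextual display_step(3)] len_bd display_step(1,2)
      by fastforce
  next
    case (display_step k)
    then show ?thesis using \<open>\<And>m'. display C (bd C a) b m' \<Longrightarrow> m = m'\<close> by blast
  qed
qed

lemma display_trans: "display C y x m \<Longrightarrow> display C x z k \<Longrightarrow> display C y z (k \<cdot> m)"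
proof (induction rule: display.induct)
  case (display_id a)
  then show ?case using id_right[OF display_hom] by simp
next
  case (display_step a b m)
  then show ?case
    using display.display_step[OF display_step(1,2) display_step(4)[OF display_step(5)]]
      assoc[OF proj_hom display_hom display_hom] by simp
qed

lemma disp: "tle C x y \<Longrightarrow> display C y x (disp C y x)"
  unfolding tle_def disp_def by (elim exE, rule theI) (auto intro: display_unique)

lemma disp_eqI: "display C y x m \<Longrightarrow> disp C y x = m"
  unfolding disp_def using display_unique by blast

lemma disp_hom: "tle C x y \<Longrightarrow> disp C y x \<in> hom C y x"
  using display_hom[OF disp] .

lemma disp_refl: "x \<in> Obj C \<Longrightarrow> disp C x x = Idn C x"
  by (rule disp_eqI[OF display_id])

lemma disp_trans: "tle C z x \<Longrightarrow> tle C x y \<Longrightarrow> disp C x z \<cdot> disp C y x = disp C y z"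
  by (rule disp_eqI[OF display_trans[OF disp disp], symmetric])

lemma disp_bd:
  assumes "y \<in> Obj C" "len C y \<ge> 1"
  shows "tle C (bd C y) y" "disp C y (bd C y) = proj C y"
proof -
  have "display C y (bd C y) (proj C y)"
    using display_step[OF assms display_id[OF bd_Obj[OF assms(1)]]] id_left[OF proj_hom[OF assms]] by simp
  then show "tle C (bd C y) y" "disp C y (bd C y) = proj C y"
    using disp_eqI unfolding tle_def by blast+
qed

text \<open>A nonempty display map begins with the projection of its source, hence factors through
  \<open>bd C y\<close>. This is the one-factor case of the cofinality of cubes.\<close>

lemma tle_less_bd:
  assumes "tle C x y" "x \<noteq> y"
  shows "tle C x (bd C y)"
proof -
  obtain m where "display C y x m" using assms(1) unfolding tle_def by blast
  then show ?thesis using assms(2) unfolding tle_def by cases auto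
qed

lemma tle_refl: "x \<in> Obj C \<Longrightarrow> tle C x x"
  unfolding tle_def by (rule exI) (rule display_id)

lemma tle_Obj: "tle C x y \<Longrightarrow> x \<in> Obj C" "tle C x y \<Longrightarrow> y \<in> Obj C"
  using display_len[OF precontextual] unfolding tle_def by blast+

lemma tle_len: "tle C x y \<Longrightarrow> len C x \<le> len C y"
  using display_len[OF precontextual] unfolding tle_def by blast

lemma tle_antisym: "tle C x y \<Longrightarrow> tle C y x \<Longrightarrow> x = y"
  using tle_len[of x y] tle_len[of y x] tle_iff[OF precontextual, of x y] by simp

lemma Sq_projD:
  assumes "(t, proj C x, proj C y, b) \<in> Sq C" "x \<in> Obj C" "y \<in> Obj C" "len C x \<ge> 1" "len C y \<ge> 1"
  shows "t \<in> hom C x y" "b \<in> hom C (bd C x) (bd C y)" "proj C y \<cdot> t = b \<cdot> proj C x"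
proof -
  note D = SqD[OF assms(1)]
  have "Src C t = x" "Trg C t = y"
    using proj_inj[OF assms(2) D(1) assms(4) D(2) D(3)] proj_inj[OF assms(3) D(5) assms(5) D(6) D(7)]
    by simp_all
  then show "t \<in> hom C x y" "b \<in> hom C (bd C x) (bd C y)" "proj C y \<cdot> t = b \<cdot> proj C x"
    using D(9,10,11) by simp_all
qed

end

definition pdisp :: "nat \<Rightarrow> (nat \<Rightarrow> ('o, 'm) precat) \<Rightarrow> (nat \<Rightarrow> 'o) \<Rightarrow> (nat \<Rightarrow> 'o) \<Rightarrow> nat \<Rightarrow> 'm" where
  "pdisp n A y x = (\<lambda>i\<in>{1..n}. disp (A i) (y i) (x i))"

lemma tdiag_simps: "fob (tdiag n A F) = fob F" "far (tdiag n A F) (y, x) = far F (pdisp n A y x)"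
  unfolding tdiag_def pdisp_def by simp_all

locale precontextual_family =
  fixes n :: nat and A :: "nat \<Rightarrow> ('o, 'm) precat"
  assumes family: "\<And>i. i \<in> {1..n} \<Longrightarrow> precontextual (A i)"
begin

abbreviation "PC \<equiv> prod_cat n A"
abbreviation "P \<equiv> ptob n A"
abbreviation "le \<equiv> ptle n A"
abbreviation "lin \<equiv> lex_lin n A"

lemma pc: "i \<in> {1..n} \<Longrightarrow> precontextual_category (A i)"
  using family by unfold_locales

lemma cat_i: "i \<in> {1..n} \<Longrightarrow> category_of (A i)"
  using family by (simp add: category_of_def precontextual_def)

lemma PC_Obj: "x \<in> Obj PC \<longleftrightarrow> x \<in> extensional {1..n} \<and> (\<forall>i\<in>{1..n}. x i \<in> Obj (A i))"
  unfolding prod_cat_def by (auto simp: PiE_iff)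

lemma PC_Arr: "f \<in> Arr PC \<longleftrightarrow> f \<in> extensional {1..n} \<and> (\<forall>i\<in>{1..n}. f i \<in> Arr (A i))"
  unfolding prod_cat_def by (auto simp: PiE_iff)

lemma PC_hom:
  assumes "x \<in> extensional {1..n}" "y \<in> extensional {1..n}"
  shows "f \<in> hom PC x y \<longleftrightarrow> f \<in> extensional {1..n} \<and> (\<forall>i\<in>{1..n}. f i \<in> hom (A i) (x i) (y i))"
proof -
  have "(\<lambda>i\<in>{1..n}. Src (A i) (f i)) = x \<longleftrightarrow> (\<forall>i\<in>{1..n}. Src (A i) (f i) = x i)"
    "(\<lambda>i\<in>{1..n}. Trg (A i) (f i)) = y \<longleftrightarrow> (\<forall>i\<in>{1..n}. Trg (A i) (f i) = y i)"
    using assms by (auto simp: fun_eq_iff extensional_def)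
  then show ?thesis unfolding hom_def prod_cat_def by (auto simp: PiE_iff)
qed

lemma PC_Cmp: "Cmp PC g f = (\<lambda>i\<in>{1..n}. Cmp (A i) (g i) (f i))"
  and PC_Idn: "Idn PC x = (\<lambda>i\<in>{1..n}. Idn (A i) (x i))"
  and PC_Src: "Src PC f = (\<lambda>i\<in>{1..n}. Src (A i) (f i))"
  and PC_Trg: "Trg PC f = (\<lambda>i\<in>{1..n}. Trg (A i) (f i))"
  unfolding prod_cat_def by simp_all

lemma category_PC: "category PC"
  unfolding category_def
proof (intro conjI ballI impI)
  fix f assume f: "f \<in> Arr PC"
  then have fi: "f i \<in> hom (A i) (Src (A i) (f i)) (Trg (A i) (f i))" if "i \<in> {1..n}" for i
    using that PC_Arr unfolding hom_def by auto
  show "Src PC f \<in> Obj PC" "Trg PC f \<in> Obj PC"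
    using category_of.hom_Obj[OF cat_i fi] unfolding PC_Obj PC_Src PC_Trg by auto
  show "Cmp PC f (Idn PC (Src PC f)) = f" "Cmp PC (Idn PC (Trg PC f)) f = f"
    using category_of.id_left[OF cat_i fi] category_of.id_right[OF cat_i fi] f
    unfolding PC_Cmp PC_Idn PC_Src PC_Trg PC_Arr by (auto simp: fun_eq_iff extensional_def)
  fix g assume g: "g \<in> Arr PC"
  then have gi: "g i \<in> hom (A i) (Src (A i) (g i)) (Trg (A i) (g i))" if "i \<in> {1..n}" for i
    using that PC_Arr unfolding hom_def by auto
  { assume c: "Src PC g = Trg PC f"
    have ci: "Src (A i) (g i) = Trg (A i) (f i)" if "i \<in> {1..n}" for i
      using fun_cong[OF c, of i] that unfolding PC_Src PC_Trg by simp
    have gi': "g i \<in> hom (A i) (Trg (A i) (f i)) (Trg (A i) (g i))" if "i \<in> {1..n}" for i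
      using gi[OF that] ci[OF that] by simp
    show "Cmp PC g f \<in> hom PC (Src PC f) (Trg PC g)"
      by (subst PC_hom) (use category_of.comp_hom[OF cat_i fi gi'] ci in
          \<open>auto simp: PC_Src PC_Trg PC_Cmp\<close>) }
  fix h assume h: "h \<in> Arr PC"
  then have hi: "h i \<in> hom (A i) (Src (A i) (h i)) (Trg (A i) (h i))" if "i \<in> {1..n}" for i
    using that PC_Arr unfolding hom_def by auto
  assume c: "Src PC g = Trg PC f \<and> Src PC h = Trg PC g"
  have ci: "Src (A i) (g i) = Trg (A i) (f i)" "Src (A i) (h i) = Trg (A i) (g i)" if "i \<in> {1..n}" for i
    using fun_cong[OF conjunct1[OF c], of i] fun_cong[OF conjunct2[OF c], of i] that
    unfolding PC_Src PC_Trg by auto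
  have gi': "g i \<in> hom (A i) (Trg (A i) (f i)) (Trg (A i) (g i))"
    and hi': "h i \<in> hom (A i) (Trg (A i) (g i)) (Trg (A i) (h i))" if "i \<in> {1..n}" for i
    using gi[OF that] hi[OF that] ci[OF that] by simp_all
  show "Cmp PC h (Cmp PC g f) = Cmp PC (Cmp PC h g) f"
    using category_of.assoc[OF cat_i fi gi' hi']
    unfolding PC_Cmp by (auto simp: fun_eq_iff)
next
  fix x assume "x \<in> Obj PC"
  then show "Idn PC x \<in> hom PC x x"
    by (subst PC_hom) (auto simp: PC_Obj PC_Idn intro: category_of.id_hom[OF cat_i])
qed

sublocale PC: category_of PC
  using category_PC by unfold_locales

lemma P_iff: "x \<in> P \<longleftrightarrow> x \<in> extensional {1..n} \<and> (\<forall>i\<in>{1..n}. x i \<in> Obj (A i) \<and> len (A i) (x i) \<ge> 1)"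
  unfolding ptob_def tob_def by (auto simp: PiE_iff)

lemma P_iff_Obj: "x \<in> P \<longleftrightarrow> x \<in> Obj PC \<and> (\<forall>i\<in>{1..n}. len (A i) (x i) \<noteq> 0)"
  unfolding P_iff PC_Obj by (auto simp: Suc_le_eq)

lemma P_Obj: "x \<in> P \<Longrightarrow> x \<in> Obj PC"
  unfolding P_iff_Obj by blast

lemma local_linearization: "local_linearization P le lin"
  using lex_lin_local_linearization family by blast

lemma pdisp_hom: "x \<in> P \<Longrightarrow> y \<in> P \<Longrightarrow> le x y \<Longrightarrow> pdisp n A y x \<in> hom PC y x"
  by (subst PC_hom) (auto simp: P_iff pdisp_def ptle_def intro: precontextual_category.disp_hom[OF pc])

lemma pdisp_refl: "x \<in> P \<Longrightarrow> pdisp n A x x = Idn PC x"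
  unfolding PC_Idn pdisp_def
  by (auto simp: P_iff fun_eq_iff precontextual_category.disp_refl[OF pc])

lemma pdisp_trans: "le x y \<Longrightarrow> le y z \<Longrightarrow> Cmp PC (pdisp n A y x) (pdisp n A z y) = pdisp n A z x"
  unfolding PC_Cmp pdisp_def ptle_def
  by (auto simp: fun_eq_iff precontextual_category.disp_trans[OF pc])

lemma diagram_tdiag:
  assumes F: "is_functor PC C F"
  shows "diagram_on C P le (tdiag n A F)"
proof -
  have h: "far F f \<in> hom C (fob F x) (fob F y)" if "f \<in> hom PC x y" for f x y
    using F that unfolding is_functor_def hom_def by auto
  have c: "far F (Cmp PC g f) = Cmp C (far F g) (far F f)"
    if "f \<in> hom PC x y" "g \<in> hom PC y z" for f g x y z
    using F that unfolding is_functor_def hom_def by auto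
  show ?thesis
    unfolding diagram_on_def is_functor_def poset_op_def
  proof (simp, intro conjI allI ballI impI, goal_cases)
    case (1 x)
    then show ?case using F P_Obj unfolding is_functor_def tdiag_simps by blast
  next
    case (2 y x)
    then show ?case using h[OF pdisp_hom] unfolding tdiag_simps by blast
  next
    case (3 x)
    then show ?case using F P_Obj unfolding is_functor_def tdiag_simps pdisp_refl[OF 3] by blast
  next
    case (4 z y x)
    then show ?case
      using c[OF pdisp_hom pdisp_hom, of y z x] pdisp_trans[of x y z] unfolding tdiag_simps by simp
  qed
qed

end

section \<open>Independence of boundary objects from the ambient principal sieve\<close>

section \<open>Locally cellular diagrams\<close>

lemma poset_subset: "poset P le \<Longrightarrow> Q \<subseteq> P \<Longrightarrow> poset Q le"
proof -
  assume "poset P le" "Q \<subseteq> P"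
  moreover have "le x z" if "x \<in> Q" "y \<in> Q" "z \<in> Q" "le x y" "le y z" for x y z
  proof -
    have "x \<in> P" "y \<in> P" "z \<in> P" using that \<open>Q \<subseteq> P\<close> by blast+
    then show ?thesis using \<open>poset P le\<close> that(4,5) unfolding poset_def by blast
  qed
  ultimately show ?thesis unfolding poset_def by blast
qed

locale locally_linearized_poset =
  fixes P :: "'p set" and le lin
  assumes loc: "local_linearization P le lin"
begin

lemma poset: "poset P le"
  using loc unfolding local_linearization_def by blast

lemma down_linearized: "w \<in> P \<Longrightarrow> linearized_poset (down P le w) le lin"
proof
  assume w: "w \<in> P"
  show "finite (down P le w)" "linearization (down P le w) le lin"
    using loc w unfolding local_linearization_def by auto
  show "Defs.poset (down P le w) le"
    by (rule poset_subset[OF poset]) (auto simp: down_def)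
qed

lemma self_down: "w \<in> P \<Longrightarrow> w \<in> down P le w"
  using poset unfolding poset_def down_def by blast

lemma le_trans: "x \<in> P \<Longrightarrow> y \<in> P \<Longrightarrow> z \<in> P \<Longrightarrow> le x y \<Longrightarrow> le y z \<Longrightarrow> le x z"
  using poset unfolding poset_def by blast

lemma le_antisym: "x \<in> P \<Longrightarrow> y \<in> P \<Longrightarrow> le x y \<Longrightarrow> le y x \<Longrightarrow> x = y"
  using poset unfolding poset_def by blast

lemma sieve_down_sdown:
  assumes "y \<in> P" "w \<in> P" "le y w"
  shows "sieve (down P le w) le (sdown P le y)"
  unfolding sieve_def
proof (intro conjI subsetI ballI impI)
  fix x assume "x \<in> sdown P le y"
  then have x: "x \<in> P" "le x y" "x \<noteq> y" unfolding sdown_def by auto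
  then show "x \<in> down P le w" using le_trans[OF x(1) assms(1,2) x(2) assms(3)] unfolding down_def by simp
  fix z assume "z \<in> down P le w" "le z x"
  then have z: "z \<in> P" "le z x" unfolding down_def by auto
  moreover have "z \<noteq> y" using le_antisym[OF x(1) assms(1) x(2)] z x(3) by blast
  ultimately show "z \<in> sdown P le y"
    using le_trans[OF z(1) x(1) assms(1) z(2) x(2)] unfolding sdown_def by simp
qed

end

locale locally_cellular_diagram = contextual_category C + locally_linearized_poset P le lin
  for C :: "('o, 'm) precat" and P :: "'p set" and le lin +
  fixes F :: "('p, 'p \<times> 'p, 'o, 'm) ftr"
  assumes locally_cellular: "locally_cellular C P le lin F"
begin

lemma diagram: "diagram_on C P le F"
  using locally_cellular unfolding locally_cellular_def diagram_on_def by blast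

lemma down_diagrams: "w \<in> P \<Longrightarrow> linearized_diagrams C (down P le w) le lin"
  using down_linearized contextual_category_axioms unfolding linearized_diagrams_def by blast

lemma diagram_down: "diagram_on C (down P le w) le F"
  by (rule diagram_on_subset[OF diagram]) (auto simp: down_def)

lemma the_choice:
  assumes "w \<in> P"
  defines "c \<equiv> the_choice C (down P le w) le lin F"
  shows "cellular_choice C (down P le w) le lin F (fst c) (snd c)"
proof -
  have "\<exists>c. cellular_choice C (down P le w) le lin F (fst c) (snd c)"
    using locally_cellular assms(1) unfolding locally_cellular_def cellular_def by fastforce
  from someI_ex[OF this] show ?thesis unfolding c_def the_choice_def .
qed

text \<open>A choice over any larger principal sieve computes the boundary of \<open>y\<close>, by
  uniqueness of choices on common sieves. This removes the dependence on the selection inside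
  \<open>the_choice\<close>.\<close>

lemma latch_eq:
  assumes w: "w \<in> P" and y: "y \<in> P" "le y w"
    and ch: "cellular_choice C (down P le w) le lin F a \<pi>"
  shows "a (sdown P le y) = latch C P le lin F y"
    "x \<in> sdown P le y \<Longrightarrow> \<pi> (sdown P le y) x = latch_proj C P le lin F y x"
proof -
  interpret W: linearized_diagrams C "down P le w" le lin by (rule down_diagrams[OF w])
  have "le y y" using self_down[OF y(1)] unfolding down_def by simp
  from W.cellular_choice_unique[OF down_linearized[OF y(1)] diagram_down diagram_down ch the_choice[OF y(1)]
      sieve_down_sdown[OF y(1) w y(2)] sieve_down_sdown[OF y(1) y(1) this]]
  show "a (sdown P le y) = latch C P le lin F y"
    "x \<in> sdown P le y \<Longrightarrow> \<pi> (sdown P le y) x = latch_proj C P le lin F y x"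
    unfolding latch_def latch_proj_def by blast+
qed

lemma latching_latch: "latching C P le F (latch C P le lin F) (latch_proj C P le lin F)"
  unfolding latching_def
proof (intro ballI)
  fix y assume y: "y \<in> P"
  interpret Y: linearized_diagrams C "down P le y" le lin by (rule down_diagrams[OF y])
  have s: "sdown (down P le y) le y = sdown P le y"
    using sdown_down[OF poset y self_down[OF y]] .
  show "len C (fob F y) \<ge> 1 \<and> bd C (fob F y) = latch C P le lin F y \<and>
     limit_cone C le F (sdown P le y) (latch C P le lin F y) (latch_proj C P le lin F y) \<and>
     (\<forall>x\<in>sdown P le y. latch_proj C P le lin F y x \<cdot> proj C (fob F y) = far F (y, x))"
    using Y.cellular_choice_tower(1)[OF diagram_down the_choice[OF y]] self_down[OF y]
    unfolding latching_def latch_def latch_proj_def by (metis s)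
qed

end

text \<open>Only principal sieves are compared: a contextual functor may identify objects without a
  common upper bound, but it is bijective below each fixed object.\<close>

definition poset_local_iso :: "('p \<Rightarrow> 'q) \<Rightarrow> 'p set \<Rightarrow> ('p \<Rightarrow> 'p \<Rightarrow> bool) \<Rightarrow> 'q set \<Rightarrow> ('q \<Rightarrow> 'q \<Rightarrow> bool) \<Rightarrow> bool" where
  "poset_local_iso u P le P' le' \<longleftrightarrow> (\<forall>w\<in>P. u w \<in> P' \<and> bij_betw u (down P le w) (down P' le' (u w)) \<and>
     (\<forall>x\<in>down P le w. \<forall>y\<in>down P le w. le x y \<longleftrightarrow> le' (u x) (u y)))"

context locally_linearized_poset
begin

lemma local_iso_sdown:
  assumes u: "poset_local_iso u P le P' le'" and w: "w \<in> P"
  shows "u ` sdown P le w = sdown P' le' (u w)" "inj_on u (sdown P le w)"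
proof -
  have b: "inj_on u (down P le w)" "u ` down P le w = down P' le' (u w)"
    using u w unfolding poset_local_iso_def bij_betw_def by blast+
  have s: "sdown P le w = down P le w - {w}" "sdown P' le' (u w) = down P' le' (u w) - {u w}"
    unfolding sdown_def down_def by auto
  show "inj_on u (sdown P le w)" using inj_on_subset[OF b(1)] s by blast
  show "u ` sdown P le w = sdown P' le' (u w)"
    unfolding s using inj_on_image_set_diff[OF b(1), of "down P le w" "{w}"] b(2) self_down[OF w] by simp
qed

text \<open>Only \<open>le\<close> is involved, so this applies to the permutation of the
  factors.\<close>

lemma latching_reindex:
  assumes u: "poset_local_iso u P le P' le'"
    and G: "\<And>x. x \<in> P \<Longrightarrow> fob G x = fob F (u x)"
      "\<And>x y. x \<in> P \<Longrightarrow> y \<in> P \<Longrightarrow> le x y \<Longrightarrow> far G (y, x) = far F (u y, u x)"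
    and L: "latching C P' le' F g \<rho>"
  shows "latching C P le G (\<lambda>y. g (u y)) (\<lambda>y x. \<rho> (u y) (u x))"
  unfolding latching_def
proof (intro ballI conjI)
  fix y assume y: "y \<in> P"
  note s = local_iso_sdown[OF u y]
  have uy: "u y \<in> P'" using u y unfolding poset_local_iso_def by blast
  note L' = L[unfolded latching_def, rule_format, OF uy]
  show "len C (fob G y) \<ge> 1" "bd C (fob G y) = g (u y)" using L' G(1)[OF y] by auto
  have S: "x \<in> P" "le x y" "x \<in> down P le y" if "x \<in> sdown P le y" for x
    using that unfolding sdown_def down_def by auto
  show "limit_cone C le G (sdown P le y) (g (u y)) (\<lambda>x. \<rho> (u y) (u x))"
  proof (rule limit_cone_reindex[OF s(2), where le' = le' and F = F])
    show "le x z \<longleftrightarrow> le' (u x) (u z)" if "x \<in> sdown P le y" "z \<in> sdown P le y" for x z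
      using u y S(3)[OF that(1)] S(3)[OF that(2)] unfolding poset_local_iso_def by blast
  qed (use L' s(1) G S in auto)
  fix x assume x: "x \<in> sdown P le y"
  then have "u x \<in> sdown P' le' (u y)" using s(1) by blast
  then show "Cmp C (\<rho> (u y) (u x)) (proj C (fob G y)) = far G (y, x)"
    using L' G(1)[OF y] G(2)[OF S(1)[OF x] y S(2)[OF x]] by simp
qed

end

text \<open>The choices themselves are transported along \<open>u\<close>, so
  \<open>latch_eq\<close> identifies the boundary objects strictly and not just up to
  isomorphism.\<close>

lemma (in locally_cellular_diagram) locally_cellular_reindex:
  assumes Q: "locally_linearized_poset Q le' lin'"
    and u: "poset_local_iso u Q le' P le"
    and lin: "\<And>w x y. w \<in> Q \<Longrightarrow> x \<in> down Q le' w \<Longrightarrow> y \<in> down Q le' w \<Longrightarrow> lin' x y \<longleftrightarrow> lin (u x) (u y)"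
    and dG: "diagram_on C Q le' G"
    and G: "\<And>x. x \<in> Q \<Longrightarrow> fob G x = fob F (u x)"
      "\<And>x y. x \<in> Q \<Longrightarrow> y \<in> Q \<Longrightarrow> le' x y \<Longrightarrow> far G (y, x) = far F (u y, u x)"
  shows "locally_cellular C Q le' lin' G"
    "y \<in> Q \<Longrightarrow> latch C Q le' lin' G y = latch C P le lin F (u y)"
    "y \<in> Q \<Longrightarrow> x \<in> sdown Q le' y \<Longrightarrow> latch_proj C Q le' lin' G y x = latch_proj C P le lin F (u y) (u x)"
proof -
  interpret Q: locally_linearized_poset Q le' lin' by (rule Q)
  define c where "c w = the_choice C (down P le w) le lin F" for w
  have ch: "cellular_choice C (down Q le' w) le' lin' G (\<lambda>X. fst (c (u w)) (u ` X)) (\<lambda>X x. snd (c (u w)) (u ` X) (u x))"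
    if w: "w \<in> Q" for w
  proof (rule cellular_choice_reindex)
    show "bij_betw u (down Q le' w) (down P le (u w))"
      "\<And>x y. x \<in> down Q le' w \<Longrightarrow> y \<in> down Q le' w \<Longrightarrow> le' x y = le (u x) (u y)"
      using u w unfolding poset_local_iso_def by blast+
    show "cellular_choice C (down P le (u w)) le lin F (fst (c (u w))) (snd (c (u w)))"
      using the_choice u w unfolding c_def poset_local_iso_def by blast
  qed (use lin[OF w] G in \<open>auto simp: down_def\<close>)
  have dGw: "diagram_on C (down Q le' w) le' G" for w
    by (rule diagram_on_subset[OF dG]) (auto simp: down_def)
  show lc: "locally_cellular C Q le' lin' G"
    using dG dGw ch unfolding locally_cellular_def cellular_def diagram_on_def by blast
  interpret G: locally_cellular_diagram C Q le' lin' G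
    by unfold_locales (rule lc)
  { assume y: "y \<in> Q"
    have yy: "le' y y" using Q.self_down[OF y] unfolding down_def by simp
    note e = G.latch_eq[OF y y yy ch[OF y]]
    note s = Q.local_iso_sdown[OF u y]
    show "latch C Q le' lin' G y = latch C P le lin F (u y)"
      using e(1) s(1) unfolding latch_def c_def by simp
    show "x \<in> sdown Q le' y \<Longrightarrow> latch_proj C Q le' lin' G y x = latch_proj C P le lin F (u y) (u x)"
      using e(2)[of x] s(1) unfolding latch_proj_def c_def by simp }
qed

section \<open>Cofinality of the punctured cube among the elements strictly below a tuple\<close>

section \<open>Punctured cubes\<close>

definition faces :: "nat \<Rightarrow> nat set set" where
  "faces n = {I. I \<noteq> {} \<and> I \<subseteq> {1..n}}"

definition mixed :: "nat \<Rightarrow> (nat \<Rightarrow> 'm) \<Rightarrow> (nat \<Rightarrow> 'm) \<Rightarrow> nat set \<Rightarrow> nat \<Rightarrow> 'm" where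
  "mixed n f0 f1 I = (\<lambda>i\<in>{1..n}. if i \<in> I then f1 i else f0 i)"

definition Sq_family :: "nat \<Rightarrow> (nat \<Rightarrow> ('o, 'm) precat) \<Rightarrow> (nat \<Rightarrow> 'o) \<Rightarrow> (nat \<Rightarrow> 'o) \<Rightarrow> (nat \<Rightarrow> 'm)
    \<Rightarrow> (nat \<Rightarrow> 'm) \<Rightarrow> bool" where
  "Sq_family n A x y f0 f1 \<longleftrightarrow> x \<in> ptob n A \<and> y \<in> ptob n A \<and> f0 \<in> hom (prod_cat n A) x y \<and>
     f1 \<in> Arr (prod_cat n A) \<and>
     (\<forall>i\<in>{1..n}. (f0 i, proj (A i) (x i), proj (A i) (y i), f1 i) \<in> Sq (A i))"

text \<open>Given by cases and not as a display arrow of \<open>P\<close>, because a vertex of the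
  cube may have an entry of length 0 and lie outside \<open>P\<close>.\<close>

definition cube_arr :: "nat \<Rightarrow> (nat \<Rightarrow> ('o, 'm) precat) \<Rightarrow> (nat \<Rightarrow> 'o) \<Rightarrow> nat set \<Rightarrow> nat set \<Rightarrow> nat \<Rightarrow> 'm" where
  "cube_arr n A x I I' =
     (\<lambda>i\<in>{1..n}. if i \<in> I' - I then proj (A i) (x i) else Idn (A i) (cube n A x I i))"

context precontextual_family
begin

lemma tob_i:
  assumes "x \<in> P" "i \<in> {1..n}"
  shows "x i \<in> Obj (A i)" "len (A i) (x i) \<ge> 1" "bd (A i) (x i) \<in> Obj (A i)"
    "proj (A i) (x i) \<in> hom (A i) (x i) (bd (A i) (x i))" "bd (A i) (x i) \<noteq> x i"
proof -
  interpret B: precontextual_category "A i" by (rule pc[OF assms(2)])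
  show *: "x i \<in> Obj (A i)" "len (A i) (x i) \<ge> 1" using assms P_iff by auto
  show "bd (A i) (x i) \<in> Obj (A i)" "proj (A i) (x i) \<in> hom (A i) (x i) (bd (A i) (x i))"
    using B.bd_Obj B.proj_hom * by auto
  show "bd (A i) (x i) \<noteq> x i" using B.len_bd[OF *] *(2) by fastforce
qed

lemma cube_apply: "i \<in> {1..n} \<Longrightarrow> cube n A x I i = (if i \<in> I then bd (A i) (x i) else x i)"
  unfolding cube_def by simp

lemma cube_Obj: "x \<in> P \<Longrightarrow> cube n A x I \<in> Obj PC"
  unfolding PC_Obj using tob_i by (auto simp: cube_def)

lemma cube_ext: "cube n A x I \<in> extensional {1..n}"
  unfolding cube_def by simp

lemma cube_P_len: "cube n A x I \<in> P \<Longrightarrow> i \<in> I \<Longrightarrow> i \<in> {1..n} \<Longrightarrow> len (A i) (bd (A i) (x i)) \<ge> 1"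
  unfolding P_iff by (metis cube_apply)

lemma cube_P_antimono:
  assumes "x \<in> P" "I \<subseteq> I'" "cube n A x I' \<in> P"
  shows "cube n A x I \<in> P"
  unfolding P_iff using cube_P_len[OF assms(3)] assms(2) tob_i[OF assms(1)] cube_ext
  by (auto simp: cube_apply)

lemma cube_sdown:
  assumes x: "x \<in> P" and I: "I \<in> faces n" and c: "cube n A x I \<in> P"
  shows "cube n A x I \<in> sdown P le x"
proof -
  have t: "tle (A i) (cube n A x I i) (x i)" if i: "i \<in> {1..n}" for i
  proof -
    interpret B: precontextual_category "A i" by (rule pc[OF i])
    show ?thesis using B.disp_bd(1) B.tle_refl tob_i[OF x i] cube_apply[OF i] by simp
  qed
  obtain i where "i \<in> I" "i \<in> {1..n}" using I unfolding faces_def by blast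
  then have "cube n A x I i \<noteq> x i" using tob_i(5)[OF x] cube_apply[of i x I] by simp
  then have "cube n A x I \<noteq> x" by auto
  then show ?thesis using c t unfolding sdown_def ptle_def by auto
qed

text \<open>An entry of \<open>z\<close> that differs from that of \<open>x\<close> lies below
  \<open>bd\<close> of it, so \<open>z\<close> lies below the vertex lowering exactly these entries.
  The vertex is in \<open>P\<close> because its lengths are at least those of
  \<open>z\<close>.\<close>

lemma below_cube:
  assumes x: "x \<in> P" and z: "z \<in> sdown P le x"
  defines "I \<equiv> {i \<in> {1..n}. z i \<noteq> x i}"
  shows "I \<in> faces n" "cube n A x I \<in> P" "le z (cube n A x I)"
proof -
  have zP: "z \<in> P" and zx: "le z x" "z \<noteq> x" using z unfolding sdown_def by auto
  have "\<exists>i\<in>{1..n}. z i \<noteq> x i"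
    using zx(2) zP x extensionalityI[of z "{1..n}" x] unfolding P_iff by blast
  then show "I \<in> faces n" unfolding I_def faces_def by auto
  have le: "tle (A i) (z i) (cube n A x I i)" if i: "i \<in> {1..n}" for i
  proof -
    interpret B: precontextual_category "A i" by (rule pc[OF i])
    show ?thesis
      using zx(1) i B.tle_less_bd B.tle_refl tob_i[OF x i] cube_apply[OF i] unfolding I_def ptle_def by auto
  qed
  then show "le z (cube n A x I)" unfolding ptle_def by blast
  show "cube n A x I \<in> P"
    unfolding P_iff
  proof (intro conjI ballI cube_ext)
    fix i assume i: "i \<in> {1..n}"
    interpret B: precontextual_category "A i" by (rule pc[OF i])
    show "cube n A x I i \<in> Obj (A i)" "len (A i) (cube n A x I i) \<ge> 1"
      using B.tle_Obj[OF le[OF i]] B.tle_len[OF le[OF i]] tob_i[OF zP i] by auto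
  qed
qed

lemma cube_arr_hom:
  assumes x: "x \<in> P" and II: "I \<subseteq> I'"
  shows "cube_arr n A x I I' \<in> hom PC (cube n A x I) (cube n A x I')"
proof (subst PC_hom, intro cube_ext, rule cube_ext, intro conjI ballI)
  fix i assume i: "i \<in> {1..n}"
  show "cube_arr n A x I I' i \<in> hom (A i) (cube n A x I i) (cube n A x I' i)"
    using tob_i[OF x i] II category_of.id_hom[OF cat_i[OF i]] i
    by (auto simp: cube_arr_def cube_apply)
qed (simp add: cube_arr_def)

lemma cube_arr_pdisp:
  assumes x: "x \<in> P" and II: "I \<subseteq> I'" and c: "cube n A x I' \<in> P"
  shows "cube_arr n A x I I' = pdisp n A (cube n A x I) (cube n A x I')"
    "le (cube n A x I') (cube n A x I)"
proof -
  have "cube_arr n A x I I' i = disp (A i) (cube n A x I i) (cube n A x I' i) \<and>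
      tle (A i) (cube n A x I' i) (cube n A x I i)" if i: "i \<in> {1..n}" for i
  proof -
    interpret B: precontextual_category "A i" by (rule pc[OF i])
    show ?thesis
      using tob_i[OF x i] II B.disp_bd[of "x i"] B.disp_refl B.tle_refl i
      by (auto simp: cube_arr_def cube_apply)
  qed
  then show "cube_arr n A x I I' = pdisp n A (cube n A x I) (cube n A x I')"
    "le (cube n A x I') (cube n A x I)"
    unfolding ptle_def pdisp_def by (auto simp: cube_arr_def fun_eq_iff)
qed

lemma Sq_familyD:
  assumes "Sq_family n A x y f0 f1"
  shows "x \<in> P" "y \<in> P" "f0 \<in> hom PC x y"
    "i \<in> {1..n} \<Longrightarrow> f0 i \<in> hom (A i) (x i) (y i)"
    "i \<in> {1..n} \<Longrightarrow> f1 i \<in> hom (A i) (bd (A i) (x i)) (bd (A i) (y i))"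
    "i \<in> {1..n} \<Longrightarrow> Cmp (A i) (proj (A i) (y i)) (f0 i) = Cmp (A i) (f1 i) (proj (A i) (x i))"
proof -
  note S = assms[unfolded Sq_family_def]
  show x: "x \<in> P" and y: "y \<in> P" and "f0 \<in> hom PC x y" using S by auto
  assume i: "i \<in> {1..n}"
  interpret B: precontextual_category "A i" by (rule pc[OF i])
  have "(f0 i, proj (A i) (x i), proj (A i) (y i), f1 i) \<in> Sq (A i)" using S i by blast
  from B.Sq_projD[OF this tob_i(1)[OF x i] tob_i(1)[OF y i] tob_i(2)[OF x i] tob_i(2)[OF y i]]
  show "f0 i \<in> hom (A i) (x i) (y i)" "f1 i \<in> hom (A i) (bd (A i) (x i)) (bd (A i) (y i))"
    "Cmp (A i) (proj (A i) (y i)) (f0 i) = Cmp (A i) (f1 i) (proj (A i) (x i))" .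
qed

lemma mixed_hom:
  assumes "Sq_family n A x y f0 f1"
  shows "mixed n f0 f1 I \<in> hom PC (cube n A x I) (cube n A y I)"
  using Sq_familyD(4,5)[OF assms] by (subst PC_hom) (auto simp: mixed_def cube_apply cube_def)

text \<open>Coordinates in \<open>I' - I\<close> are the given commuting squares; in the others
  \<open>cube_arr\<close> is an identity.\<close>

lemma mixed_cube_arr:
  assumes S: "Sq_family n A x y f0 f1" and II: "I \<subseteq> I'"
  shows "Cmp PC (mixed n f0 f1 I') (cube_arr n A x I I') = Cmp PC (cube_arr n A y I I') (mixed n f0 f1 I)"
proof -
  have "Cmp (A i) (mixed n f0 f1 I' i) (cube_arr n A x I I' i) =
      Cmp (A i) (cube_arr n A y I I' i) (mixed n f0 f1 I i)" if i: "i \<in> {1..n}" for i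
  proof -
    interpret B: precontextual_category "A i" by (rule pc[OF i])
    note D = Sq_familyD[OF S]
    consider "i \<in> I' - I" | "i \<in> I" "i \<in> I'" | "i \<notin> I" "i \<notin> I'" using II by blast
    then show ?thesis
    proof cases
      case 1
      then show ?thesis using D(6)[OF i] i by (simp add: mixed_def cube_arr_def)
    next
      case 2
      then show ?thesis using B.id_left[OF D(5)[OF i]] B.id_right[OF D(5)[OF i]] i
        by (simp add: mixed_def cube_arr_def cube_apply)
    next
      case 3
      then show ?thesis using B.id_left[OF D(4)[OF i]] B.id_right[OF D(4)[OF i]] i
        by (simp add: mixed_def cube_arr_def cube_apply)
    qed
  qed
  then show ?thesis unfolding PC_Cmp by (auto simp: fun_eq_iff)
qed

end

section \<open>Characterization of multimorphisms\<close>

text \<open>A multimorphism without extensionality and without the clause on squares: just enough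
  for boundary objects to make sense, so that the clause on squares can be proved
  afterwards.\<close>

locale cellular_functor = precontextual_family n A + contextual_category C
  for n and A :: "nat \<Rightarrow> ('o, 'm) precat" and C :: "('c, 'd) precat" +
  fixes F :: "(nat \<Rightarrow> 'o, nat \<Rightarrow> 'm, 'c, 'd) ftr"
  assumes F_functor: "is_functor (prod_cat n A) C F"
    and F_unit: "\<And>x. x \<in> Obj (prod_cat n A) \<Longrightarrow> x \<notin> ptob n A \<Longrightarrow> fob F x = unit_ob C"
    and loc: "locally_cellular C (ptob n A) (ptle n A) (lex_lin n A) (tdiag n A F)"
begin

sublocale L: locally_cellular_diagram C P le lin "tdiag n A F"
  by unfold_locales (rule local_linearization, rule loc)

lemma F_hom: "f \<in> hom PC x y \<Longrightarrow> far F f \<in> hom C (fob F x) (fob F y)"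
  using F_functor unfolding is_functor_def hom_def by auto

lemma F_comp: "f \<in> hom PC x y \<Longrightarrow> g \<in> hom PC y z \<Longrightarrow> far F (Cmp PC g f) = far F g \<cdot> far F f"
  using F_functor unfolding is_functor_def hom_def by auto

lemma F_Obj: "x \<in> Obj PC \<Longrightarrow> fob F x \<in> Obj C"
  and F_id: "x \<in> Obj PC \<Longrightarrow> far F (Idn PC x) = Idn C (fob F x)"
  using F_functor unfolding is_functor_def by auto

lemma latching_bnd: "latching C P le (tdiag n A F) (bnd n A C F) (bnd_proj n A C F)"
  using L.latching_latch unfolding bnd_def bnd_proj_def .

lemma bnd:
  assumes "x \<in> P"
  shows "fob F x \<in> Obj C" "len C (fob F x) \<ge> 1" "bd C (fob F x) = bnd n A C F x"
    "limit_cone C le (tdiag n A F) (sdown P le x) (bnd n A C F x) (bnd_proj n A C F x)"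
    "z \<in> sdown P le x \<Longrightarrow> bnd_proj n A C F x z \<in> hom C (bnd n A C F x) (fob F z)"
    "bnd n A C F x \<in> Obj C"
proof -
  show "fob F x \<in> Obj C" using F_Obj P_Obj assms by blast
  show "len C (fob F x) \<ge> 1" "bd C (fob F x) = bnd n A C F x"
    and l: "limit_cone C le (tdiag n A F) (sdown P le x) (bnd n A C F x) (bnd_proj n A C F x)"
    using latching_bnd assms unfolding latching_def tdiag_simps by auto
  show "z \<in> sdown P le x \<Longrightarrow> bnd_proj n A C F x z \<in> hom C (bnd n A C F x) (fob F z)"
    "bnd n A C F x \<in> Obj C"
    using limit_coneD(1,2)[OF l] unfolding tdiag_simps by auto
qed

lemma diagram_sdown: "diagram_on C (sdown P le x) le (tdiag n A F)"
  by (rule diagram_on_subset[OF L.diagram]) (auto simp: sdown_def)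

lemma bnd_mono:
  assumes "x \<in> P" "m \<in> hom C c (bnd n A C F x)" "m' \<in> hom C c (bnd n A C F x)"
    "\<And>z. z \<in> sdown P le x \<Longrightarrow> bnd_proj n A C F x z \<cdot> m = bnd_proj n A C F x z \<cdot> m'"
  shows "m = m'"
  using limit_mono[OF diagram_sdown bnd(4)[OF assms(1)] assms(2,3,4)] .

lemma bnd_proj_comp:
  assumes "x \<in> P" "z \<in> sdown P le x" "y \<in> sdown P le x" "le z y"
  shows "far F (pdisp n A y z) \<cdot> bnd_proj n A C F x y = bnd_proj n A C F x z"
  using limit_coneD(3)[OF bnd(4)[OF assms(1)], of z y] assms(2,3,4) unfolding tdiag_simps by blast

lemma cube_proj_hom:
  assumes x: "x \<in> P" and I: "I \<in> faces n"
  shows "cube_proj n A C F x I \<in> hom C (bnd n A C F x) (fob F (cube n A x I))"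
proof (cases "cube n A x I \<in> P")
  case True
  then show ?thesis using bnd(5)[OF x cube_sdown[OF x I True]] unfolding cube_proj_def by simp
next
  case False
  obtain f where f: "f \<in> hom C (bnd n A C F x) (unit_ob C)" using unit_hom_ex[OF bnd(6)[OF x]] by blast
  have "(THE m. m \<in> hom C (bnd n A C F x) (unit_ob C)) = f"
    using f unit_hom_eq by blast
  then show ?thesis using f False F_unit[OF cube_Obj[OF x] False] unfolding cube_proj_def by simp
qed

text \<open>Tuples with an entry of length 0 go to the terminal object, so all equations of arrows
  into them hold automatically. This settles the cube equations outside \<open>P\<close>.\<close>

lemma unit_arr_eq:
  assumes "x \<in> Obj PC" "x \<notin> P" "f \<in> hom C a (fob F x)" "g \<in> hom C a (fob F x)"
  shows "f = g"
  using assms F_unit unit_hom_eq by simp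

lemma cube_proj_arr:
  assumes x: "x \<in> P" and I: "I \<in> faces n" "I' \<in> faces n" "I \<subseteq> I'"
  shows "far F (cube_arr n A x I I') \<cdot> cube_proj n A C F x I = cube_proj n A C F x I'"
proof (cases "cube n A x I' \<in> P")
  case True
  note c = cube_P_antimono[OF x I(3) True]
  note e = cube_arr_pdisp[OF x I(3) True]
  show ?thesis
    using bnd_proj_comp[OF x cube_sdown[OF x I(2) True] cube_sdown[OF x I(1) c] e(2)] e(1) c True
    unfolding cube_proj_def by simp
next
  case False
  show ?thesis
    by (rule unit_arr_eq[OF cube_Obj[OF x] False comp_hom[OF cube_proj_hom[OF x I(1)]
          F_hom[OF cube_arr_hom[OF x I(3)]]] cube_proj_hom[OF x I(2)]])
qed

lemma bnd_proj_cube: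
  assumes x: "x \<in> P" and z: "z \<in> sdown P le x"
  defines "I \<equiv> {i \<in> {1..n}. z i \<noteq> x i}"
  shows "bnd_proj n A C F x z = far F (pdisp n A (cube n A x I) z) \<cdot> cube_proj n A C F x I"
proof -
  note b = below_cube[OF x z, folded I_def]
  show ?thesis using bnd_proj_comp[OF x z cube_sdown[OF x b(1,2)] b(3)] b(2) unfolding cube_proj_def by simp
qed

text \<open>By cofinality every projection of the boundary object factors through one to a vertex of
  the cube, so the vertices detect equality.\<close>

lemma cube_mono:
  assumes x: "x \<in> P" and m: "m \<in> hom C c (bnd n A C F x)" "m' \<in> hom C c (bnd n A C F x)"
    and e: "\<And>I. I \<in> faces n \<Longrightarrow> cube_proj n A C F x I \<cdot> m = cube_proj n A C F x I \<cdot> m'"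
  shows "m = m'"
proof (rule bnd_mono[OF x m])
  fix z assume z: "z \<in> sdown P le x"
  let ?I = "{i \<in> {1..n}. z i \<noteq> x i}"
  note b = below_cube[OF x z]
  have zP: "z \<in> P" using z unfolding sdown_def by blast
  note h = F_hom[OF pdisp_hom[OF zP b(2,3)]] and c = cube_proj_hom[OF x b(1)]
  show "bnd_proj n A C F x z \<cdot> m = bnd_proj n A C F x z \<cdot> m'"
    unfolding bnd_proj_cube[OF x z] using assoc[OF m(1) c h] assoc[OF m(2) c h] e[OF b(1)] by simp
qed

text \<open>The map of limits exists before anything is known about preservation of squares. Its
  component at \<open>z\<close> strictly below \<open>y\<close> uses the set of entries where
  \<open>z\<close> and \<open>y\<close> differ: project to that vertex of the cube of
  \<open>x\<close>, cross to the cube of \<open>y\<close> by \<open>F\<close>, and go down to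
  \<open>z\<close> along a display map.\<close>

lemma cube_induced_ex:
  assumes S: "Sq_family n A x y f0 f1"
  shows "\<exists>\<beta>\<in>hom C (bnd n A C F x) (bnd n A C F y). \<forall>I\<in>faces n.
     cube_proj n A C F y I \<cdot> \<beta> = far F (mixed n f0 f1 I) \<cdot> cube_proj n A C F x I"
proof -
  note D = Sq_familyD[OF S]
  note x = D(1) and y = D(2)
  let ?cx = "cube_proj n A C F x" and ?cy = "cube_proj n A C F y"
  let ?f = "\<lambda>I. far F (mixed n f0 f1 I)"
  define I where "I z = {i \<in> {1..n}. z i \<noteq> y i}" for z
  define \<nu> where "\<nu> z = far F (pdisp n A (cube n A y (I z)) z) \<cdot> ?f (I z) \<cdot> ?cx (I z)" for z
  note b = below_cube[OF y, folded I_def]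
  have fc: "?f I \<cdot> ?cx I \<in> hom C (bnd n A C F x) (fob F (cube n A y I))" if "I \<in> faces n" for I
    using comp_hom[OF cube_proj_hom[OF x that] F_hom[OF mixed_hom[OF S]]] .
  have zP: "z \<in> P" if "z \<in> sdown P le y" for z using that unfolding sdown_def by blast
  have ph: "far F (pdisp n A (cube n A y (I z)) z) \<in> hom C (fob F (cube n A y (I z))) (fob F z)"
    if "z \<in> sdown P le y" for z using F_hom[OF pdisp_hom[OF zP[OF that] b(2,3)[OF that]]] .
  have \<nu>h: "\<nu> z \<in> hom C (bnd n A C F x) (fob F z)" if "z \<in> sdown P le y" for z
    unfolding \<nu>_def using comp_hom[OF fc[OF b(1)[OF that]] ph[OF that]] .
  have "far F (pdisp n A z w) \<cdot> \<nu> z = \<nu> w"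
    if w: "w \<in> sdown P le y" and z: "z \<in> sdown P le y" and wz: "le w z" for w z
  proof -
    note fh = F_hom[OF mixed_hom[OF S]]
    have zy: "le z y" using z unfolding sdown_def by blast
    \<comment> \<open>Going down from \<open>z\<close> to \<open>w\<close> can only enlarge the set
      of entries that differ from \<open>y\<close>, by antisymmetry.\<close>
    have II: "I z \<subseteq> I w"
    proof
      fix i assume i: "i \<in> I z"
      then have i': "i \<in> {1..n}" "z i \<noteq> y i" unfolding I_def by auto
      interpret B: precontextual_category "A i" by (rule pc[OF i'(1)])
      have "tle (A i) (w i) (z i)" "tle (A i) (z i) (y i)" using wz zy i'(1) unfolding ptle_def by auto
      then have "w i \<noteq> y i" using B.tle_antisym i'(2) by metis
      then show "i \<in> I w" using i' unfolding I_def by blast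
    qed
    note e = cube_arr_pdisp[OF y II b(2)[OF w]]
    note pw = pdisp_hom[OF zP[OF w] zP[OF z] wz] and pz = pdisp_hom[OF zP[OF z] b(2,3)[OF z]]
      and pw' = pdisp_hom[OF zP[OF w] b(2,3)[OF w]]
    note qh = cube_arr_hom[OF y II] and qx = cube_arr_hom[OF x II]
    have "far F (pdisp n A z w) \<cdot> \<nu> z =
        far F (Cmp PC (pdisp n A z w) (pdisp n A (cube n A y (I z)) z)) \<cdot> ?f (I z) \<cdot> ?cx (I z)"
      unfolding \<nu>_def F_comp[OF pz pw] using assoc[OF fc[OF b(1)[OF z]] ph[OF z] F_hom[OF pw]] by simp
    \<comment> \<open>Both composites are the display arrow from the vertex above \<open>z\<close>
      down to \<open>w\<close>.\<close>
    also have "Cmp PC (pdisp n A z w) (pdisp n A (cube n A y (I z)) z) =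
        Cmp PC (pdisp n A (cube n A y (I w)) w) (cube_arr n A y (I z) (I w))"
      unfolding e(1) using pdisp_trans[OF wz b(3)[OF z]] pdisp_trans[OF b(3)[OF w] e(2)] by simp
    also have "far F \<dots> \<cdot> ?f (I z) \<cdot> ?cx (I z) =
        far F (pdisp n A (cube n A y (I w)) w) \<cdot> (far F (cube_arr n A y (I z) (I w)) \<cdot> ?f (I z) \<cdot> ?cx (I z))"
      unfolding F_comp[OF qh pw'] using assoc[OF fc[OF b(1)[OF z]] F_hom[OF qh] F_hom[OF pw']] by simp
    also have "far F (cube_arr n A y (I z) (I w)) \<cdot> ?f (I z) \<cdot> ?cx (I z) =
        far F (Cmp PC (cube_arr n A y (I z) (I w)) (mixed n f0 f1 (I z))) \<cdot> ?cx (I z)"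
      unfolding F_comp[OF mixed_hom[OF S] qh]
      using assoc[OF cube_proj_hom[OF x b(1)[OF z]] fh F_hom[OF qh]] by simp
    also have "\<dots> = far F (Cmp PC (mixed n f0 f1 (I w)) (cube_arr n A x (I z) (I w))) \<cdot> ?cx (I z)"
      using mixed_cube_arr[OF S II] by simp
    also have "\<dots> = ?f (I w) \<cdot> far F (cube_arr n A x (I z) (I w)) \<cdot> ?cx (I z)"
      unfolding F_comp[OF qx mixed_hom[OF S]]
      using assoc[OF cube_proj_hom[OF x b(1)[OF z]] F_hom[OF qx] fh] by simp
    also have "far F (cube_arr n A x (I z) (I w)) \<cdot> ?cx (I z) = ?cx (I w)"
      using cube_proj_arr[OF x b(1)[OF z] b(1)[OF w] II] .
    finally show ?thesis unfolding \<nu>_def .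
  qed
  then have c: "cone C le (tdiag n A F) (sdown P le y) (bnd n A C F x) \<nu>"
    using \<nu>h bnd(6)[OF x] unfolding cone_def tdiag_simps by blast
  let ?\<beta> = "induced C (sdown P le y) (bnd n A C F x) \<nu> (bnd n A C F y) (bnd_proj n A C F y)"
  note i = induced[OF bnd(4)[OF y] c]
  have "?cy J \<cdot> ?\<beta> = ?f J \<cdot> ?cx J" if J: "J \<in> faces n" for J
  proof (cases "cube n A y J \<in> P")
    case True
    note s = cube_sdown[OF y J True]
    \<comment> \<open>\<open>bd\<close> shortens every entry, so the vertex for \<open>J\<close>
      differs from \<open>y\<close> in exactly the entries of \<open>J\<close>.\<close>
    have IJ: "I (cube n A y J) = J"
      using J tob_i(5)[OF y] unfolding I_def faces_def by (auto simp: cube_apply split: if_splits)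
    have "?cy J \<cdot> ?\<beta> = \<nu> (cube n A y J)" using i(2)[OF s] True unfolding cube_proj_def by simp
    also have "\<dots> = ?f J \<cdot> ?cx J"
      unfolding \<nu>_def IJ pdisp_refl[OF True] F_id[OF P_Obj[OF True]] by (rule id_left[OF fc[OF J]])
    finally show ?thesis .
  next
    case False
    show ?thesis
      by (rule unit_arr_eq[OF cube_Obj[OF y] False comp_hom[OF i(1) cube_proj_hom[OF y J]] fc[OF J]])
  qed
  then show ?thesis using i(1) by blast
qed

end

text \<open>The bottom arrow is a witness with prescribed projections in place of the term
  \<open>induced\<close>. It is unique by \<open>cube_mono\<close>, and witnesses can be composed
  and mapped by functors directly.\<close>

definition preserves_squares :: "nat \<Rightarrow> (nat \<Rightarrow> ('o, 'm) precat) \<Rightarrow> ('c, 'd) precat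
    \<Rightarrow> (nat \<Rightarrow> 'o, nat \<Rightarrow> 'm, 'c, 'd) ftr \<Rightarrow> bool" where
  "preserves_squares n A C F \<longleftrightarrow> (\<forall>x y f0 f1. Sq_family n A x y f0 f1 \<longrightarrow>
     (\<exists>\<beta>\<in>hom C (bnd n A C F x) (bnd n A C F y).
        (\<forall>I\<in>faces n. Cmp C (cube_proj n A C F y I) \<beta> = Cmp C (far F (mixed n f0 f1 I)) (cube_proj n A C F x I)) \<and>
        (far F f0, proj C (fob F x), proj C (fob F y), \<beta>) \<in> Sq C))"

context cellular_functor
begin

text \<open>\<open>cube_induced_ex\<close> and \<open>cube_mono\<close> show that the arrow
  described by \<open>induced\<close> exists and is unique, so both forms of the clause on squares
  agree.\<close>

lemma multimorphism_iff:
  "multimorphism n A C F \<longleftrightarrow> ext_ftr PC F \<and> preserves_squares n A C F"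
proof -
  let ?ind = "\<lambda>x y f0 f1. induced C (faces n) (bnd n A C F x)
     (\<lambda>I. far F (mixed n f0 f1 I) \<cdot> cube_proj n A C F x I) (bnd n A C F y) (cube_proj n A C F y)"
  have ind: "?ind x y f0 f1 = \<beta>"
    if S: "Sq_family n A x y f0 f1" and \<beta>: "\<beta> \<in> hom C (bnd n A C F x) (bnd n A C F y)"
      "\<forall>I\<in>faces n. cube_proj n A C F y I \<cdot> \<beta> = far F (mixed n f0 f1 I) \<cdot> cube_proj n A C F x I"
    for x y f0 f1 \<beta>
    unfolding induced_def
  proof (rule the_equality)
    fix m assume "m \<in> hom C (bnd n A C F x) (bnd n A C F y) \<and>
      (\<forall>I\<in>faces n. cube_proj n A C F y I \<cdot> m = far F (mixed n f0 f1 I) \<cdot> cube_proj n A C F x I)"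
    then show "m = \<beta>" using cube_mono[OF Sq_familyD(2)[OF S], of m _ \<beta>] \<beta> by auto
  qed (use \<beta> in auto)
  have sq: "distinguished C (far F f0, proj C (fob F x), proj C (fob F y), ?ind x y f0 f1) \<longleftrightarrow>
     (\<exists>\<beta>\<in>hom C (bnd n A C F x) (bnd n A C F y).
        (\<forall>I\<in>faces n. Cmp C (cube_proj n A C F y I) \<beta> = Cmp C (far F (mixed n f0 f1 I)) (cube_proj n A C F x I)) \<and>
        (far F f0, proj C (fob F x), proj C (fob F y), \<beta>) \<in> Sq C)"
    if S: "Sq_family n A x y f0 f1" for x y f0 f1
    unfolding distinguished_iff[OF bnd(1,2)[OF Sq_familyD(2)[OF S]]]
  proof
    assume *: "(far F f0, proj C (fob F x), proj C (fob F y), ?ind x y f0 f1) \<in> Sq C"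
    obtain \<beta> where \<beta>: "\<beta> \<in> hom C (bnd n A C F x) (bnd n A C F y)"
      "\<forall>I\<in>faces n. cube_proj n A C F y I \<cdot> \<beta> = far F (mixed n f0 f1 I) \<cdot> cube_proj n A C F x I"
      using cube_induced_ex[OF S] by blast
    with * show "\<exists>\<beta>\<in>hom C (bnd n A C F x) (bnd n A C F y).
        (\<forall>I\<in>faces n. Cmp C (cube_proj n A C F y I) \<beta> = Cmp C (far F (mixed n f0 f1 I)) (cube_proj n A C F x I)) \<and>
        (far F f0, proj C (fob F x), proj C (fob F y), \<beta>) \<in> Sq C"
      unfolding ind[OF S \<beta>] by blast
  next
    assume "\<exists>\<beta>\<in>hom C (bnd n A C F x) (bnd n A C F y).
        (\<forall>I\<in>faces n. Cmp C (cube_proj n A C F y I) \<beta> = Cmp C (far F (mixed n f0 f1 I)) (cube_proj n A C F x I)) \<and>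
        (far F f0, proj C (fob F x), proj C (fob F y), \<beta>) \<in> Sq C"
    then show "(far F f0, proj C (fob F x), proj C (fob F y), ?ind x y f0 f1) \<in> Sq C"
      using ind[OF S] by auto
  qed
  have u: "\<forall>x\<in>Obj PC. (\<exists>i\<in>{1..n}. len (A i) (x i) = 0) \<longrightarrow> fob F x = unit_ob C"
    using F_unit unfolding P_iff_Obj by blast
  have "multimorphism n A C F \<longleftrightarrow> ext_ftr PC F \<and> (\<forall>x y f0 f1. Sq_family n A x y f0 f1 \<longrightarrow>
      distinguished C (far F f0, proj C (fob F x), proj C (fob F y), ?ind x y f0 f1))"
    unfolding multimorphism_def Sq_family_def faces_def mixed_def using F_functor u loc by blast
  also have "\<dots> \<longleftrightarrow> ext_ftr PC F \<and> preserves_squares n A C F"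
    unfolding preserves_squares_def using sq by simp
  finally show ?thesis .
qed

end

lemma multimorphism_cellular_functor:
  assumes "precontextual_family n A" "contextual_category C" "multimorphism n A C F"
  shows "cellular_functor n A C F"
proof -
  interpret precontextual_family n A by fact
  interpret contextual_category C by fact
  show ?thesis
    by unfold_locales (use assms(3) in \<open>auto simp: multimorphism_def P_iff_Obj\<close>)
qed

section \<open>What reordering of tuples preserves: the product category, the componentwise order,
  the cubes\<close>

section \<open>Permutation of factors\<close>

text \<open>One polymorphic function for tuples of objects and of arrows, which are separate fields
  of \<open>perm_ftr\<close>.\<close>

definition reorder :: "nat \<Rightarrow> (nat \<Rightarrow> nat) \<Rightarrow> (nat \<Rightarrow> 'a) \<Rightarrow> nat \<Rightarrow> 'a" where
  "reorder n \<sigma> x = (\<lambda>i\<in>{1..n}. x (\<sigma> i))"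

lemma reorder_apply: "i \<in> {1..n} \<Longrightarrow> reorder n \<sigma> x i = x (\<sigma> i)"
  and reorder_ext: "reorder n \<sigma> x \<in> extensional {1..n}"
  unfolding reorder_def by auto

lemma perm_ftr_simps: "fob (perm_ftr n \<sigma>) x = reorder n \<sigma> x" "far (perm_ftr n \<sigma>) f = reorder n \<sigma> f"
  unfolding perm_ftr_def reorder_def by simp_all

lemma reorder_reorder:
  assumes "\<sigma> permutes {1..n}" "x \<in> extensional {1..n}"
  shows "reorder n (inv \<sigma>) (reorder n \<sigma> x) = x" "reorder n \<sigma> (reorder n (inv \<sigma>) x) = x"
proof -
  have 1: "\<sigma> i \<in> {1..n} \<longleftrightarrow> i \<in> {1..n}" "inv \<sigma> i \<in> {1..n} \<longleftrightarrow> i \<in> {1..n}"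
    "\<sigma> (inv \<sigma> i) = i" "inv \<sigma> (\<sigma> i) = i" for i
    using permutes_in_image[OF assms(1)] permutes_in_image[OF permutes_inv[OF assms(1)]]
      permutes_inverses[OF assms(1)] by auto
  show "reorder n (inv \<sigma>) (reorder n \<sigma> x) = x" "reorder n \<sigma> (reorder n (inv \<sigma>) x) = x"
    using assms(2) 1 unfolding reorder_def fun_eq_iff by (auto simp: extensional_def)
qed

locale permuted_family = precontextual_family n A for n and A :: "nat \<Rightarrow> ('o, 'm) precat" +
  fixes \<sigma> :: "nat \<Rightarrow> nat"
  assumes perm: "\<sigma> permutes {1..n}"
begin

lemma perm_in: "i \<in> {1..n} \<Longrightarrow> \<sigma> i \<in> {1..n}"
  using permutes_in_image[OF perm] by blast

lemma perm_surj:
  assumes "i \<in> {1..n}"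
  obtains k where "k \<in> {1..n}" "i = \<sigma> k"
  using assms permutes_image[OF perm] by blast

lemma perm_all: "(\<forall>i\<in>{1..n}. Q (\<sigma> i)) \<longleftrightarrow> (\<forall>i\<in>{1..n}. Q i)"
  using perm_in perm_surj by metis

sublocale S: precontextual_family n "A \<circ> \<sigma>"
  by unfold_locales (use family perm_in in auto)

abbreviation "s \<equiv> reorder n \<sigma>"

lemma s_Obj: "x \<in> Obj PC \<Longrightarrow> s x \<in> Obj S.PC"
  unfolding PC_Obj S.PC_Obj using perm_in by (auto simp: reorder_def)

lemma s_P: "x \<in> P \<Longrightarrow> s x \<in> S.P"
  unfolding P_iff S.P_iff using perm_in by (auto simp: reorder_def)

lemma s_P_iff: "x \<in> Obj PC \<Longrightarrow> s x \<in> S.P \<longleftrightarrow> x \<in> P"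
  unfolding P_iff S.P_iff PC_Obj using perm_all[of "\<lambda>i. x i \<in> Obj (A i) \<and> 1 \<le> len (A i) (x i)"]
  by (auto simp: reorder_apply reorder_ext[unfolded One_nat_def])

lemma s_hom:
  assumes "f \<in> hom PC x y" shows "s f \<in> hom S.PC (s x) (s y)"
proof -
  have "x \<in> extensional {1..n}" "y \<in> extensional {1..n}"
    using PC.hom_Obj[OF assms] PC_Obj by auto
  then have "\<forall>i\<in>{1..n}. f i \<in> hom (A i) (x i) (y i)" using assms PC_hom by blast
  then show ?thesis
    by (subst S.PC_hom) (auto simp: reorder_ext[unfolded One_nat_def] reorder_apply perm_in[simplified])
qed

lemma s_Cmp: "s (Cmp PC g f) = Cmp S.PC (s g) (s f)"
  unfolding PC_Cmp S.PC_Cmp using perm_in by (auto simp: fun_eq_iff reorder_def)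

lemma s_Idn: "s (Idn PC x) = Idn S.PC (s x)"
  unfolding PC_Idn S.PC_Idn using perm_in by (auto simp: fun_eq_iff reorder_def)

lemma s_pdisp: "s (pdisp n A y x) = pdisp n (A \<circ> \<sigma>) (s y) (s x)"
  unfolding pdisp_def using perm_in by (auto simp: fun_eq_iff reorder_def)

text \<open>The componentwise order is insensitive to the order of the factors. The lexicographic
  order is not, which is why \<open>F\<close> composed with the permutation is in general no
  multimorphism.\<close>

lemma s_le: "S.le (s x) (s y) \<longleftrightarrow> le x y"
  unfolding ptle_def using perm_all[of "\<lambda>i. tle (A i) (x i) (y i)"] by (simp add: reorder_apply)

lemma s_inj: "x \<in> P \<Longrightarrow> y \<in> P \<Longrightarrow> s x = s y \<Longrightarrow> x = y"
  using reorder_reorder(1)[OF perm, of x] reorder_reorder(1)[OF perm, of y] unfolding P_iff by metis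

lemma s_surj:
  assumes "z \<in> S.P"
  obtains x where "x \<in> P" "z = s x"
proof
  let ?x = "reorder n (inv \<sigma>) z"
  show z: "z = s ?x" using reorder_reorder(2)[OF perm, of z] assms unfolding S.P_iff by simp
  have "\<forall>i\<in>{1..n}. ?x (\<sigma> i) \<in> Obj (A (\<sigma> i)) \<and> 1 \<le> len (A (\<sigma> i)) (?x (\<sigma> i))"
    using assms z unfolding S.P_iff by (metis comp_apply reorder_apply)
  then show "?x \<in> P"
    unfolding P_iff using perm_all[of "\<lambda>i. ?x i \<in> Obj (A i) \<and> 1 \<le> len (A i) (?x i)"] reorder_ext by blast
qed

lemma s_local_iso: "poset_local_iso s P le S.P S.le"
  unfolding poset_local_iso_def
proof (intro ballI conjI)
  fix w assume w: "w \<in> P"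
  show "s w \<in> S.P" using s_P[OF w] .
  show "bij_betw s (down P le w) (down S.P S.le (s w))"
    unfolding bij_betw_def
  proof
    show "inj_on s (down P le w)" using s_inj unfolding inj_on_def down_def by blast
    show "s ` down P le w = down S.P S.le (s w)"
    proof
      show "s ` down P le w \<subseteq> down S.P S.le (s w)" using s_P s_le unfolding down_def by blast
      show "down S.P S.le (s w) \<subseteq> s ` down P le w"
      proof
        fix z assume z: "z \<in> down S.P S.le (s w)"
        then obtain x where "x \<in> P" "z = s x" using s_surj unfolding down_def by blast
        then show "z \<in> s ` down P le w" using z s_le unfolding down_def by blast
      qed
    qed
  qed
qed (simp add: s_le)

text \<open>Position \<open>i\<close> of the reordered tuple holds entry \<open>\<sigma> i\<close>,
  so lowering the entries in \<open>I\<close> means lowering the positions in the preimage of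
  \<open>I\<close>.\<close>

definition face_pre :: "nat set \<Rightarrow> nat set" where
  "face_pre I = {i \<in> {1..n}. \<sigma> i \<in> I}"

lemma face_pre: "I \<in> faces n \<Longrightarrow> face_pre I \<in> faces n"
proof -
  assume I: "I \<in> faces n"
  then obtain i where i: "i \<in> I" "i \<in> {1..n}" unfolding faces_def by blast
  obtain k where "k \<in> {1..n}" "i = \<sigma> k" using perm_surj[OF i(2)] .
  then have "k \<in> face_pre I" using i(1) unfolding face_pre_def by simp
  moreover have "face_pre I \<subseteq> {1..n}" unfolding face_pre_def by blast
  ultimately show "face_pre I \<in> faces n" unfolding faces_def by auto
qed

lemma face_pre_surj:
  assumes "J \<in> faces n"
  obtains I where "I \<in> faces n" "J = face_pre I"
proof
  have J: "J \<noteq> {}" "J \<subseteq> {1..n}" using assms unfolding faces_def by auto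
  show "\<sigma> ` J \<in> faces n" using J perm_in unfolding faces_def by auto
  show "J = face_pre (\<sigma> ` J)"
    using J inj_image_mem_iff[OF permutes_inj[OF perm]] unfolding face_pre_def by auto
qed

lemma s_cube: "s (cube n A x I) = cube n (A \<circ> \<sigma>) (s x) (face_pre I)"
  using perm_in by (auto simp: fun_eq_iff reorder_def cube_def face_pre_def)

lemma s_mixed: "s (mixed n f0 f1 I) = mixed n (s f0) (s f1) (face_pre I)"
  using perm_in by (auto simp: fun_eq_iff reorder_def mixed_def face_pre_def)

lemma s_Sq_family:
  assumes "Sq_family n A x y f0 f1"
  shows "Sq_family n (A \<circ> \<sigma>) (s x) (s y) (s f0) (s f1)"
proof -
  have "s f1 \<in> Arr S.PC"
    using assms perm_in unfolding Sq_family_def S.PC_Arr PC_Arr by (auto simp: reorder_def)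
  moreover have "\<forall>i\<in>{1..n}. (f0 i, proj (A i) (x i), proj (A i) (y i), f1 i) \<in> Sq (A i)"
    using assms unfolding Sq_family_def by blast
  ultimately show ?thesis
    using assms s_P s_hom perm_in unfolding Sq_family_def by (auto simp: reorder_apply)
qed

lemma poset_iso_sdown:
  assumes "x \<in> P"
  shows "s ` sdown P le x = sdown S.P S.le (s x)"
proof -
  interpret locally_linearized_poset P le lin by unfold_locales (rule local_linearization)
  show ?thesis using local_iso_sdown(1)[OF s_local_iso assms] .
qed

end

section \<open>Shuffling diagrams as isomorphisms over the boundary data of the pulled-back
  diagram\<close>

section \<open>Shuffling diagrams\<close>

lemma (in category_of) limit_cone_comparison_iso:
  assumes d: "diagram_on C X le G" and l: "limit_cone C le G X a \<pi>" "limit_cone C le G X b \<rho>"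
    and m: "m \<in> hom C a b" "\<And>x. x \<in> X \<Longrightarrow> \<rho> x \<cdot> m = \<pi> x"
  shows "iso_arr C m"
proof -
  note k = limit_cone_subset_induced[OF l(2,1) subset_refl]
  let ?k = "induced C X b \<rho> a \<pi>"
  note h1 = comp_hom[OF m(1) k(1)] and h2 = comp_hom[OF k(1) m(1)]
  have "?k \<cdot> m = Idn C a"
    by (rule limit_mono[OF d l(1) h1 id_hom[OF limit_coneD(1)[OF l(1)]]])
      (use assoc[OF m(1) k(1) limit_coneD(2)[OF l(1)]] k(2) m(2) id_right[OF limit_coneD(2)[OF l(1)]] in simp)
  moreover have "m \<cdot> ?k = Idn C b"
    by (rule limit_mono[OF d l(2) h2 id_hom[OF limit_coneD(1)[OF l(2)]]])
      (use assoc[OF k(1) m(1) limit_coneD(2)[OF l(2)]] k(2) m(2) id_right[OF limit_coneD(2)[OF l(2)]] in simp)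
  ultimately show ?thesis using iso_arrI[OF m(1) k(1)] by blast
qed

locale multimorphism_source = permuted_family n A \<sigma> + contextual_category C +
    F: cellular_functor n "A \<circ> \<sigma>" C F
  for n and A :: "nat \<Rightarrow> ('o, 'm) precat" and \<sigma> and C :: "('c, 'd) precat" and F
begin

abbreviation "Fs \<equiv> comp_ftr PC F (perm_ftr n \<sigma>)"
abbreviation "G \<equiv> tdiag n A Fs"
abbreviation "g \<equiv> \<lambda>y. bnd n (A \<circ> \<sigma>) C F (s y)"
abbreviation "\<rho> \<equiv> \<lambda>y x. bnd_proj n (A \<circ> \<sigma>) C F (s y) (s x)"

lemma Fs_ob: "x \<in> Obj PC \<Longrightarrow> fob Fs x = fob F (s x)"
  and Fs_ar: "f \<in> Arr PC \<Longrightarrow> far Fs f = far F (s f)"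
  unfolding comp_ftr_def by (simp_all add: perm_ftr_simps)

lemma Fs_hom: "f \<in> hom PC x y \<Longrightarrow> far F (s f) \<in> hom C (fob F (s x)) (fob F (s y))"
  using F.F_hom[OF s_hom] .

lemma Fs_functor: "is_functor PC C Fs"
  unfolding is_functor_def
proof (intro conjI ballI impI)
  fix x assume x: "x \<in> Obj PC"
  show "fob Fs x \<in> Obj C" using Fs_ob[OF x] F.F_Obj[OF s_Obj[OF x]] by simp
  show "far Fs (Idn PC x) = Idn C (fob Fs x)"
    using Fs_ob[OF x] Fs_ar PC.id_hom[OF x] F.F_id[OF s_Obj[OF x]] s_Idn unfolding hom_def by simp
next
  fix f assume f: "f \<in> Arr PC"
  note fh = PC.Arr_hom[OF f]
  show "far Fs f \<in> hom C (fob Fs (Src PC f)) (fob Fs (Trg PC f))"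
    using Fs_hom[OF fh] Fs_ar[OF f] Fs_ob PC.hom_Obj[OF fh] by simp
  fix k assume k: "k \<in> Arr PC" and c: "Src PC k = Trg PC f"
  have kh: "k \<in> hom PC (Trg PC f) (Trg PC k)" using PC.Arr_hom[OF k] c by simp
  show "far Fs (Cmp PC k f) = far Fs k \<cdot> far Fs f"
    using Fs_ar[OF f] Fs_ar[OF k] Fs_ar PC.hom_Arr[OF PC.comp_hom[OF fh kh]] s_Cmp
      F.F_comp[OF s_hom[OF fh] s_hom[OF kh]] by simp
qed

lemma G_diagram: "diagram_on C P le G"
  by (rule diagram_tdiag[OF Fs_functor])

lemma G_simps:
  "x \<in> P \<Longrightarrow> fob G x = fob F (s x)"
  "x \<in> P \<Longrightarrow> y \<in> P \<Longrightarrow> le x y \<Longrightarrow> far G (y, x) = far (tdiag n (A \<circ> \<sigma>) F) (s y, s x)"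
  unfolding tdiag_simps using Fs_ob[OF P_Obj] Fs_ar PC.hom_Arr[OF pdisp_hom] s_pdisp by simp_all

sublocale LP: locally_linearized_poset P le lin
  by unfold_locales (rule local_linearization)

lemma G_latching: "latching C P le G g \<rho>"
  using LP.latching_reindex[OF s_local_iso, of G "tdiag n (A \<circ> \<sigma>) F", OF _ _ F.latching_bnd]
    G_simps unfolding tdiag_simps by simp

lemma G_latchingD:
  assumes "y \<in> P"
  shows "limit_cone C le G (sdown P le y) (g y) (\<rho> y)" "fob F (s y) \<in> Obj C" "len C (fob F (s y)) \<ge> 1"
    "bd C (fob F (s y)) = g y"
  using G_latching assms F.bnd(1,2,3)[OF s_P[OF assms]] unfolding latching_def by auto

lemma G_sdown: "diagram_on C (sdown P le y) le G"
  by (rule diagram_on_subset[OF G_diagram]) (auto simp: sdown_def)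

definition comparison :: "(nat \<Rightarrow> 'o, nat \<Rightarrow> 'm, 'c, 'd) ftr \<Rightarrow> ((nat \<Rightarrow> 'o) \<Rightarrow> 'd) \<Rightarrow> bool" where
  "comparison F' \<phi> \<longleftrightarrow> (\<forall>x\<in>Obj PC. \<phi> x \<in> hom C (fob F' x) (fob F (s x)) \<and> iso_arr C (\<phi> x)) \<and>
     (\<forall>x y. \<forall>f\<in>hom PC x y. \<phi> y \<cdot> far F' f = far F (s f) \<cdot> \<phi> x)"

text \<open>As in \<open>preserves_squares\<close>, the bottom arrow is a witness. For every
  comparison between cellular functors such a \<open>\<kappa>\<close> exists and is unique, so the
  condition lies in membership in \<open>Sq\<close>.\<close>

definition latching_squares :: "(nat \<Rightarrow> 'o, nat \<Rightarrow> 'm, 'c, 'd) ftr \<Rightarrow> ((nat \<Rightarrow> 'o) \<Rightarrow> 'd) \<Rightarrow> bool" where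
  "latching_squares F' \<phi> \<longleftrightarrow> (\<forall>a\<in>P. \<exists>\<kappa>\<in>hom C (bnd n A C F' a) (g a).
     (\<forall>b\<in>sdown P le a. \<rho> a b \<cdot> \<kappa> = \<phi> b \<cdot> bnd_proj n A C F' a b) \<and>
     (\<phi> a, proj C (fob F' a), proj C (fob F (s a)), \<kappa>) \<in> Sq C)"

lemma nat_iso_comparison: "nat_iso PC C F' Fs \<phi> \<longleftrightarrow> comparison F' \<phi>"
proof -
  have "(\<forall>f\<in>Arr PC. \<phi> (Trg PC f) \<cdot> far F' f = far F (s f) \<cdot> \<phi> (Src PC f)) \<longleftrightarrow>
      (\<forall>x y. \<forall>f\<in>hom PC x y. \<phi> y \<cdot> far F' f = far F (s f) \<cdot> \<phi> x)"
    unfolding hom_def by auto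
  then show ?thesis unfolding nat_iso_def comparison_def using Fs_ob Fs_ar by simp
qed

end

locale shuffling_pair = multimorphism_source n A \<sigma> C F + F': cellular_functor n A C F'
  for n and A :: "nat \<Rightarrow> ('o, 'm) precat" and \<sigma> and C :: "('c, 'd) precat" and F F' +
  fixes \<phi> :: "(nat \<Rightarrow> 'o) \<Rightarrow> 'd"
  assumes cmp: "comparison F' \<phi>"
begin

lemma \<phi>_hom: "x \<in> Obj PC \<Longrightarrow> \<phi> x \<in> hom C (fob F' x) (fob F (s x))"
  and \<phi>_iso: "x \<in> Obj PC \<Longrightarrow> iso_arr C (\<phi> x)"
  and \<phi>_nat: "f \<in> hom PC x y \<Longrightarrow> \<phi> y \<cdot> far F' f = far F (s f) \<cdot> \<phi> x"
  using cmp unfolding comparison_def by blast+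

lemma \<phi>_nat_diagram:
  assumes "x \<in> P" "y \<in> P" "le x y"
  shows "\<phi> x \<cdot> far (tdiag n A F') (y, x) = far G (y, x) \<cdot> \<phi> y"
  using \<phi>_nat[OF pdisp_hom[OF assms]] G_simps(2)[OF assms] s_pdisp[of y x] unfolding tdiag_simps by simp

text \<open>Through \<open>\<phi>\<close> the boundary of \<open>F'\<close> becomes a limit of
  \<open>G\<close> below \<open>a\<close>, as is the boundary of \<open>F\<close>. This is the
  origin of \<open>\<kappa>\<close> and of its invertibility.\<close>

lemma latch_limit:
  assumes a: "a \<in> P"
  shows "limit_cone C le G (sdown P le a) (bnd n A C F' a) (\<lambda>b. \<phi> b \<cdot> bnd_proj n A C F' a b)"
proof (rule limit_cone_iso[OF F'.diagram_sdown G_sdown _ _ _ F'.bnd(4)[OF a]])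
  have S: "x \<in> P" "x \<in> Obj PC" if "x \<in> sdown P le a" for x
    using that P_Obj unfolding sdown_def by auto
  show "\<phi> x \<in> hom C (fob (tdiag n A F') x) (fob G x)" "iso_arr C (\<phi> x)" if "x \<in> sdown P le a" for x
    using \<phi>_hom \<phi>_iso S[OF that] G_simps(1) tdiag_simps(1)[of n A F'] by simp_all
  show "\<phi> x \<cdot> far (tdiag n A F') (y, x) = far G (y, x) \<cdot> \<phi> y"
    if "x \<in> sdown P le a" "y \<in> sdown P le a" "le x y" for x y
    using \<phi>_nat_diagram S that by blast
qed

lemma kappa_ex:
  assumes a: "a \<in> P"
  shows "\<exists>\<kappa>\<in>hom C (bnd n A C F' a) (g a). \<forall>b\<in>sdown P le a. \<rho> a b \<cdot> \<kappa> = \<phi> b \<cdot> bnd_proj n A C F' a b"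
  using limit_cone_subset_induced[OF latch_limit[OF a] G_latchingD(1)[OF a] subset_refl] by blast

lemma kappa_induced:
  assumes "a \<in> P" "\<kappa> \<in> hom C (bnd n A C F' a) (g a)"
    "\<And>b. b \<in> sdown P le a \<Longrightarrow> \<rho> a b \<cdot> \<kappa> = \<phi> b \<cdot> bnd_proj n A C F' a b"
  shows "induced C (sdown P le a) (bnd n A C F' a) (\<lambda>b. \<phi> b \<cdot> bnd_proj n A C F' a b) (g a) (\<rho> a) = \<kappa>"
  by (rule induced_eqI[OF G_sdown G_latchingD(1)[OF assms(1)] assms(2,3)])

lemma kappa_iso:
  assumes "a \<in> P" "\<kappa> \<in> hom C (bnd n A C F' a) (g a)"
    "\<And>b. b \<in> sdown P le a \<Longrightarrow> \<rho> a b \<cdot> \<kappa> = \<phi> b \<cdot> bnd_proj n A C F' a b"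
  shows "iso_arr C \<kappa>"
  by (rule limit_cone_comparison_iso[OF G_sdown latch_limit[OF assms(1)] G_latchingD(1)[OF assms(1)] assms(2,3)])

lemma shuffling_diagram_iff:
  "shuffling_diagram n A \<sigma> C F F' \<phi> \<longleftrightarrow>
     multimorphism n (A \<circ> \<sigma>) C F \<and> multimorphism n A C F' \<and> latching_squares F' \<phi>"
proof -
  have "distinguished C (\<phi> a, proj C (fob F' a), proj C (fob F (s a)),
      induced C (sdown P le a) (bnd n A C F' a) (\<lambda>b. \<phi> b \<cdot> bnd_proj n A C F' a b) (g a) (\<rho> a)) \<longleftrightarrow>
    (\<exists>\<kappa>\<in>hom C (bnd n A C F' a) (g a).
     (\<forall>b\<in>sdown P le a. \<rho> a b \<cdot> \<kappa> = \<phi> b \<cdot> bnd_proj n A C F' a b) \<and>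
     (\<phi> a, proj C (fob F' a), proj C (fob F (s a)), \<kappa>) \<in> Sq C)" (is "?l = ?r")
    if a: "a \<in> P" for a
    unfolding distinguished_iff[OF G_latchingD(2,3)[OF a]]
  proof
    obtain \<kappa> where \<kappa>: "\<kappa> \<in> hom C (bnd n A C F' a) (g a)"
      "\<forall>b\<in>sdown P le a. \<rho> a b \<cdot> \<kappa> = \<phi> b \<cdot> bnd_proj n A C F' a b" using kappa_ex[OF a] by blast
    assume "(\<phi> a, proj C (fob F' a), proj C (fob F (s a)),
      induced C (sdown P le a) (bnd n A C F' a) (\<lambda>b. \<phi> b \<cdot> bnd_proj n A C F' a b) (g a) (\<rho> a)) \<in> Sq C"
    then show ?r using \<kappa> kappa_induced[OF a \<kappa>(1)] by auto
  next
    assume ?r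
    then show "(\<phi> a, proj C (fob F' a), proj C (fob F (s a)),
      induced C (sdown P le a) (bnd n A C F' a) (\<lambda>b. \<phi> b \<cdot> bnd_proj n A C F' a b) (g a) (\<rho> a)) \<in> Sq C"
      using kappa_induced[OF a] by auto
  qed
  then show ?thesis
    using cmp nat_iso_comparison
    unfolding shuffling_diagram_def latching_squares_def Let_def perm_ftr_simps by simp
qed

text \<open>Inside \<open>P\<close> this is the defining property of \<open>\<kappa>\<close> at the
  vertex; outside, both sides end in the terminal object.\<close>

lemma cube_proj_\<phi>:
  assumes a: "a \<in> P" and \<kappa>: "\<kappa> \<in> hom C (bnd n A C F' a) (g a)"
      "\<forall>b\<in>sdown P le a. \<rho> a b \<cdot> \<kappa> = \<phi> b \<cdot> bnd_proj n A C F' a b"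
    and I: "I \<in> faces n"
  shows "cube_proj n (A \<circ> \<sigma>) C F (s a) (face_pre I) \<cdot> \<kappa> = \<phi> (cube n A a I) \<cdot> cube_proj n A C F' a I"
proof (cases "cube n A a I \<in> P")
  case True
  then show ?thesis
    using \<kappa>(2) cube_sdown[OF a I True] s_P[OF True] unfolding cube_proj_def s_cube[symmetric] by simp
next
  case False
  have "cube n (A \<circ> \<sigma>) (s a) (face_pre I) \<notin> S.P" using False s_P_iff[OF cube_Obj[OF a]] s_cube by metis
  note u = F.unit_arr_eq[OF S.cube_Obj[OF s_P[OF a]] this]
  have h: "\<phi> (cube n A a I) \<cdot> cube_proj n A C F' a I \<in>
      hom C (bnd n A C F' a) (fob F (cube n (A \<circ> \<sigma>) (s a) (face_pre I)))"
    using comp_hom[OF F'.cube_proj_hom[OF a I] \<phi>_hom[OF cube_Obj[OF a]]] unfolding s_cube .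
  show ?thesis by (rule u[OF comp_hom[OF \<kappa>(1) F.cube_proj_hom[OF s_P[OF a] face_pre[OF I]]] h])
qed

text \<open>The squares of \<open>F\<close>, \<open>F'\<close> and \<open>\<phi>\<close> form a
  cube. The square of \<open>\<phi> x\<close> pasted with that of \<open>F\<close> has bottom
  \<open>\<kappa>y \<cdot> \<beta>'\<close>; cancelling the square of \<open>\<phi> y\<close> leaves
  a distinguished square with bottom \<open>\<beta>'\<close>, whose top is \<open>F' f0\<close>
  because \<open>\<phi> y\<close> is monic.\<close>

lemma preserves_squares_transport:
  assumes sq: "latching_squares F' \<phi>" and F: "preserves_squares n (A \<circ> \<sigma>) C F"
  shows "preserves_squares n A C F'"
  unfolding preserves_squares_def
proof (intro allI impI)
  fix x y f0 f1 assume S: "Sq_family n A x y f0 f1"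
  note D = Sq_familyD[OF S]
  note x = D(1) and y = D(2)
  obtain \<kappa>x where \<kappa>x: "\<kappa>x \<in> hom C (bnd n A C F' x) (g x)"
      "\<forall>b\<in>sdown P le x. \<rho> x b \<cdot> \<kappa>x = \<phi> b \<cdot> bnd_proj n A C F' x b"
    and Sx: "(\<phi> x, proj C (fob F' x), proj C (fob F (s x)), \<kappa>x) \<in> Sq C"
    using sq x unfolding latching_squares_def by blast
  obtain \<kappa>y where \<kappa>y: "\<kappa>y \<in> hom C (bnd n A C F' y) (g y)"
      "\<forall>b\<in>sdown P le y. \<rho> y b \<cdot> \<kappa>y = \<phi> b \<cdot> bnd_proj n A C F' y b"
    and Sy: "(\<phi> y, proj C (fob F' y), proj C (fob F (s y)), \<kappa>y) \<in> Sq C"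
    using sq y unfolding latching_squares_def by blast
  obtain \<beta> where \<beta>: "\<beta> \<in> hom C (g x) (g y)"
    "\<forall>I\<in>faces n. cube_proj n (A \<circ> \<sigma>) C F (s y) I \<cdot> \<beta> =
        far F (mixed n (s f0) (s f1) I) \<cdot> cube_proj n (A \<circ> \<sigma>) C F (s x) I"
    and SF: "(far F (s f0), proj C (fob F (s x)), proj C (fob F (s y)), \<beta>) \<in> Sq C"
    using F s_Sq_family[OF S] unfolding preserves_squares_def by blast
  obtain \<beta>' where \<beta>': "\<beta>' \<in> hom C (bnd n A C F' x) (bnd n A C F' y)"
    "\<forall>I\<in>faces n. cube_proj n A C F' y I \<cdot> \<beta>' = far F' (mixed n f0 f1 I) \<cdot> cube_proj n A C F' x I"
    using F'.cube_induced_ex[OF S] by blast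
  \<comment> \<open>Commutativity of the bottom face is tested at the vertices, all of which have
    the form \<open>face_pre I\<close>.\<close>
  have e: "\<kappa>y \<cdot> \<beta>' = \<beta> \<cdot> \<kappa>x"
  proof (rule F.cube_mono[OF s_P[OF y] comp_hom[OF \<beta>'(1) \<kappa>y(1)] comp_hom[OF \<kappa>x(1) \<beta>(1)]])
    fix J assume J: "J \<in> faces n"
    then obtain I where I: "I \<in> faces n" "J = face_pre I" using face_pre_surj by blast
    note fh = mixed_hom[OF S, of I]
    note cx = F'.cube_proj_hom[OF x I(1)] and cy = F'.cube_proj_hom[OF y I(1)]
    note cx' = F.cube_proj_hom[OF s_P[OF x] face_pre[OF I(1)]]
      and cy' = F.cube_proj_hom[OF s_P[OF y] face_pre[OF I(1)]]
    note px = \<phi>_hom[OF cube_Obj[OF x]] and py = \<phi>_hom[OF cube_Obj[OF y]]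
    let ?f = "mixed n f0 f1 I"
    have "cube_proj n (A \<circ> \<sigma>) C F (s y) J \<cdot> \<kappa>y \<cdot> \<beta>' = (\<phi> (cube n A y I) \<cdot> cube_proj n A C F' y I) \<cdot> \<beta>'"
      using assoc[OF \<beta>'(1) \<kappa>y(1) cy'] cube_proj_\<phi>[OF y \<kappa>y I(1)] I(2) by simp
    also have "\<dots> = \<phi> (cube n A y I) \<cdot> far F' ?f \<cdot> cube_proj n A C F' x I"
      using assoc[OF \<beta>'(1) cy py] \<beta>'(2) I(1) by simp
    also have "\<dots> = far F (s ?f) \<cdot> \<phi> (cube n A x I) \<cdot> cube_proj n A C F' x I"
      using assoc[OF cx F'.F_hom[OF fh] py] \<phi>_nat[OF fh] assoc[OF cx px Fs_hom[OF fh]] by simp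
    also have "\<dots> = far F (s ?f) \<cdot> cube_proj n (A \<circ> \<sigma>) C F (s x) J \<cdot> \<kappa>x"
      using cube_proj_\<phi>[OF x \<kappa>x I(1)] I(2) by simp
    also have "\<dots> = (cube_proj n (A \<circ> \<sigma>) C F (s y) J \<cdot> \<beta>) \<cdot> \<kappa>x"
      using assoc[OF \<kappa>x(1) cx' Fs_hom[OF fh, unfolded s_cube]] \<beta>(2) J I(2) by (simp add: s_mixed)
    also have "\<dots> = cube_proj n (A \<circ> \<sigma>) C F (s y) J \<cdot> \<beta> \<cdot> \<kappa>x"
      using assoc[OF \<kappa>x(1) \<beta>(1) cy'] I(2) by simp
    finally show "cube_proj n (A \<circ> \<sigma>) C F (s y) J \<cdot> \<kappa>y \<cdot> \<beta>' = cube_proj n (A \<circ> \<sigma>) C F (s y) J \<cdot> \<beta> \<cdot> \<kappa>x" .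
  qed
  have "(far F (s f0) \<cdot> \<phi> x, proj C (fob F' x), proj C (fob F (s y)), \<kappa>y \<cdot> \<beta>') \<in> Sq C"
    using Sq_comp[OF Sx SF] e by simp
  moreover have "Trg C (proj C (fob F' y)) = bnd n A C F' y"
    using hom_Arr[OF proj_hom[OF F'.bnd(1,2)[OF y]]] F'.bnd(3)[OF y] by simp
  ultimately obtain u where u: "(u, proj C (fob F' x), proj C (fob F' y), \<beta>') \<in> Sq C"
    "far F (s f0) \<cdot> \<phi> x = \<phi> y \<cdot> u"
    using Sq_cancel[OF Sy, of "far F (s f0) \<cdot> \<phi> x" "proj C (fob F' x)" \<beta>' "bnd n A C F' x"] \<beta>'(1) by auto
  have "u \<in> hom C (Src C u) (fob F' y)" using Sq_proj(2)[OF u(1) F'.bnd(1,2)[OF y]] .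
  moreover have "Src C u = fob F' x"
    using SqD(1,2,3)[OF u(1)] proj_inj[OF _ F'.bnd(1)[OF x] _ F'.bnd(2)[OF x]] by metis
  ultimately have "u = far F' f0"
    using iso_mono[OF \<phi>_iso \<phi>_hom, OF P_Obj[OF y] P_Obj[OF y], of u "fob F' x" "far F' f0"]
      F'.F_hom[OF D(3)] u(2) \<phi>_nat[OF D(3)] by simp
  then show "\<exists>\<beta>\<in>hom C (bnd n A C F' x) (bnd n A C F' y).
      (\<forall>I\<in>faces n. cube_proj n A C F' y I \<cdot> \<beta> = far F' (mixed n f0 f1 I) \<cdot> cube_proj n A C F' x I) \<and>
      (far F' f0, proj C (fob F' x), proj C (fob F' y), \<beta>) \<in> Sq C"
    using \<beta>' u(1) by blast
qed

end

section \<open>Existence and uniqueness of shuffling diagrams\<close>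

context multimorphism_source
begin

lemma down_diagrams:
  assumes "w \<in> P"
  shows "linearized_diagrams C (down P le w) le lin"
  unfolding linearized_diagrams_def
  using contextual_category_axioms LP.down_linearized[OF assms] by blast

lemma G_down: "diagram_on C (down P le w) le G"
  by (rule diagram_on_subset[OF G_diagram]) (auto simp: down_def)

lemma down_sdown:
  assumes "w \<in> P" "y \<in> down P le w"
  shows "y \<in> P" "sdown (down P le w) le y = sdown P le y" "down (down P le w) le y = down P le y"
  using assms sdown_down[OF LP.poset assms] down_down[OF LP.poset assms] unfolding down_def by auto

lemma latching_down:
  assumes "w \<in> P"
  shows "latching C (down P le w) le G g \<rho>"
  using G_latching down_sdown[OF assms] unfolding latching_def by simp

text \<open>\<open>g\<close> and \<open>\<rho>\<close> do not depend on the principal sieve, so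
  towers over different ones coincide on common sieves.\<close>

lemma towers_agree:
  assumes y: "y \<in> P" and w: "w \<in> P"
    and T: "tower C (down P le y) le lin G g \<rho> a \<pi>" "tower C (down P le w) le lin G g \<rho> a' \<pi>'"
    and X: "sieve (down P le y) le X" "sieve (down P le w) le X"
  shows "a X = a' X" "x \<in> X \<Longrightarrow> \<pi> X x = \<pi>' X x"
proof -
  interpret Y: linearized_diagrams C "down P le y" le lin by (rule down_diagrams[OF y])
  have "a X = a' X \<and> (\<forall>x\<in>X. \<pi> X x = \<pi>' X x)"
    by (rule Y.tower_unique[OF LP.down_linearized[OF w] T _ X]) simp
  then show "a X = a' X" "x \<in> X \<Longrightarrow> \<pi> X x = \<pi>' X x" by auto
qed

lemma down_sieves:
  assumes "w \<in> P" "y \<in> down P le w"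
  shows "sieve (down P le w) le (down P le y)" "sieve (down P le w) le (sdown P le y)"
proof -
  interpret W: linearized_poset "down P le w" le lin by (rule LP.down_linearized[OF assms(1)])
  show "sieve (down P le w) le (down P le y)" "sieve (down P le w) le (sdown P le y)"
    using W.sieve_down[OF assms(2)] W.sieve_sdown[OF assms(2)] down_sdown[OF assms] by simp_all
qed

end

context shuffling_pair
begin

text \<open>The key to uniqueness: composing the projections chosen for \<open>F'\<close> with
  \<open>\<phi>\<close> gives a tower for data depending on \<open>F\<close> only. Over the
  principal sieve of \<open>w\<close> this tower returns \<open>F' w\<close> as apex and
  \<open>\<phi> w\<close> as top projection.\<close>

lemma choice_tower:
  assumes sq: "latching_squares F' \<phi>" and w: "w \<in> P"
  defines "c \<equiv> the_choice C (down P le w) le lin (tdiag n A F')"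
  shows "tower C (down P le w) le lin G g \<rho> (fst c) (\<lambda>X x. \<phi> x \<cdot> snd c X x)"
    "fst c (down P le w) = fob F' w" "\<phi> w \<cdot> snd c (down P le w) w = \<phi> w"
proof -
  interpret W: linearized_diagrams C "down P le w" le lin by (rule down_diagrams[OF w])
  note ch = F'.L.the_choice[OF w, folded c_def]
  note F'd = F'.L.diagram_down[of w]
  have DP: "x \<in> P" "le x w" if "x \<in> down P le w" for x using that unfolding down_def by auto
  show "tower C (down P le w) le lin G g \<rho> (fst c) (\<lambda>X x. \<phi> x \<cdot> snd c X x)"
  proof (rule W.tower_transport[OF G_down F'd latching_down[OF w] ch])
    fix x assume "x \<in> down P le w"
    then have x: "x \<in> P" using DP by blast
    show "\<phi> x \<in> hom C (fob (tdiag n A F') x) (fob G x)" "iso_arr C (\<phi> x)"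
      using \<phi>_hom[OF P_Obj[OF x]] \<phi>_iso[OF P_Obj[OF x]] G_simps(1)[OF x] tdiag_simps(1)[of n A F'] by simp_all
  next
    fix x y assume "x \<in> down P le w" "y \<in> down P le w" "le x y"
    then show "\<phi> x \<cdot> far (tdiag n A F') (y, x) = far G (y, x) \<cdot> \<phi> y" using \<phi>_nat_diagram DP by blast
  next
    fix y assume y: "y \<in> down P le w"
    note yP = DP(1)[OF y]
    note e = F'.L.latch_eq[OF w yP DP(2)[OF y] ch, folded bnd_def bnd_proj_def]
    obtain \<kappa> where \<kappa>: "\<kappa> \<in> hom C (bnd n A C F' y) (g y)"
      "\<forall>b\<in>sdown P le y. \<rho> y b \<cdot> \<kappa> = \<phi> b \<cdot> bnd_proj n A C F' y b"
      "(\<phi> y, proj C (fob F' y), proj C (fob F (s y)), \<kappa>) \<in> Sq C"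
      using sq yP unfolding latching_squares_def by blast
    have "induced C (sdown P le y) (bnd n A C F' y) (\<lambda>x. \<phi> x \<cdot> snd c (sdown P le y) x) (g y) (\<rho> y) =
      induced C (sdown P le y) (bnd n A C F' y) (\<lambda>b. \<phi> b \<cdot> bnd_proj n A C F' y b) (g y) (\<rho> y)"
      by (rule induced_cong) (use e(2) in auto)
    also have "\<dots> = \<kappa>" using kappa_induced[OF yP \<kappa>(1)] \<kappa>(2) by blast
    finally show "(\<phi> y, proj C (fob (tdiag n A F') y), proj C (fob G y),
        induced C (sdown (down P le w) le y) (fst c (sdown (down P le w) le y))
          (\<lambda>x. \<phi> x \<cdot> snd c (sdown (down P le w) le y) x) (g y) (\<rho> y)) \<in> Sq C"
      using \<kappa>(3) e(1) G_simps(1)[OF yP] tdiag_simps(1)[of n A F'] down_sdown(2)[OF w y] by simp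
  qed
  have ww: "w \<in> down P le w" using LP.self_down[OF w] .
  have dw: "down (down P le w) le w = down P le w" using down_sdown(3)[OF w ww] .
  show "fst c (down P le w) = fob F' w" using W.cellular_choiceD(3)[OF ch ww] dw tdiag_simps(1)[of n A F'] by simp
  have "snd c (down P le w) w = Idn C (fob F' w)"
    using W.cellular_choiceD(4)[OF ch ww, of w] dw ww diagram_onD(3)[OF F'.L.diagram w] tdiag_simps(1)[of n A F']
    by simp
  then show "\<phi> w \<cdot> snd c (down P le w) w = \<phi> w" using id_right[OF \<phi>_hom[OF P_Obj[OF w]]] by simp
qed

lemma \<phi>_unit:
  assumes "x \<in> Obj PC" "x \<notin> P"
  shows "fob F' x = unit_ob C" "\<phi> x \<in> hom C (unit_ob C) (unit_ob C)"
  using F'.F_unit[OF assms] \<phi>_hom[OF assms(1)] F.F_unit[OF s_Obj[OF assms(1)]] s_P_iff[OF assms(1)] assms(2)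
  by simp_all

lemma far_F'_eq:
  assumes "f \<in> hom PC x y"
  shows "far F' f = inv_arr (\<phi> y) \<cdot> far F (s f) \<cdot> \<phi> x"
proof -
  have o: "x \<in> Obj PC" "y \<in> Obj PC" using PC.hom_Obj[OF assms] by auto
  show ?thesis
    using inv_comp_cancel[OF \<phi>_iso[OF o(2)] \<phi>_hom[OF o(2)] F'.F_hom[OF assms]] \<phi>_nat[OF assms] by simp
qed

end

context multimorphism_source
begin

text \<open>On \<open>P\<close> the tower determines the values and the isomorphism; elsewhere both
  are forced by the terminal object. Naturality then fixes the action on arrows, and extensionality
  gives equality of functors.\<close>

lemma shuffling_unique:
  assumes 1: "shuffling_pair n A \<sigma> C F F1 \<phi>1" and 2: "shuffling_pair n A \<sigma> C F F2 \<phi>2"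
    and sq: "latching_squares F1 \<phi>1" "latching_squares F2 \<phi>2"
    and ext: "ext_ftr PC F1" "ext_ftr PC F2"
  shows "F1 = F2"
proof -
  interpret F1: shuffling_pair n A \<sigma> C F F1 \<phi>1 by (rule 1)
  interpret F2: shuffling_pair n A \<sigma> C F F2 \<phi>2 by (rule 2)
  have *: "fob F1 x = fob F2 x \<and> \<phi>1 x = \<phi>2 x" if x: "x \<in> Obj PC" for x
  proof (cases "x \<in> P")
    case True
    note ww = LP.self_down[OF True]
    note c1 = F1.choice_tower[OF sq(1) True] and c2 = F2.choice_tower[OF sq(2) True]
    from towers_agree[OF True True c1(1) c2(1) down_sieves(1)[OF True ww] down_sieves(1)[OF True ww]] ww
    show ?thesis using c1(2,3) c2(2,3) by auto
  next
    case False
    then show ?thesis using F1.\<phi>_unit[OF x] F2.\<phi>_unit[OF x] unit_hom_eq by simp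
  qed
  have "far F1 f = far F2 f" if "f \<in> Arr PC" for f
    using F1.far_F'_eq[OF PC.Arr_hom[OF that]] F2.far_F'_eq[OF PC.Arr_hom[OF that]]
      PC.hom_Obj[OF PC.Arr_hom[OF that]] * by simp
  then have "far F1 = far F2" "fob F1 = fob F2"
    using * ext unfolding ext_ftr_def by (blast intro: extensionalityI)+
  then show ?thesis by simp
qed

text \<open>A separate selection over each finite principal sieve; \<open>towers_agree\<close> makes
  the selections compatible, so no tower over the possibly infinite \<open>P\<close> is
  required.\<close>

definition chosen_tower where
  "chosen_tower w = (SOME c. tower C (down P le w) le lin G g \<rho> (fst c) (snd c))"

lemma chosen_tower:
  assumes "w \<in> P"
  shows "tower C (down P le w) le lin G g \<rho> (fst (chosen_tower w)) (snd (chosen_tower w))"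
proof -
  interpret W: linearized_diagrams C "down P le w" le lin by (rule down_diagrams[OF assms])
  have "\<exists>c. tower C (down P le w) le lin G g \<rho> (fst c) (snd c)"
    using W.tower_ex[OF G_down latching_down[OF assms]] by auto
  from someI_ex[OF this] show ?thesis unfolding chosen_tower_def .
qed

text \<open>Outside \<open>P\<close> both functors take the value \<open>unit_ob C\<close>, so the
  identity is the only possible component.\<close>

definition shuffled_iso :: "(nat \<Rightarrow> 'o) \<Rightarrow> 'd" where
  "shuffled_iso x = (if x \<in> P then snd (chosen_tower x) (down P le x) x else Idn C (unit_ob C))"

definition shuffled :: "(nat \<Rightarrow> 'o, nat \<Rightarrow> 'm, 'c, 'd) ftr" where
  "shuffled = \<lparr>fob = \<lambda>x\<in>Obj PC. if x \<in> P then fst (chosen_tower x) (down P le x) else unit_ob C,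
     far = \<lambda>f\<in>Arr PC. inv_arr (shuffled_iso (Trg PC f)) \<cdot> far F (s f) \<cdot> shuffled_iso (Src PC f)\<rparr>"

lemma shuffled_iso:
  assumes x: "x \<in> Obj PC"
  shows "shuffled_iso x \<in> hom C (fob shuffled x) (fob F (s x))" "iso_arr C (shuffled_iso x)"
proof -
  have "shuffled_iso x \<in> hom C (fob shuffled x) (fob F (s x)) \<and> iso_arr C (shuffled_iso x)"
  proof (cases "x \<in> P")
    case True
    interpret W: linearized_diagrams C "down P le x" le lin by (rule down_diagrams[OF True])
    note xx = LP.self_down[OF True]
    show ?thesis
      using W.tower_iso[OF G_down chosen_tower[OF True] xx] down_sdown(3)[OF True xx] G_simps(1)[OF True] True x
      unfolding shuffled_iso_def shuffled_def by simp
  next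
    case False
    then have "fob F (s x) = unit_ob C" using F.F_unit[OF s_Obj[OF x]] s_P_iff[OF x] by blast
    then show ?thesis
      using False x id_hom[OF unit_ob(1)] iso_id[OF unit_ob(1)] unfolding shuffled_iso_def shuffled_def by simp
  qed
  then show "shuffled_iso x \<in> hom C (fob shuffled x) (fob F (s x))" "iso_arr C (shuffled_iso x)" by auto
qed

lemma far_shuffled:
  assumes "f \<in> hom PC x y"
  shows "far shuffled f = inv_arr (shuffled_iso y) \<cdot> far F (s f) \<cdot> shuffled_iso x"
    "far shuffled f \<in> hom C (fob shuffled x) (fob shuffled y)"
    "shuffled_iso y \<cdot> far shuffled f = far F (s f) \<cdot> shuffled_iso x"
proof -
  have o: "x \<in> Obj PC" "y \<in> Obj PC" using PC.hom_Obj[OF assms] by auto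
  show e: "far shuffled f = inv_arr (shuffled_iso y) \<cdot> far F (s f) \<cdot> shuffled_iso x"
    using PC.hom_Arr[OF assms] unfolding shuffled_def by simp
  note i = shuffled_iso[OF o(1)] and j = shuffled_iso[OF o(2)]
  note h = comp_hom[OF i(1) Fs_hom[OF assms]]
  show "far shuffled f \<in> hom C (fob shuffled x) (fob shuffled y)"
    unfolding e by (rule comp_hom[OF h inv_arr(1)[OF j(2,1)]])
  show "shuffled_iso y \<cdot> far shuffled f = far F (s f) \<cdot> shuffled_iso x"
    unfolding e by (rule comp_inv_cancel[OF j(2,1) h])
qed

lemma shuffled_functor: "is_functor PC C shuffled"
  unfolding is_functor_def
proof (intro conjI ballI impI)
  fix x assume x: "x \<in> Obj PC"
  note i = shuffled_iso[OF x]
  show "fob shuffled x \<in> Obj C" using hom_Obj[OF i(1)] by blast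
  have "far F (s (Idn PC x)) = Idn C (fob F (s x))" using F.F_id[OF s_Obj[OF x]] s_Idn by simp
  then show "far shuffled (Idn PC x) = Idn C (fob shuffled x)"
    using far_shuffled(1)[OF PC.id_hom[OF x]] id_left[OF i(1)] inv_arr(2)[OF i(2,1)] by simp
next
  fix f assume "f \<in> Arr PC"
  note fh = PC.Arr_hom[OF this]
  show "far shuffled f \<in> hom C (fob shuffled (Src PC f)) (fob shuffled (Trg PC f))"
    using far_shuffled(2)[OF fh] .
  fix k assume k: "k \<in> Arr PC" and c: "Src PC k = Trg PC f"
  have kh: "k \<in> hom PC (Trg PC f) (Trg PC k)" using PC.Arr_hom[OF k] c by simp
  note ch = PC.comp_hom[OF fh kh]
  have o: "Src PC f \<in> Obj PC" "Trg PC f \<in> Obj PC" "Trg PC k \<in> Obj PC"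
    using PC.hom_Obj[OF fh] PC.hom_Obj[OF kh] by auto
  note i = shuffled_iso(1)[OF o(1)] and j = shuffled_iso(1)[OF o(2)] and l = shuffled_iso(1)[OF o(3)]
  have "shuffled_iso (Trg PC k) \<cdot> far shuffled k \<cdot> far shuffled f =
      (far F (s k) \<cdot> shuffled_iso (Trg PC f)) \<cdot> far shuffled f"
    using assoc[OF far_shuffled(2)[OF fh] far_shuffled(2)[OF kh] l] far_shuffled(3)[OF kh] by simp
  also have "\<dots> = far F (s k) \<cdot> far F (s f) \<cdot> shuffled_iso (Src PC f)"
    using assoc[OF far_shuffled(2)[OF fh] j Fs_hom[OF kh]] far_shuffled(3)[OF fh] by simp
  also have "\<dots> = far F (s (Cmp PC k f)) \<cdot> shuffled_iso (Src PC f)"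
    using assoc[OF i Fs_hom[OF fh] Fs_hom[OF kh]] F.F_comp[OF s_hom[OF fh] s_hom[OF kh]] s_Cmp by simp
  also have "\<dots> = shuffled_iso (Trg PC k) \<cdot> far shuffled (Cmp PC k f)" using far_shuffled(3)[OF ch] by simp
  finally show "far shuffled (Cmp PC k f) = far shuffled k \<cdot> far shuffled f"
    using iso_mono[OF shuffled_iso(2)[OF o(3)] l far_shuffled(2)[OF ch]
      comp_hom[OF far_shuffled(2)[OF fh] far_shuffled(2)[OF kh]]] by simp
qed

text \<open>The explicit form of the projections is kept because it is needed to compute the
  boundary projections of \<open>shuffled\<close>.\<close>

lemma shuffled_choice:
  assumes w: "w \<in> P"
  shows "\<exists>\<pi>. cellular_choice C (down P le w) le lin (tdiag n A shuffled) (fst (chosen_tower w)) \<pi> \<and>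
     (\<forall>X. \<forall>x\<in>down P le w. \<pi> X x = inv_arr (shuffled_iso x) \<cdot> snd (chosen_tower w) X x)"
proof -
  interpret W: linearized_diagrams C "down P le w" le lin by (rule down_diagrams[OF w])
  have DP: "x \<in> P" "le x w" if "x \<in> down P le w" for x using that unfolding down_def by auto
  have dS: "diagram_on C (down P le w) le (tdiag n A shuffled)"
    by (rule diagram_on_subset[OF diagram_tdiag[OF shuffled_functor]]) (auto simp: down_def)
  \<comment> \<open>The tower over \<open>w\<close> agrees with the one selected for
    \<open>x\<close> on the principal sieve of \<open>x\<close>.\<close>
  have a: "fst (chosen_tower w) (down P le x) = fob shuffled x"
      "snd (chosen_tower w) (down P le x) x = shuffled_iso x" if "x \<in> down P le w" for x
  proof -
    note x = DP(1)[OF that]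
    note xx = LP.self_down[OF x]
    note e = towers_agree[OF w x chosen_tower[OF w] chosen_tower[OF x] down_sieves(1)[OF w that] down_sieves(1)[OF x xx]]
    show "fst (chosen_tower w) (down P le x) = fob shuffled x"
      "snd (chosen_tower w) (down P le x) x = shuffled_iso x"
      using e(1) e(2)[OF xx] x P_Obj[OF x] unfolding shuffled_iso_def shuffled_def by simp_all
  qed
  let ?\<pi> = "\<lambda>X x. inv_arr (snd (chosen_tower w) (down (down P le w) le x) x) \<cdot> snd (chosen_tower w) X x"
  have ch: "cellular_choice C (down P le w) le lin (tdiag n A shuffled) (fst (chosen_tower w)) ?\<pi>"
  proof (rule W.tower_cellular_choice[OF G_down dS latching_down[OF w] chosen_tower[OF w]])
    show "fob (tdiag n A shuffled) x = fst (chosen_tower w) (down (down P le w) le x)" if "x \<in> down P le w" for x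
      using a(1)[OF that] down_sdown(3)[OF w that] tdiag_simps(1)[of n A shuffled] by simp
    fix x y assume x: "x \<in> down P le w" and y: "y \<in> down P le w" and xy: "le x y"
    show "snd (chosen_tower w) (down (down P le w) le x) x \<cdot> far (tdiag n A shuffled) (y, x) =
        far G (y, x) \<cdot> snd (chosen_tower w) (down (down P le w) le y) y"
      using a(2)[OF x] a(2)[OF y] down_sdown(3)[OF w x] down_sdown(3)[OF w y]
        far_shuffled(3)[OF pdisp_hom[OF DP(1)[OF x] DP(1)[OF y] xy]] G_simps(2)[OF DP(1)[OF x] DP(1)[OF y] xy]
        s_pdisp[of y x] unfolding tdiag_simps by simp
  qed
  have eq: "?\<pi> X x = inv_arr (shuffled_iso x) \<cdot> snd (chosen_tower w) X x" if "x \<in> down P le w" for X x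
    using a(2)[OF that] down_sdown(3)[OF w that] by simp
  show ?thesis using ch eq by blast
qed

lemma cellular_functor_shuffled: "cellular_functor n A C shuffled"
proof unfold_locales
  show "is_functor PC C shuffled" by (rule shuffled_functor)
  show "fob shuffled x = unit_ob C" if "x \<in> Obj PC" "x \<notin> P" for x
    using that unfolding shuffled_def by simp
  have d: "diagram_on C X le (tdiag n A shuffled)" if "X \<subseteq> P" for X
    by (rule diagram_on_subset[OF diagram_tdiag[OF shuffled_functor] that])
  have "diagram_on C (down P le w) le (tdiag n A shuffled)" for w
    by (rule d) (auto simp: down_def)
  then show "locally_cellular C P le lin (tdiag n A shuffled)"
    using d[OF subset_refl] shuffled_choice unfolding locally_cellular_def cellular_def diagram_on_def by blast
qed

lemma shuffling_pair_shuffled: "shuffling_pair n A \<sigma> C F shuffled shuffled_iso"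
proof -
  interpret F': cellular_functor n A C shuffled by (rule cellular_functor_shuffled)
  show ?thesis
  proof unfold_locales
    show "comparison shuffled shuffled_iso"
      using shuffled_iso far_shuffled(3) unfolding comparison_def by blast
  qed
qed

text \<open>Each square is the tower square over a principal sieve. Its bottom is the required arrow
  because the choice from \<open>shuffled_choice\<close> computes the boundary of
  \<open>shuffled\<close>, with projections corrected by inverses that cancel against
  \<open>shuffled_iso\<close>.\<close>

lemma latching_squares_shuffled: "latching_squares shuffled shuffled_iso"
  unfolding latching_squares_def
proof
  fix y assume y: "y \<in> P"
  interpret F': cellular_functor n A C shuffled by (rule cellular_functor_shuffled)
  interpret Y: linearized_diagrams C "down P le y" le lin by (rule down_diagrams[OF y])
  note yy = LP.self_down[OF y]
  have le_yy: "le y y" using yy unfolding down_def by simp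
  let ?S = "sdown P le y"
  let ?a = "fst (chosen_tower y)" and ?\<pi> = "snd (chosen_tower y)"
  have Sy: "x \<in> down P le y" "x \<in> P" if "x \<in> ?S" for x using that unfolding sdown_def down_def by auto
  obtain \<pi> where \<pi>: "cellular_choice C (down P le y) le lin (tdiag n A shuffled) ?a \<pi>"
    "\<forall>X. \<forall>x\<in>down P le y. \<pi> X x = inv_arr (shuffled_iso x) \<cdot> ?\<pi> X x"
    using shuffled_choice[OF y] by blast
  note e = F'.L.latch_eq[OF y y le_yy \<pi>(1), folded bnd_def bnd_proj_def]
  note T = chosen_tower[OF y]
  note lS = Y.towerD(1)[OF T down_sieves(2)[OF y yy]]
  note L = G_latchingD[OF y]
  let ?k = "induced C ?S (?a ?S) (?\<pi> ?S) (g y) (\<rho> y)"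
  note k = limit_cone_subset_induced[OF lS L(1) subset_refl]
  have "(?\<pi> (down P le y) y, proj C (?a (down P le y)), proj C (fob G y), ?k) \<in> Sq C"
    using Y.tower_Sq_down[OF G_down T yy] down_sdown(2,3)[OF y yy] by simp
  then have "(shuffled_iso y, proj C (fob shuffled y), proj C (fob F (s y)), ?k) \<in> Sq C"
    using y P_Obj[OF y] G_simps(1)[OF y] unfolding shuffled_iso_def shuffled_def by simp
  moreover have "?k \<in> hom C (bnd n A C shuffled y) (g y)" using k(1) e(1) by simp
  moreover have "\<rho> y b \<cdot> ?k = shuffled_iso b \<cdot> bnd_proj n A C shuffled y b" if b: "b \<in> ?S" for b
  proof -
    note i = shuffled_iso[OF P_Obj[OF Sy(2)[OF b]]]
    have "?\<pi> ?S b \<in> hom C (?a ?S) (fob F (s b))"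
      using limit_coneD(2)[OF lS b] G_simps(1)[OF Sy(2)[OF b]] by simp
    from comp_inv_cancel[OF i(2,1) this]
    have "shuffled_iso b \<cdot> \<pi> ?S b = ?\<pi> ?S b" using \<pi>(2) Sy(1)[OF b] by simp
    then show ?thesis using k(2)[OF b] e(2)[OF b] by simp
  qed
  ultimately show "\<exists>\<kappa>\<in>hom C (bnd n A C shuffled y) (g y).
      (\<forall>b\<in>?S. \<rho> y b \<cdot> \<kappa> = shuffled_iso b \<cdot> bnd_proj n A C shuffled y b) \<and>
      (shuffled_iso y, proj C (fob shuffled y), proj C (fob F (s y)), \<kappa>) \<in> Sq C" by blast
qed

lemma shuffling_diagram_shuffled:
  assumes F: "multimorphism n (A \<circ> \<sigma>) C F"
  shows "shuffling_diagram n A \<sigma> C F shuffled shuffled_iso"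
proof -
  interpret F': shuffling_pair n A \<sigma> C F shuffled shuffled_iso by (rule shuffling_pair_shuffled)
  have "ext_ftr PC shuffled" unfolding ext_ftr_def shuffled_def by simp
  then have "multimorphism n A C shuffled"
    using F'.preserves_squares_transport[OF latching_squares_shuffled] F F.multimorphism_iff
      F'.F'.multimorphism_iff by blast
  then show ?thesis using F'.shuffling_diagram_iff F latching_squares_shuffled by blast
qed

end

lemma multimorphism_sourceI:
  assumes "permuted_family n A \<sigma>" "contextual_category C" "multimorphism n (A \<circ> \<sigma>) C F"
  shows "multimorphism_source n A \<sigma> C F"
proof -
  interpret permuted_family n A \<sigma> by fact
  show ?thesis
    using assms multimorphism_cellular_functor[OF S.precontextual_family_axioms assms(2,3)]
    unfolding multimorphism_source_def by blast
qed

lemma shuffling_pairI: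
  assumes "permuted_family n A \<sigma>" "contextual_category C" "shuffling_diagram n A \<sigma> C F F' \<phi>"
  shows "shuffling_pair n A \<sigma> C F F' \<phi>"
proof -
  have m: "multimorphism n (A \<circ> \<sigma>) C F" "multimorphism n A C F'"
    using assms(3) unfolding shuffling_diagram_def by auto
  interpret multimorphism_source n A \<sigma> C F by (rule multimorphism_sourceI[OF assms(1,2) m(1)])
  interpret F': cellular_functor n A C F'
    by (rule multimorphism_cellular_functor[OF precontextual_family_axioms assms(2) m(2)])
  have "comparison F' \<phi>" using assms(3) nat_iso_comparison unfolding shuffling_diagram_def by blast
  then show ?thesis by unfold_locales
qed

theorem ex1_shuffling_diagram:
  assumes "permuted_family n A \<sigma>" "contextual_category C" "multimorphism n (A \<circ> \<sigma>) C F"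
  shows "\<exists>!F'. \<exists>\<phi>. shuffling_diagram n A \<sigma> C F F' \<phi>"
proof -
  interpret multimorphism_source n A \<sigma> C F by (rule multimorphism_sourceI[OF assms])
  show ?thesis
  proof (rule ex1I)
    show "\<exists>\<phi>. shuffling_diagram n A \<sigma> C F shuffled \<phi>" using shuffling_diagram_shuffled[OF assms(3)] by blast
    fix F' assume "\<exists>\<phi>. shuffling_diagram n A \<sigma> C F F' \<phi>"
    then obtain \<phi> where d: "shuffling_diagram n A \<sigma> C F F' \<phi>" by blast
    note p = shuffling_pairI[OF assms(1,2) d]
    note p' = shuffling_pair_shuffled
    have "latching_squares F' \<phi>" using d shuffling_pair.shuffling_diagram_iff[OF p] by blast
    moreover have "ext_ftr PC F'" "ext_ftr PC shuffled"
      using d shuffling_diagram_shuffled[OF assms(3)]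
      unfolding shuffling_diagram_def multimorphism_def by blast+
    ultimately show "F' = shuffled"
      using shuffling_unique[OF p p' _ latching_squares_shuffled] by blast
  qed
qed

context shuffling_pair
begin

text \<open>\<open>\<kappa>\<close> is an isomorphism by \<open>kappa_iso\<close>, so
  \<open>Sq_iso\<close> inverts each square; the inverses of \<open>\<phi>\<close> and
  \<open>\<kappa>\<close> then form the diagram in the other direction.\<close>

lemma shuffling_diagram_inverse:
  assumes d: "shuffling_diagram n A \<sigma> C F F' \<phi>"
  defines "\<psi> \<equiv> \<lambda>z. inv_arr (\<phi> (reorder n (inv \<sigma>) z))"
  shows "shuffling_diagram n (A \<circ> \<sigma>) (inv \<sigma>) C F' F \<psi>"
proof -
  \<comment> \<open>Lets \<open>F'\<close>, a multimorphism on \<open>A\<close>, act as the source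
    of a shuffling diagram for the family \<open>A \<circ> \<sigma>\<close>.\<close>
  have A: "A \<circ> \<sigma> \<circ> inv \<sigma> = A"
    using permutes_inverses(1)[OF perm] by (simp add: fun_eq_iff)
  let ?t = "reorder n (inv \<sigma>)"
  have ts: "?t (s x) = x" and st: "s (?t x) = x" if "x \<in> extensional {1..n}" for x :: "nat \<Rightarrow> 'z"
    using reorder_reorder[OF perm that] by auto
  have d': "multimorphism n (A \<circ> \<sigma>) C F" "multimorphism n A C F'" "latching_squares F' \<phi>"
    using d shuffling_diagram_iff by auto
  have fam': "permuted_family n (A \<circ> \<sigma>) (inv \<sigma>)"
    by unfold_locales (rule permutes_inv[OF perm])
  have m': "multimorphism n (A \<circ> \<sigma> \<circ> inv \<sigma>) C F'" unfolding A by (rule d'(2))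
  interpret R: multimorphism_source n "A \<circ> \<sigma>" "inv \<sigma>" C F' by (rule multimorphism_sourceI[OF fam' contextual_category_axioms m'])
  have tO: "?t z \<in> Obj PC" if "z \<in> Obj S.PC" for z using R.s_Obj[OF that] unfolding A .
  have h: "\<psi> z \<in> hom C (fob F z) (fob F' (?t z))" "iso_arr C (\<psi> z)" if z: "z \<in> Obj S.PC" for z
  proof -
    have "z \<in> extensional {1..n}" using z S.PC_Obj by blast
    then show "\<psi> z \<in> hom C (fob F z) (fob F' (?t z))" "iso_arr C (\<psi> z)"
      using inv_arr(1)[OF \<phi>_iso[OF tO[OF z]] \<phi>_hom[OF tO[OF z]]]
        iso_inv_arr[OF \<phi>_iso[OF tO[OF z]] \<phi>_hom[OF tO[OF z]]] unfolding \<psi>_def by (simp_all add: st)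
  qed
  have "R.comparison F \<psi>"
    unfolding R.comparison_def
  proof (intro conjI ballI allI)
    fix x y f assume f: "f \<in> hom S.PC x y"
    have o: "x \<in> Obj S.PC" "y \<in> Obj S.PC" using S.PC.hom_Obj[OF f] by auto
    have tf: "?t f \<in> hom PC (?t x) (?t y)" using R.s_hom[OF f] unfolding A .
    have stf: "s (?t f) = f" using st[of f] S.PC_hom f o S.PC_Obj by blast
    note i = \<phi>_iso[OF tO[OF o(1)]] \<phi>_hom[OF tO[OF o(1)]]
      and j = \<phi>_iso[OF tO[OF o(2)]] \<phi>_hom[OF tO[OF o(2)]]
    have sx: "s (?t x) = x" "s (?t y) = y" using st[of x] st[of y] o S.PC_Obj by blast+
    note Ff = Fs_hom[OF tf, unfolded stf] and F'f = F'.F_hom[OF tf]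
    have "\<phi> (?t y) \<cdot> far F' (?t f) \<cdot> inv_arr (\<phi> (?t x)) = (far F f \<cdot> \<phi> (?t x)) \<cdot> inv_arr (\<phi> (?t x))"
      using assoc[OF inv_arr(1)[OF i] F'f j(2)] \<phi>_nat[OF tf] stf by simp
    also have "\<dots> = far F f"
      using assoc[OF inv_arr(1)[OF i] i(2) Ff] inv_arr(3)[OF i] id_right[OF Ff] by simp
    finally show "\<psi> y \<cdot> far F f = far F' (?t f) \<cdot> \<psi> x"
      using inv_comp_cancel[OF j comp_hom[OF inv_arr(1)[OF i] F'f]] unfolding \<psi>_def by simp
  qed (use h in auto)
  then have pair: "shuffling_pair n (A \<circ> \<sigma>) (inv \<sigma>) C F' F \<psi>"
    by (intro shuffling_pair.intro shuffling_pair_axioms.intro R.multimorphism_source_axioms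
        F.cellular_functor_axioms)
  have "R.latching_squares F \<psi>"
    unfolding R.latching_squares_def A
  proof
    fix z assume z: "z \<in> S.P"
    obtain a where a: "a \<in> P" "z = s a" using s_surj[OF z] .
    have ext: "x \<in> extensional {1..n}" if "x \<in> P" for x using that P_iff by blast
    have ta: "?t z = a" using ts[OF ext[OF a(1)]] a(2) by simp
    obtain \<kappa> where \<kappa>: "\<kappa> \<in> hom C (bnd n A C F' a) (g a)"
      "\<And>b. b \<in> sdown P le a \<Longrightarrow> \<rho> a b \<cdot> \<kappa> = \<phi> b \<cdot> bnd_proj n A C F' a b"
      and Sq: "(\<phi> a, proj C (fob F' a), proj C (fob F (s a)), \<kappa>) \<in> Sq C"
      using d'(3) a(1) unfolding latching_squares_def by blast
    note iso = kappa_iso[OF a(1) \<kappa>]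
    note ki = inv_arr[OF iso \<kappa>(1)]
    have "(\<psi> z, proj C (fob F z), proj C (fob F' (?t z)), inv_arr \<kappa>) \<in> Sq C"
      using Sq_iso(2)[OF Sq iso] a(2) ta unfolding \<psi>_def by simp
    moreover have "inv_arr \<kappa> \<in> hom C (bnd n (A \<circ> \<sigma>) C F z) (bnd n A C F' (?t z))"
      using ki(1) a(2) ta by simp
    moreover have "bnd_proj n A C F' (?t z) (?t b) \<cdot> inv_arr \<kappa> = \<psi> b \<cdot> bnd_proj n (A \<circ> \<sigma>) C F z b"
      if bz: "b \<in> sdown S.P S.le z" for b
    proof -
      \<comment> \<open>\<open>s\<close> is an order isomorphism, so elements strictly below
        \<open>s a\<close> come from elements strictly below \<open>a\<close>.\<close>
      obtain b' where b': "b' \<in> sdown P le a" "b = s b'"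
        using bz unfolding a(2) poset_iso_sdown[OF a(1), symmetric] by blast
      then have bP: "b' \<in> P" unfolding sdown_def by blast
      have tb: "?t b = b'" using ts[OF ext[OF bP]] b'(2) by simp
      note i = \<phi>_iso[OF P_Obj[OF bP]] \<phi>_hom[OF P_Obj[OF bP]]
      note p' = F'.bnd(5)[OF a(1) b'(1)]
      have p: "\<rho> a b' \<in> hom C (g a) (fob F (s b'))"
        using limit_coneD(2)[OF G_latchingD(1)[OF a(1)] b'(1)] G_simps(1)[OF bP] by simp
      have "\<phi> b' \<cdot> bnd_proj n A C F' a b' \<cdot> inv_arr \<kappa> = (\<rho> a b' \<cdot> \<kappa>) \<cdot> inv_arr \<kappa>"
        using assoc[OF ki(1) p' i(2)] \<kappa>(2)[OF b'(1)] by simp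
      also have "\<dots> = \<rho> a b'"
        using assoc[OF ki(1) \<kappa>(1) p] ki(3) id_right[OF p] by simp
      finally have "bnd_proj n A C F' a b' \<cdot> inv_arr \<kappa> = inv_arr (\<phi> b') \<cdot> \<rho> a b'"
        using inv_comp_cancel[OF i comp_hom[OF ki(1) p']] by simp
      then show ?thesis using ta tb a(2) b'(2) unfolding \<psi>_def by simp
    qed
    ultimately show "\<exists>\<kappa>\<in>hom C (bnd n (A \<circ> \<sigma>) C F z) (bnd n A C F' (?t z)).
        (\<forall>b\<in>sdown S.P S.le z. bnd_proj n A C F' (?t z) (?t b) \<cdot> \<kappa> = \<psi> b \<cdot> bnd_proj n (A \<circ> \<sigma>) C F z b) \<and>
        (\<psi> z, proj C (fob F z), proj C (fob F' (?t z)), \<kappa>) \<in> Sq C" by blast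
  qed
  then show ?thesis
    using shuffling_pair.shuffling_diagram_iff[OF pair] m' d'(1) by blast
qed

end

section \<open>Naturality in the target\<close>

lemma contextual_categoryI: "contextual C \<Longrightarrow> contextual_category C"
  by unfold_locales

locale postcomposition = precontextual_family n A + contextual_functor_on C D H + F: cellular_functor n A C F
  for n and A :: "nat \<Rightarrow> ('o, 'm) precat" and C :: "('c, 'd) precat" and D :: "('e, 'f) precat" and H F
begin

abbreviation "HF \<equiv> comp_ftr PC H F"

lemma HF_ob: "x \<in> Obj PC \<Longrightarrow> fob HF x = fob H (fob F x)"
  and HF_ar: "f \<in> hom PC x y \<Longrightarrow> far HF f = far H (far F f)"
  unfolding comp_ftr_def hom_def by simp_all

lemma HF_functor: "is_functor PC D HF"
  unfolding is_functor_def
proof (intro conjI ballI impI)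
  fix x assume x: "x \<in> Obj PC"
  show "fob HF x \<in> Obj D" using HF_ob[OF x] H_Obj[OF F.F_Obj[OF x]] by simp
  show "far HF (Idn PC x) = Idn D (fob HF x)"
    using HF_ob[OF x] HF_ar[OF PC.id_hom[OF x]] F.F_id[OF x] H_id[OF F.F_Obj[OF x]] by simp
next
  fix f assume "f \<in> Arr PC"
  note fh = PC.Arr_hom[OF this]
  show "far HF f \<in> hom D (fob HF (Src PC f)) (fob HF (Trg PC f))"
    using HF_ob PC.hom_Obj[OF fh] HF_ar[OF fh] H_hom[OF F.F_hom[OF fh]] by simp
  fix k assume k: "k \<in> Arr PC" and c: "Src PC k = Trg PC f"
  have kh: "k \<in> hom PC (Trg PC f) (Trg PC k)" using PC.Arr_hom[OF k] c by simp
  show "far HF (Cmp PC k f) = Cmp D (far HF k) (far HF f)"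
    using HF_ar[OF fh] HF_ar[OF kh] HF_ar[OF PC.comp_hom[OF fh kh]] F.F_comp[OF fh kh]
      H_comp[OF F.F_hom[OF fh] F.F_hom[OF kh]] by simp
qed

lemma HF_choice:
  assumes w: "w \<in> P"
  defines "c \<equiv> the_choice C (down P le w) le lin (tdiag n A F)"
  shows "cellular_choice D (down P le w) le lin (tdiag n A HF) (\<lambda>X. fob H (fst c X)) (\<lambda>X x. far H (snd c X x))"
proof -
  interpret W: linearized_poset "down P le w" le lin by (rule F.L.down_linearized[OF w])
  interpret W: cellular_image C D H "down P le w" le lin ..
  have dH: "diagram_on D (down P le w) le (tdiag n A HF)"
    by (rule D.diagram_on_subset[OF diagram_tdiag[OF HF_functor]]) (auto simp: down_def)
  show ?thesis
  proof (rule W.cellular_choice_image[OF F.L.diagram_down dH])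
    show "cellular_choice C (down P le w) le lin (tdiag n A F) (fst c) (snd c)"
      unfolding c_def by (rule F.L.the_choice[OF w])
    fix x assume "x \<in> down P le w"
    then have x: "x \<in> P" unfolding down_def by blast
    show "fob (tdiag n A HF) x = fob H (fob (tdiag n A F) x)"
      unfolding tdiag_simps by (rule HF_ob[OF P_Obj[OF x]])
    fix y assume "y \<in> down P le w" and le: "le x y"
    then have y: "y \<in> P" unfolding down_def by blast
    show "far (tdiag n A HF) (y, x) = far H (far (tdiag n A F) (y, x))"
      unfolding tdiag_simps by (rule HF_ar[OF pdisp_hom[OF x y le]])
  qed
qed

sublocale HF: cellular_functor n A D HF
proof
  show "is_functor PC D HF" by (rule HF_functor)
  show "fob HF x = unit_ob D" if "x \<in> Obj PC" "x \<notin> P" for x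
    using HF_ob[OF that(1)] F.F_unit[OF that] H_unit by simp
  have d: "diagram_on D X le (tdiag n A HF)" if "X \<subseteq> P" for X
    by (rule D.diagram_on_subset[OF diagram_tdiag[OF HF_functor] that])
  have "diagram_on D (down P le w) le (tdiag n A HF)" for w
    by (rule d) (auto simp: down_def)
  then show "locally_cellular D P le lin (tdiag n A HF)"
    using d[OF subset_refl] HF_choice unfolding locally_cellular_def cellular_def diagram_on_def by blast
qed

text \<open>The image of the choice for \<open>F\<close> is a choice for \<open>HF\<close>, so
  uniqueness of choices yields equality of boundary objects.\<close>

lemma HF_bnd:
  assumes x: "x \<in> P"
  shows "bnd n A D HF x = fob H (bnd n A C F x)"
    "z \<in> sdown P le x \<Longrightarrow> bnd_proj n A D HF x z = far H (bnd_proj n A C F x z)"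
proof -
  have "le x x" using F.L.self_down[OF x] unfolding down_def by simp
  from HF.L.latch_eq[OF x x this HF_choice[OF x], folded bnd_def bnd_proj_def]
  show "bnd n A D HF x = fob H (bnd n A C F x)"
    "z \<in> sdown P le x \<Longrightarrow> bnd_proj n A D HF x z = far H (bnd_proj n A C F x z)"
    unfolding bnd_def bnd_proj_def latch_def latch_proj_def by simp_all
qed

lemma HF_cube_proj:
  assumes x: "x \<in> P" and I: "I \<in> faces n"
  shows "cube_proj n A D HF x I = far H (cube_proj n A C F x I)"
proof (cases "cube n A x I \<in> P")
  case True
  then show ?thesis using HF_bnd(2)[OF x cube_sdown[OF x I True]] unfolding cube_proj_def by simp
next
  case False
  have "far H (cube_proj n A C F x I) \<in> hom D (bnd n A D HF x) (fob HF (cube n A x I))"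
    using H_hom[OF F.cube_proj_hom[OF x I]] HF_bnd(1)[OF x] HF_ob[OF cube_Obj[OF x]] by simp
  then show ?thesis by (rule HF.unit_arr_eq[OF cube_Obj[OF x] False HF.cube_proj_hom[OF x I]])
qed

text \<open>The bottom witness for \<open>HF\<close> is the image of the one for \<open>F\<close>;
  its equations are images of equations.\<close>

lemma multimorphism_HF:
  assumes "multimorphism n A C F"
  shows "multimorphism n A D HF"
proof -
  have "preserves_squares n A D HF"
    unfolding preserves_squares_def
  proof (intro allI impI)
    fix x y f0 f1 assume S: "Sq_family n A x y f0 f1"
    note Sd = Sq_familyD[OF S]
    obtain \<beta> where \<beta>: "\<beta> \<in> hom C (bnd n A C F x) (bnd n A C F y)"
      "\<forall>I\<in>faces n. Cmp C (cube_proj n A C F y I) \<beta> = Cmp C (far F (mixed n f0 f1 I)) (cube_proj n A C F x I)"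
      "(far F f0, proj C (fob F x), proj C (fob F y), \<beta>) \<in> Sq C"
      using assms S F.multimorphism_iff unfolding preserves_squares_def by blast
    have "Cmp D (cube_proj n A D HF y I) (far H \<beta>) =
        Cmp D (far HF (mixed n f0 f1 I)) (cube_proj n A D HF x I)" if I: "I \<in> faces n" for I
      using HF_cube_proj[OF Sd(1) I] HF_cube_proj[OF Sd(2) I] HF_ar[OF mixed_hom[OF S]]
        H_comp[OF \<beta>(1) F.cube_proj_hom[OF Sd(2) I]]
        H_comp[OF F.cube_proj_hom[OF Sd(1) I] F.F_hom[OF mixed_hom[OF S]]] \<beta>(2) I by simp
    moreover have "(far HF f0, proj D (fob HF x), proj D (fob HF y), far H \<beta>) \<in> Sq D"
      using H_Sq[OF \<beta>(3)] H_proj[OF F.bnd(1,2)[OF Sd(1)]] H_proj[OF F.bnd(1,2)[OF Sd(2)]]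
        HF_ob[OF P_Obj[OF Sd(1)]] HF_ob[OF P_Obj[OF Sd(2)]] HF_ar[OF Sd(3)] by simp
    moreover have "far H \<beta> \<in> hom D (bnd n A D HF x) (bnd n A D HF y)"
      using H_hom[OF \<beta>(1)] HF_bnd(1) Sd(1,2) by simp
    ultimately show "\<exists>\<beta>\<in>hom D (bnd n A D HF x) (bnd n A D HF y).
      (\<forall>I\<in>faces n. Cmp D (cube_proj n A D HF y I) \<beta> =
          Cmp D (far HF (mixed n f0 f1 I)) (cube_proj n A D HF x I)) \<and>
      (far HF f0, proj D (fob HF x), proj D (fob HF y), \<beta>) \<in> Sq D" by blast
  qed
  moreover have "ext_ftr PC HF" unfolding ext_ftr_def comp_ftr_def by simp
  ultimately show ?thesis using HF.multimorphism_iff by blast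
qed

end

lemma postcompositionI:
  assumes "precontextual_family n A" "contextual C" "contextual D" "contextual_functor C D H"
    "multimorphism n A C F"
  shows "postcomposition n A C D H F"
proof -
  interpret precontextual_family n A by fact
  interpret C: contextual_category C by (rule contextual_categoryI[OF assms(2)])
  interpret contextual_functor_on C D H
    using assms(3,4) by unfold_locales
  interpret cellular_functor n A C F
    by (rule multimorphism_cellular_functor[OF precontextual_family_axioms C.contextual_category_axioms assms(5)])
  show ?thesis ..
qed

text \<open>The images of \<open>\<phi>\<close> and of the witnesses \<open>\<kappa>\<close> work,
  since \<open>HF_bnd\<close> carries the boundary projections along.\<close>

lemma shuffling_diagram_postcomposition:
  assumes fam: "permuted_family n A \<sigma>" and C: "contextual C" and D: "contextual D"
    and H: "contextual_functor C D H" and d: "shuffling_diagram n A \<sigma> C F F' \<phi>"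
  shows "shuffling_diagram n A \<sigma> D (comp_ftr (prod_cat n (A \<circ> \<sigma>)) H F) (comp_ftr (prod_cat n A) H F')
      (\<lambda>x. far H (\<phi> x))"
proof -
  interpret S: shuffling_pair n A \<sigma> C F F' \<phi> by (rule shuffling_pairI[OF fam contextual_categoryI[OF C] d])
  have d': "multimorphism n (A \<circ> \<sigma>) C F" "multimorphism n A C F'" "S.latching_squares F' \<phi>"
    using d S.shuffling_diagram_iff by auto
  interpret K: postcomposition n "A \<circ> \<sigma>" C D H F
    by (rule postcompositionI[OF S.S.precontextual_family_axioms C D H d'(1)])
  interpret K': postcomposition n A C D H F'
    by (rule postcompositionI[OF S.precontextual_family_axioms C D H d'(2)])
  note m = K.multimorphism_HF[OF d'(1)] and m' = K'.multimorphism_HF[OF d'(2)]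
  interpret T: multimorphism_source n A \<sigma> D K.HF
    by (rule multimorphism_sourceI[OF fam contextual_categoryI[OF D] m])
  have "T.comparison K'.HF (\<lambda>x. far H (\<phi> x))"
    unfolding T.comparison_def
  proof (intro conjI ballI allI)
    fix x assume x: "x \<in> Obj S.PC"
    show "far H (\<phi> x) \<in> hom D (fob K'.HF x) (fob K.HF (S.s x))"
      using K.H_hom[OF S.\<phi>_hom[OF x]] K.HF_ob[OF S.s_Obj[OF x]] K'.HF_ob[OF x] by simp
    show "iso_arr D (far H (\<phi> x))" using K.H_iso[OF S.\<phi>_hom[OF x] S.\<phi>_iso[OF x]] .
  next
    fix x y f assume f: "f \<in> hom S.PC x y"
    note o = S.PC.hom_Obj[OF f]
    show "Cmp D (far H (\<phi> y)) (far K'.HF f) = Cmp D (far K.HF (S.s f)) (far H (\<phi> x))"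
      using K'.HF_ar[OF f] K.HF_ar[OF S.s_hom[OF f]] S.\<phi>_nat[OF f] o
        K.H_comp[OF S.F'.F_hom[OF f] S.\<phi>_hom] K.H_comp[OF S.\<phi>_hom S.Fs_hom[OF f]] by simp
  qed
  then have pair: "shuffling_pair n A \<sigma> D K.HF K'.HF (\<lambda>x. far H (\<phi> x))"
    by (intro shuffling_pair.intro shuffling_pair_axioms.intro T.multimorphism_source_axioms
        K'.HF.cellular_functor_axioms)
  have "T.latching_squares K'.HF (\<lambda>x. far H (\<phi> x))"
    unfolding T.latching_squares_def
  proof
    fix a assume a: "a \<in> S.P"
    obtain \<kappa> where \<kappa>: "\<kappa> \<in> hom C (bnd n A C F' a) (S.g a)"
      "\<forall>b\<in>sdown S.P S.le a. Cmp C (S.\<rho> a b) \<kappa> = Cmp C (\<phi> b) (bnd_proj n A C F' a b)"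
      "(\<phi> a, proj C (fob F' a), proj C (fob F (S.s a)), \<kappa>) \<in> Sq C"
      using d'(3) a unfolding S.latching_squares_def by blast
    note sa = S.s_P[OF a]
    have 1: "Cmp D (T.\<rho> a b) (far H \<kappa>) = Cmp D (far H (\<phi> b)) (bnd_proj n A D K'.HF a b)"
      if b: "b \<in> sdown S.P S.le a" for b
    proof -
      have bP: "b \<in> S.P" and sb: "S.s b \<in> sdown S.S.P S.S.le (S.s a)"
        using b S.poset_iso_sdown[OF a] unfolding sdown_def by blast+
      show ?thesis
        using K.HF_bnd(2)[OF sa sb] K'.HF_bnd(2)[OF a b] \<kappa>(2) b
          K.H_comp[OF \<kappa>(1) S.F.bnd(5)[OF sa sb]]
          K.H_comp[OF S.F'.bnd(5)[OF a b] S.\<phi>_hom[OF S.P_Obj[OF bP]]] by simp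
    qed
    moreover have "far H \<kappa> \<in> hom D (bnd n A D K'.HF a) (T.g a)"
      using K.H_hom[OF \<kappa>(1)] K.HF_bnd(1)[OF sa] K'.HF_bnd(1)[OF a] by simp
    moreover have "(far H (\<phi> a), proj D (fob K'.HF a), proj D (fob K.HF (S.s a)), far H \<kappa>) \<in> Sq D"
      using K.H_Sq[OF \<kappa>(3)] K.H_proj[OF S.F'.bnd(1,2)[OF a]] K.H_proj[OF S.F.bnd(1,2)[OF sa]]
        K'.HF_ob[OF S.P_Obj[OF a]] K.HF_ob[OF S.S.P_Obj[OF sa]] by simp
    ultimately show "\<exists>\<kappa>\<in>hom D (bnd n A D K'.HF a) (T.g a).
      (\<forall>b\<in>sdown S.P S.le a. Cmp D (T.\<rho> a b) \<kappa> = Cmp D (far H (\<phi> b)) (bnd_proj n A D K'.HF a b)) \<and>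
      (far H (\<phi> a), proj D (fob K'.HF a), proj D (fob K.HF (S.s a)), \<kappa>) \<in> Sq D" by blast
  qed
  then show ?thesis using shuffling_pair.shuffling_diagram_iff[OF pair] m m' by blast
qed

section \<open>Contextual functors on the factors are local isomorphisms for both orders\<close>

section \<open>Naturality in the sources\<close>

context precontextual_functor
begin

lemma display_H: "display C y x m \<Longrightarrow> display D (fob H y) (fob H x) (far H m)"
proof (induction rule: display.induct)
  case (display_id a)
  then show ?case using display.display_id[OF H_Obj] H_id by simp
next
  case (display_step a b m)
  have "far H (Cmp C m (proj C a)) = Cmp D (far H m) (proj D (fob H a))"
    using H_comp[OF proj_hom[OF display_step(1,2)] display_hom[OF display_step(3)]]
      H_proj[OF display_step(1,2)] by simp
  moreover have "display D (bd D (fob H a)) (fob H b) (far H m)"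
    using display_step(4) H_bd[OF display_step(1)] by simp
  ultimately show ?case
    using display.display_step[OF H_Obj[OF display_step(1)]] H_len[OF display_step(1)] display_step(2) by simp
qed

lemma tle_H: "tle C x y \<Longrightarrow> tle D (fob H x) (fob H y)"
  using display_H unfolding tle_def by blast

lemma disp_H: "tle C x y \<Longrightarrow> far H (disp C y x) = disp D (fob H y) (fob H x)"
  using D.disp_eqI[OF display_H[OF disp]] by simp

text \<open>Objects below \<open>w\<close> are iterated boundaries of \<open>w\<close> and hence
  determined by their length, which \<open>H\<close> preserves.\<close>

lemma H_inj_below:
  assumes "tle C x w" "tle C y w" "fob H x = fob H y"
  shows "x = y"
proof -
  have "len C x = len C y" using H_len tle_Obj(1) assms by metis
  then show ?thesis using assms(1,2) tle_iff[OF precontextual] by metis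
qed

text \<open>Two objects below \<open>w\<close> are comparable; if the comparison goes the other way,
  antisymmetry in \<open>D\<close> makes the images equal.\<close>

lemma tle_H_below:
  assumes "tle C x w" "tle C y w"
  shows "tle D (fob H x) (fob H y) \<longleftrightarrow> tle C x y"
proof
  assume *: "tle D (fob H x) (fob H y)"
  show "tle C x y"
  proof (cases "tle C x y")
    case False
    then have yx: "tle C y x" using tle_chain[OF precontextual assms] by blast
    then have "fob H x = fob H y" using D.tle_antisym[OF * tle_H] by blast
    then show ?thesis using H_inj_below[OF assms] yx by simp
  qed
qed (rule tle_H)

text \<open>The preimage is an iterated boundary of \<open>w\<close>, the number of iterations being
  the difference of lengths in \<open>D\<close>.\<close>

lemma H_surj_below:
  assumes w: "w \<in> Obj C" and z: "tle D z (fob H w)"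
  shows "\<exists>x. tle C x w \<and> fob H x = z"
proof -
  have pow: "fob H ((bd C ^^ k) w) = (bd D ^^ k) (fob H w) \<and> (bd C ^^ k) w \<in> Obj C" for k
    by (induction k) (use w bd_Obj in \<open>auto simp: H_bd[symmetric]\<close>)
  let ?k = "len D (fob H w) - len D z"
  have "z = (bd D ^^ ?k) (fob H w)" using z tle_iff[OF D.precontextual] by blast
  moreover have "\<exists>m. display C w ((bd C ^^ ?k) w) m"
    using display_bd[OF precontextual w, of ?k] H_len[OF w] by simp
  ultimately show ?thesis using pow unfolding tle_def by metis
qed

end

locale family_functor = A': precontextual_family n A' + precontextual_family n A
  for n and A' :: "nat \<Rightarrow> ('p, 'q) precat" and A :: "nat \<Rightarrow> ('o, 'm) precat" +
  fixes U :: "nat \<Rightarrow> ('p, 'q, 'o, 'm) ftr"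
  assumes U: "\<And>i. i \<in> {1..n} \<Longrightarrow> contextual_functor (A' i) (A i) (U i)"
begin

lemma U_i: "i \<in> {1..n} \<Longrightarrow> precontextual_functor (A' i) (A i) (U i)"
  unfolding precontextual_functor_def precontextual_functor_axioms_def using A'.pc pc U by blast

abbreviation "u \<equiv> fob (prod_ftr n U)"
abbreviation "ua \<equiv> far (prod_ftr n U)"

lemma u_apply: "i \<in> {1..n} \<Longrightarrow> u x i = fob (U i) (x i)"
  and ua_apply: "i \<in> {1..n} \<Longrightarrow> ua f i = far (U i) (f i)"
  unfolding prod_ftr_def by simp_all

lemma u_ext: "u x \<in> extensional {1..n}" and ua_ext: "ua f \<in> extensional {1..n}"
  unfolding prod_ftr_def by simp_all

lemma u_Obj: "x \<in> Obj A'.PC \<Longrightarrow> u x \<in> Obj PC"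
  unfolding PC_Obj A'.PC_Obj using u_ext u_apply precontextual_functor.H_Obj[OF U_i] by metis

lemma u_P_iff:
  assumes x: "x \<in> Obj A'.PC"
  shows "u x \<in> P \<longleftrightarrow> x \<in> A'.P"
proof -
  have "len (A i) (u x i) = len (A' i) (x i)" if i: "i \<in> {1..n}" for i
    using precontextual_functor.H_len[OF U_i[OF i]] x i unfolding A'.PC_Obj u_apply[OF i] by blast
  then show ?thesis using x u_Obj[OF x] unfolding P_iff_Obj A'.P_iff_Obj by simp
qed

lemma u_P: "x \<in> A'.P \<Longrightarrow> u x \<in> P"
  using u_P_iff A'.P_Obj by blast

lemma ua_hom:
  assumes "f \<in> hom A'.PC x y" shows "ua f \<in> hom PC (u x) (u y)"
proof -
  have "x \<in> extensional {1..n}" "y \<in> extensional {1..n}"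
    using A'.PC.hom_Obj[OF assms] A'.PC_Obj by auto
  then have "\<forall>i\<in>{1..n}. f i \<in> hom (A' i) (x i) (y i)" using assms A'.PC_hom by blast
  then have "\<forall>i\<in>{1..n}. ua f i \<in> hom (A i) (u x i) (u y i)"
    using precontextual_functor.H_hom[OF U_i] u_apply ua_apply by metis
  then show ?thesis using PC_hom[OF u_ext u_ext] ua_ext by blast
qed

lemma ua_Cmp:
  assumes f: "f \<in> hom A'.PC x y" and g: "g \<in> hom A'.PC y z"
  shows "ua (Cmp A'.PC g f) = Cmp PC (ua g) (ua f)"
proof (rule extensionalityI[OF ua_ext])
  have e: "x \<in> extensional {1..n}" "y \<in> extensional {1..n}" "z \<in> extensional {1..n}"
    using A'.PC.hom_Obj[OF f] A'.PC.hom_Obj[OF g] A'.PC_Obj by auto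
  fix i assume i: "i \<in> {1..n}"
  have "f i \<in> hom (A' i) (x i) (y i)" "g i \<in> hom (A' i) (y i) (z i)"
    using f g i A'.PC_hom[OF e(1,2)] A'.PC_hom[OF e(2,3)] by blast+
  from precontextual_functor.H_comp[OF U_i[OF i] this]
  show "ua (Cmp A'.PC g f) i = Cmp PC (ua g) (ua f) i"
    using i unfolding ua_apply[OF i] PC_Cmp A'.PC_Cmp by (simp add: prod_ftr_def)
qed (simp add: PC_Cmp)

lemma ua_Idn:
  assumes x: "x \<in> Obj A'.PC"
  shows "ua (Idn A'.PC x) = Idn PC (u x)"
proof (rule extensionalityI[OF ua_ext])
  fix i assume i: "i \<in> {1..n}"
  then have "x i \<in> Obj (A' i)" using x A'.PC_Obj by blast
  then show "ua (Idn A'.PC x) i = Idn PC (u x) i"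
    using i precontextual_functor.H_id[OF U_i[OF i]] unfolding ua_apply[OF i] PC_Idn A'.PC_Idn
    by (simp add: prod_ftr_def)
qed (simp add: PC_Idn)

lemma ua_pdisp:
  assumes "A'.le x y"
  shows "ua (pdisp n A' y x) = pdisp n A (u y) (u x)"
proof (rule extensionalityI[OF ua_ext])
  fix i assume i: "i \<in> {1..n}"
  then have "tle (A' i) (x i) (y i)" using assms unfolding ptle_def by blast
  then show "ua (pdisp n A' y x) i = pdisp n A (u y) (u x) i"
    using i precontextual_functor.disp_H[OF U_i[OF i]] unfolding ua_apply[OF i] pdisp_def
    by (simp add: prod_ftr_def)
qed (simp add: pdisp_def)

lemma below:
  assumes "x \<in> down A'.P A'.le w" "i \<in> {1..n}"
  shows "tle (A' i) (x i) (w i)" "x i \<in> Obj (A' i)"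
  using assms A'.P_iff unfolding down_def ptle_def by auto

lemma tle_u:
  assumes "x \<in> down A'.P A'.le w" "y \<in> down A'.P A'.le w" "i \<in> {1..n}"
  shows "tle (A i) (u x i) (u y i) \<longleftrightarrow> tle (A' i) (x i) (y i)" "u x i = u y i \<longleftrightarrow> x i = y i"
  using precontextual_functor.tle_H_below[OF U_i[OF assms(3)] below(1)[OF assms(1,3)] below(1)[OF assms(2,3)]]
    precontextual_functor.H_inj_below[OF U_i[OF assms(3)] below(1)[OF assms(1,3)] below(1)[OF assms(2,3)]]
  unfolding u_apply[OF assms(3)] by auto

lemma le_u:
  assumes "x \<in> down A'.P A'.le w" "y \<in> down A'.P A'.le w"
  shows "le (u x) (u y) \<longleftrightarrow> A'.le x y"
  unfolding ptle_def using tle_u(1)[OF assms] by simp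

lemma u_inj:
  assumes "x \<in> down A'.P A'.le w" "y \<in> down A'.P A'.le w" "u x = u y"
  shows "x = y"
proof (rule extensionalityI)
  show "x \<in> extensional {1..n}" "y \<in> extensional {1..n}" using assms A'.P_iff unfolding down_def by auto
  show "x i = y i" if "i \<in> {1..n}" for i using tle_u(2)[OF assms(1,2) that] assms(3) by simp
qed

text \<open>The lexicographic order is built from \<open>tle\<close> and equality in each
  coordinate, both reflected below a fixed \<open>w\<close>, and the order of the factors is
  unchanged.\<close>

lemma lin_u:
  assumes "x \<in> down A'.P A'.le w" "y \<in> down A'.P A'.le w"
  shows "lin (u x) (u y) \<longleftrightarrow> A'.lin x y"
proof -
  have "u x = u y \<longleftrightarrow> x = y" using u_inj[OF assms] by blast
  then show ?thesis
    unfolding lex_lin_def using tle_u[OF assms] tle_u[OF assms(2,1)]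
    by (auto intro!: bex_cong)
qed

lemma u_local_iso: "poset_local_iso u A'.P A'.le P le"
  unfolding poset_local_iso_def
proof (intro ballI conjI)
  fix w assume w: "w \<in> A'.P"
  interpret LP: locally_linearized_poset A'.P A'.le A'.lin by unfold_locales (rule A'.local_linearization)
  note ww = LP.self_down[OF w]
  show "u w \<in> P" using u_P[OF w] .
  show "bij_betw u (down A'.P A'.le w) (down P le (u w))"
    unfolding bij_betw_def
  proof
    show "inj_on u (down A'.P A'.le w)" using u_inj unfolding inj_on_def by blast
    show "u ` down A'.P A'.le w = down P le (u w)"
    proof (intro equalityI subsetI)
      fix z assume "z \<in> u ` down A'.P A'.le w"
      then obtain x where x: "x \<in> down A'.P A'.le w" "z = u x" by blast
      then have "x \<in> A'.P" "A'.le x w" unfolding down_def by auto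
      then show "z \<in> down P le (u w)" using u_P le_u[OF x(1) ww] x(2) unfolding down_def by simp
    next
      fix z assume z: "z \<in> down P le (u w)"
      then have zP: "z \<in> P" and zl: "le z (u w)" unfolding down_def by auto
      have "\<exists>x. tle (A' i) x (w i) \<and> fob (U i) x = z i" if i: "i \<in> {1..n}" for i
        using precontextual_functor.H_surj_below[OF U_i[OF i]] A'.tob_i(1)[OF w i] zl i u_apply[OF i]
        unfolding ptle_def by metis
      then obtain x where x: "\<And>i. i \<in> {1..n} \<Longrightarrow> tle (A' i) (x i) (w i) \<and> fob (U i) (x i) = z i" by metis
      \<comment> \<open>Restriction turns the coordinatewise preimages into an extensional
        tuple.\<close>
      let ?x = "restrict x {1..n}"
      have uz: "u ?x = z"
        by (rule extensionalityI[OF u_ext]) (use x zP P_iff in \<open>auto simp: prod_ftr_def\<close>)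
      have "x i \<in> Obj (A' i)" if i: "i \<in> {1..n}" for i
        using precontextual_category.tle_Obj(1)[OF A'.pc[OF i]] x[OF i] by blast
      then have "?x \<in> Obj A'.PC" unfolding A'.PC_Obj by simp
      then have "?x \<in> A'.P" using u_P_iff uz zP by metis
      moreover have "A'.le ?x w" using x unfolding ptle_def by simp
      ultimately show "z \<in> u ` down A'.P A'.le w" using uz unfolding down_def by blast
    qed
  qed
qed (use le_u in blast)

lemma u_cube:
  assumes x: "x \<in> A'.P"
  shows "u (cube n A' x I) = cube n A (u x) I"
proof (rule extensionalityI[OF u_ext cube_ext])
  fix i assume i: "i \<in> {1..n}"
  show "u (cube n A' x I) i = cube n A (u x) I i"
    using i precontextual_functor.H_bd[OF U_i[OF i] A'.tob_i(1)[OF x i]]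
    unfolding u_apply[OF i] A'.cube_apply[OF i] cube_apply[OF i] by (simp add: prod_ftr_def)
qed

lemma ua_mixed: "ua (mixed n f0 f1 I) = mixed n (ua f0) (ua f1) I"
  by (rule extensionalityI[OF ua_ext]) (auto simp: mixed_def prod_ftr_def)

lemma ua_Sq_family:
  assumes S: "Sq_family n A' x y f0 f1"
  shows "Sq_family n A (u x) (u y) (ua f0) (ua f1)"
proof -
  have x: "x \<in> A'.P" and y: "y \<in> A'.P" and f0: "f0 \<in> hom A'.PC x y" and f1: "f1 \<in> Arr A'.PC"
    and sq: "\<And>i. i \<in> {1..n} \<Longrightarrow> (f0 i, proj (A' i) (x i), proj (A' i) (y i), f1 i) \<in> Sq (A' i)"
    using S unfolding Sq_family_def by auto
  have "ua f1 \<in> Arr PC" using PC.hom_Arr[OF ua_hom[OF A'.PC.Arr_hom[OF f1]]] by blast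
  moreover have "(ua f0 i, proj (A i) (u x i), proj (A i) (u y i), ua f1 i) \<in> Sq (A i)" if i: "i \<in> {1..n}" for i
    using precontextual_functor.H_Sq[OF U_i[OF i] sq[OF i]]
      precontextual_functor.H_proj[OF U_i[OF i] A'.tob_i(1,2)[OF x i]]
      precontextual_functor.H_proj[OF U_i[OF i] A'.tob_i(1,2)[OF y i]]
    unfolding u_apply[OF i] ua_apply[OF i] by simp
  ultimately show ?thesis using u_P[OF x] u_P[OF y] ua_hom[OF f0] unfolding Sq_family_def by blast
qed

end

locale precomposition = family_functor n A' A U + F: cellular_functor n A C F
  for n and A' :: "nat \<Rightarrow> ('p, 'q) precat" and A :: "nat \<Rightarrow> ('o, 'm) precat" and U
    and C :: "('c, 'd) precat" and F
begin

abbreviation "FU \<equiv> comp_ftr A'.PC F (prod_ftr n U)"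

lemma FU_ob: "x \<in> Obj A'.PC \<Longrightarrow> fob FU x = fob F (u x)"
  and FU_ar: "f \<in> hom A'.PC x y \<Longrightarrow> far FU f = far F (ua f)"
  unfolding comp_ftr_def hom_def by simp_all

lemma FU_functor: "is_functor A'.PC C FU"
  unfolding is_functor_def
proof (intro conjI ballI impI)
  fix x assume x: "x \<in> Obj A'.PC"
  show "fob FU x \<in> Obj C" using FU_ob[OF x] F.F_Obj[OF u_Obj[OF x]] by simp
  show "far FU (Idn A'.PC x) = Idn C (fob FU x)"
    using FU_ob[OF x] FU_ar[OF A'.PC.id_hom[OF x]] F.F_id[OF u_Obj[OF x]] ua_Idn[OF x] by simp
next
  fix f assume "f \<in> Arr A'.PC"
  note fh = A'.PC.Arr_hom[OF this]
  show "far FU f \<in> hom C (fob FU (Src A'.PC f)) (fob FU (Trg A'.PC f))"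
    using FU_ob A'.PC.hom_Obj[OF fh] FU_ar[OF fh] F.F_hom[OF ua_hom[OF fh]] by simp
  fix k assume k: "k \<in> Arr A'.PC" and c: "Src A'.PC k = Trg A'.PC f"
  have kh: "k \<in> hom A'.PC (Trg A'.PC f) (Trg A'.PC k)" using A'.PC.Arr_hom[OF k] c by simp
  show "far FU (Cmp A'.PC k f) = Cmp C (far FU k) (far FU f)"
    using FU_ar[OF fh] FU_ar[OF kh] FU_ar[OF A'.PC.comp_hom[OF fh kh]] ua_Cmp[OF fh kh]
      F.F_comp[OF ua_hom[OF fh] ua_hom[OF kh]] by simp
qed

text \<open>Boundary data of the composite equal those of \<open>F\<close> at the image, so no
  comparison isomorphism enters naturality in the sources.\<close>

lemma FU_reindex:
  "locally_cellular C A'.P A'.le A'.lin (tdiag n A' FU)"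
  "x \<in> A'.P \<Longrightarrow> bnd n A' C FU x = bnd n A C F (u x)"
  "x \<in> A'.P \<Longrightarrow> z \<in> sdown A'.P A'.le x \<Longrightarrow> bnd_proj n A' C FU x z = bnd_proj n A C F (u x) (u z)"
proof -
  have Q: "locally_linearized_poset A'.P A'.le A'.lin" by unfold_locales (rule A'.local_linearization)
  have 1: "fob (tdiag n A' FU) x = fob (tdiag n A F) (u x)" if "x \<in> A'.P" for x
    using FU_ob[OF A'.P_Obj[OF that]] by (simp add: tdiag_simps)
  have 2: "far (tdiag n A' FU) (y, x) = far (tdiag n A F) (u y, u x)"
    if "x \<in> A'.P" "y \<in> A'.P" "A'.le x y" for x y
    using FU_ar[OF A'.pdisp_hom[OF that]] ua_pdisp[OF that(3)] by (simp add: tdiag_simps)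
  note r = F.L.locally_cellular_reindex[OF Q u_local_iso _ A'.diagram_tdiag[OF FU_functor] 1 2]
  show "locally_cellular C A'.P A'.le A'.lin (tdiag n A' FU)"
    by (rule r(1)) (use lin_u in blast)
  show "x \<in> A'.P \<Longrightarrow> bnd n A' C FU x = bnd n A C F (u x)"
    unfolding bnd_def by (rule r(2)) (use lin_u in blast)
  show "x \<in> A'.P \<Longrightarrow> z \<in> sdown A'.P A'.le x \<Longrightarrow> bnd_proj n A' C FU x z = bnd_proj n A C F (u x) (u z)"
    unfolding bnd_proj_def by (rule r(3)) (use lin_u in blast)
qed

sublocale FU: cellular_functor n A' C FU
proof
  show "is_functor A'.PC C FU" by (rule FU_functor)
  show "fob FU x = unit_ob C" if "x \<in> Obj A'.PC" "x \<notin> A'.P" for x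
    using FU_ob[OF that(1)] F.F_unit[OF u_Obj[OF that(1)]] u_P_iff[OF that(1)] that(2) by simp
  show "locally_cellular C A'.P A'.le A'.lin (tdiag n A' FU)" by (rule FU_reindex(1))
qed

lemma FU_cube_proj:
  assumes x: "x \<in> A'.P" and I: "I \<in> faces n"
  shows "cube_proj n A' C FU x I = cube_proj n A C F (u x) I"
proof (cases "cube n A' x I \<in> A'.P")
  case True
  then show ?thesis
    using FU_reindex(3)[OF x A'.cube_sdown[OF x I True]] u_P[OF True] u_cube[OF x] unfolding cube_proj_def by simp
next
  case False
  then have "cube n A (u x) I \<notin> P" using u_P_iff[OF A'.cube_Obj[OF x]] u_cube[OF x] by metis
  then show ?thesis using False FU_reindex(2)[OF x] unfolding cube_proj_def by simp
qed

lemma multimorphism_FU: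
  assumes "multimorphism n A C F"
  shows "multimorphism n A' C FU"
proof -
  have "preserves_squares n A' C FU"
    unfolding preserves_squares_def
  proof (intro allI impI)
    fix x y f0 f1 assume S: "Sq_family n A' x y f0 f1"
    note Sd = A'.Sq_familyD[OF S]
    obtain \<beta> where \<beta>: "\<beta> \<in> hom C (bnd n A C F (u x)) (bnd n A C F (u y))"
      "\<forall>I\<in>faces n. Cmp C (cube_proj n A C F (u y) I) \<beta> =
          Cmp C (far F (mixed n (ua f0) (ua f1) I)) (cube_proj n A C F (u x) I)"
      "(far F (ua f0), proj C (fob F (u x)), proj C (fob F (u y)), \<beta>) \<in> Sq C"
      using assms ua_Sq_family[OF S] F.multimorphism_iff unfolding preserves_squares_def by blast
    have "Cmp C (cube_proj n A' C FU y I) \<beta> =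
        Cmp C (far FU (mixed n f0 f1 I)) (cube_proj n A' C FU x I)" if I: "I \<in> faces n" for I
      using FU_cube_proj[OF Sd(1) I] FU_cube_proj[OF Sd(2) I] FU_ar[OF A'.mixed_hom[OF S]] \<beta>(2) I ua_mixed
      by simp
    moreover have "(far FU f0, proj C (fob FU x), proj C (fob FU y), \<beta>) \<in> Sq C"
      using \<beta>(3) FU_ob[OF A'.P_Obj[OF Sd(1)]] FU_ob[OF A'.P_Obj[OF Sd(2)]] FU_ar[OF Sd(3)] by simp
    moreover have "\<beta> \<in> hom C (bnd n A' C FU x) (bnd n A' C FU y)"
      using \<beta>(1) FU_reindex(2) Sd(1,2) by simp
    ultimately show "\<exists>\<beta>\<in>hom C (bnd n A' C FU x) (bnd n A' C FU y).
      (\<forall>I\<in>faces n. Cmp C (cube_proj n A' C FU y I) \<beta> =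
          Cmp C (far FU (mixed n f0 f1 I)) (cube_proj n A' C FU x I)) \<and>
      (far FU f0, proj C (fob FU x), proj C (fob FU y), \<beta>) \<in> Sq C" by blast
  qed
  moreover have "ext_ftr A'.PC FU" unfolding ext_ftr_def comp_ftr_def by simp
  ultimately show ?thesis using FU.multimorphism_iff by blast
qed

end

lemma precompositionI:
  assumes "family_functor n A' A U" "contextual C" "multimorphism n A C F"
  shows "precomposition n A' A U C F"
proof -
  interpret family_functor n A' A U by fact
  have "cellular_functor n A C F"
    by (rule multimorphism_cellular_functor[OF precontextual_family_axioms contextual_categoryI[OF assms(2)] assms(3)])
  then show ?thesis using assms(1) by (intro precomposition.intro)
qed

text \<open>As boundary data coincide, \<open>\<phi>\<close> and \<open>\<kappa>\<close> are simply
  evaluated at the image tuple, using that reordering commutes with applying the functors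
  coordinatewise.\<close>

lemma shuffling_diagram_precomposition:
  assumes fam: "family_functor n A' A U" and perm: "\<sigma> permutes {1..n}" and C: "contextual C"
    and d: "shuffling_diagram n A \<sigma> C F F' \<phi>"
  shows "shuffling_diagram n A' \<sigma> C (comp_ftr (prod_cat n (A' \<circ> \<sigma>)) F (prod_ftr n (U \<circ> \<sigma>)))
      (comp_ftr (prod_cat n A') F' (prod_ftr n U)) (\<lambda>x. \<phi> (fob (prod_ftr n U) x))"
proof -
  interpret U: family_functor n A' A U by (rule fam)
  have pf: "permuted_family n A \<sigma>" "permuted_family n A' \<sigma>"
    using perm U.precontextual_family_axioms U.A'.precontextual_family_axioms
    unfolding permuted_family_def permuted_family_axioms_def by blast+
  interpret S: shuffling_pair n A \<sigma> C F F' \<phi> by (rule shuffling_pairI[OF pf(1) contextual_categoryI[OF C] d])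
  interpret S': permuted_family n A' \<sigma> by (rule pf(2))
  have fam': "family_functor n (A' \<circ> \<sigma>) (A \<circ> \<sigma>) (U \<circ> \<sigma>)"
    using S.S.precontextual_family_axioms S'.S.precontextual_family_axioms U.U S.perm_in
    unfolding family_functor_def family_functor_axioms_def by auto
  have d': "multimorphism n (A \<circ> \<sigma>) C F" "multimorphism n A C F'" "S.latching_squares F' \<phi>"
    using d S.shuffling_diagram_iff by auto
  interpret K: precomposition n "A' \<circ> \<sigma>" "A \<circ> \<sigma>" "U \<circ> \<sigma>" C F by (rule precompositionI[OF fam' C d'(1)])
  interpret K': precomposition n A' A U C F' by (rule precompositionI[OF fam C d'(2)])
  note m = K.multimorphism_FU[OF d'(1)] and m' = K'.multimorphism_FU[OF d'(2)]
  have us: "K.u (S.s x) = S.s (U.u x)" for x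
    using S.perm_in by (auto simp: fun_eq_iff reorder_def prod_ftr_def)
  have uas: "K.ua (S.s f) = S.s (U.ua f)" for f
    using S.perm_in by (auto simp: fun_eq_iff reorder_def prod_ftr_def)
  interpret T: multimorphism_source n A' \<sigma> C K.FU
    by (rule multimorphism_sourceI[OF pf(2) contextual_categoryI[OF C] m])
  let ?\<phi> = "\<lambda>x. \<phi> (U.u x)"
  have "T.comparison K'.FU ?\<phi>"
    unfolding T.comparison_def
  proof (intro conjI ballI allI)
    fix x assume x: "x \<in> Obj U.A'.PC"
    show "?\<phi> x \<in> hom C (fob K'.FU x) (fob K.FU (S.s x))"
      using S.\<phi>_hom[OF U.u_Obj[OF x]] K.FU_ob[OF S'.s_Obj[OF x]] K'.FU_ob[OF x] us by simp
    show "iso_arr C (?\<phi> x)" using S.\<phi>_iso[OF U.u_Obj[OF x]] .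
  next
    fix x y f assume f: "f \<in> hom U.A'.PC x y"
    show "Cmp C (?\<phi> y) (far K'.FU f) = Cmp C (far K.FU (S.s f)) (?\<phi> x)"
      using K'.FU_ar[OF f] K.FU_ar[OF S'.s_hom[OF f]] S.\<phi>_nat[OF U.ua_hom[OF f]] uas by simp
  qed
  then have pair: "shuffling_pair n A' \<sigma> C K.FU K'.FU ?\<phi>"
    by (intro shuffling_pair.intro shuffling_pair_axioms.intro T.multimorphism_source_axioms
        K'.FU.cellular_functor_axioms)
  have "T.latching_squares K'.FU ?\<phi>"
    unfolding T.latching_squares_def
  proof
    fix a assume a: "a \<in> U.A'.P"
    note ua = U.u_P[OF a]
    obtain \<kappa> where \<kappa>: "\<kappa> \<in> hom C (bnd n A C F' (U.u a)) (S.g (U.u a))"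
      "\<forall>b\<in>sdown U.P U.le (U.u a). Cmp C (S.\<rho> (U.u a) b) \<kappa> = Cmp C (\<phi> b) (bnd_proj n A C F' (U.u a) b)"
      "(\<phi> (U.u a), proj C (fob F' (U.u a)), proj C (fob F (S.s (U.u a))), \<kappa>) \<in> Sq C"
      using d'(3) ua unfolding S.latching_squares_def by blast
    note sa = S'.s_P[OF a]
    have "Cmp C (T.\<rho> a b) \<kappa> = Cmp C (?\<phi> b) (bnd_proj n A' C K'.FU a b)" if b: "b \<in> sdown U.A'.P U.A'.le a" for b
    proof -
      have "S.s b \<in> sdown S'.S.P S'.S.le (S.s a)" using b S'.poset_iso_sdown[OF a] by blast
      moreover have "U.u b \<in> sdown U.P U.le (U.u a)"
        using K'.FU.L.local_iso_sdown(1)[OF U.u_local_iso a] b by blast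
      ultimately show ?thesis
        using K.FU_reindex(3)[OF sa] K'.FU_reindex(3)[OF a b] \<kappa>(2) us by simp
    qed
    moreover have "\<kappa> \<in> hom C (bnd n A' C K'.FU a) (T.g a)"
      using \<kappa>(1) K.FU_reindex(2)[OF sa] K'.FU_reindex(2)[OF a] us by simp
    moreover have "(?\<phi> a, proj C (fob K'.FU a), proj C (fob K.FU (S.s a)), \<kappa>) \<in> Sq C"
      using \<kappa>(3) K'.FU_ob[OF U.A'.P_Obj[OF a]] K.FU_ob[OF S'.S.P_Obj[OF sa]] us by simp
    ultimately show "\<exists>\<kappa>\<in>hom C (bnd n A' C K'.FU a) (T.g a).
      (\<forall>b\<in>sdown U.A'.P U.A'.le a. Cmp C (T.\<rho> a b) \<kappa> = Cmp C (?\<phi> b) (bnd_proj n A' C K'.FU a b)) \<and>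
      (?\<phi> a, proj C (fob K'.FU a), proj C (fob K.FU (S.s a)), \<kappa>) \<in> Sq C" by blast
  qed
  then show ?thesis using shuffling_pair.shuffling_diagram_iff[OF pair] m m' by blast
qed

section \<open>The natural bijection\<close>

text \<open>Turns the exhibition of a shuffling diagram into an equation; every naturality statement
  is obtained this way.\<close>

lemma shuffle_eqI:
  assumes "permuted_family n A \<sigma>" "contextual C" "shuffling_diagram n A \<sigma> C F F' \<phi>"
  shows "shuffle n A \<sigma> C F = F'"
proof -
  have "multimorphism n (A \<circ> \<sigma>) C F" using assms(3) unfolding shuffling_diagram_def by blast
  from ex1_shuffling_diagram[OF assms(1) contextual_categoryI[OF assms(2)] this]
  show ?thesis unfolding shuffle_def using assms(3) by (intro the1_equality) auto
qed

lemma shuffling_diagram_shuffle: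
  assumes "permuted_family n A \<sigma>" "contextual C" "F \<in> Hom n (A \<circ> \<sigma>) C"
  obtains \<phi> where "shuffling_diagram n A \<sigma> C F (shuffle n A \<sigma> C F) \<phi>"
proof -
  have "multimorphism n (A \<circ> \<sigma>) C F" using assms(3) unfolding Hom_def by blast
  from theI'[OF ex1_shuffling_diagram[OF assms(1) contextual_categoryI[OF assms(2)] this]]
  show thesis using that unfolding shuffle_def by blast
qed

text \<open>The inverse diagram exhibits \<open>F\<close> as the result of shuffling by
  \<open>inv \<sigma>\<close>.\<close>

lemma shuffle_inverse:
  assumes fam: "permuted_family n A \<sigma>" and C: "contextual C" and F: "F \<in> Hom n (A \<circ> \<sigma>) C"
  shows "shuffle n A \<sigma> C F \<in> Hom n A C"
    "shuffle n (A \<circ> \<sigma>) (inv \<sigma>) C (shuffle n A \<sigma> C F) = F"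
proof -
  interpret permuted_family n A \<sigma> by (rule fam)
  obtain \<phi> where d: "shuffling_diagram n A \<sigma> C F (shuffle n A \<sigma> C F) \<phi>"
    by (rule shuffling_diagram_shuffle[OF assms])
  then show "shuffle n A \<sigma> C F \<in> Hom n A C" unfolding shuffling_diagram_def Hom_def by blast
  have fam': "permuted_family n (A \<circ> \<sigma>) (inv \<sigma>)" by unfold_locales (rule permutes_inv[OF perm])
  show "shuffle n (A \<circ> \<sigma>) (inv \<sigma>) C (shuffle n A \<sigma> C F) = F"
    by (rule shuffle_eqI[OF fam' C
          shuffling_pair.shuffling_diagram_inverse[OF shuffling_pairI[OF fam contextual_categoryI[OF C] d] d]])
qed

text \<open>\<open>shuffle_inverse\<close> for \<open>\<sigma>\<close> gives one composite; for the
  family \<open>A \<circ> \<sigma>\<close> and \<open>inv \<sigma>\<close> it gives the other, once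
  the two reorderings cancel.\<close>

lemma bij_betw_shuffle:
  assumes fam: "permuted_family n A \<sigma>" and C: "contextual C"
  shows "bij_betw (shuffle n A \<sigma> C) (Hom n (A \<circ> \<sigma>) C) (Hom n A C)"
proof -
  interpret permuted_family n A \<sigma> by (rule fam)
  have fam': "permuted_family n (A \<circ> \<sigma>) (inv \<sigma>)" by unfold_locales (rule permutes_inv[OF perm])
  have A: "A \<circ> \<sigma> \<circ> inv \<sigma> = A" using permutes_inverses(1)[OF perm] by (simp add: fun_eq_iff)
  have "inv (inv \<sigma>) = \<sigma>" using permutes_bij[OF perm] inv_inv_eq by blast
  then have "shuffle n (A \<circ> \<sigma>) (inv \<sigma>) C F \<in> Hom n (A \<circ> \<sigma>) C \<and>
      shuffle n A \<sigma> C (shuffle n (A \<circ> \<sigma>) (inv \<sigma>) C F) = F" if "F \<in> Hom n A C" for F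
    using shuffle_inverse[OF fam' C, of F] that A by simp
  then show ?thesis
    using shuffle_inverse[OF fam C] by (intro bij_betw_byWitness[where f' = "shuffle n (A \<circ> \<sigma>) (inv \<sigma>) C"]) auto
qed

text \<open>The inclusions of images say that post- and precomposition stay within multimorphisms,
  so that the equations for \<open>shuffle\<close> are genuine naturality squares.\<close>

theorem proposition5p18:
  fixes n :: nat
    and \<sigma> :: "nat \<Rightarrow> nat"
    and A :: "nat \<Rightarrow> ('o, 'm) precat"
  assumes "n \<ge> 1"
    and "\<sigma> permutes {1..n}"
    and "\<And>i. i \<in> {1..n} \<Longrightarrow> precontextual (A i)"
  shows
    "(\<forall>C :: ('c, 'd) precat. contextual C \<longrightarrow>
        (\<forall>F\<in>Hom n (A \<circ> \<sigma>) C. \<exists>!F'. \<exists>\<phi>. shuffling_diagram n A \<sigma> C F F' \<phi>) \<and>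
        bij_betw (shuffle n A \<sigma> C) (Hom n (A \<circ> \<sigma>) C) (Hom n A C)) \<and>
     (\<forall>(C :: ('c, 'd) precat) (D :: ('e, 'f) precat) G.
        contextual C \<and> contextual D \<and> contextual_functor C D G \<longrightarrow>
        comp_ftr (prod_cat n (A \<circ> \<sigma>)) G ` Hom n (A \<circ> \<sigma>) C \<subseteq> Hom n (A \<circ> \<sigma>) D \<and>
        comp_ftr (prod_cat n A) G ` Hom n A C \<subseteq> Hom n A D \<and>
        (\<forall>F\<in>Hom n (A \<circ> \<sigma>) C.
           shuffle n A \<sigma> D (comp_ftr (prod_cat n (A \<circ> \<sigma>)) G F) =
           comp_ftr (prod_cat n A) G (shuffle n A \<sigma> C F))) \<and>
     (\<forall>(A' :: nat \<Rightarrow> ('p, 'q) precat) (U :: nat \<Rightarrow> ('p, 'q, 'o, 'm) ftr) (C :: ('c, 'd) precat).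
        (\<forall>i\<in>{1..n}. precontextual (A' i) \<and> contextual_functor (A' i) (A i) (U i)) \<and>
        contextual C \<longrightarrow>
        (\<lambda>F. comp_ftr (prod_cat n (A' \<circ> \<sigma>)) F (prod_ftr n (U \<circ> \<sigma>))) ` Hom n (A \<circ> \<sigma>) C
          \<subseteq> Hom n (A' \<circ> \<sigma>) C \<and>
        (\<lambda>F. comp_ftr (prod_cat n A') F (prod_ftr n U)) ` Hom n A C \<subseteq> Hom n A' C \<and>
        (\<forall>F\<in>Hom n (A \<circ> \<sigma>) C.
           shuffle n A' \<sigma> C (comp_ftr (prod_cat n (A' \<circ> \<sigma>)) F (prod_ftr n (U \<circ> \<sigma>))) =
           comp_ftr (prod_cat n A') (shuffle n A \<sigma> C F) (prod_ftr n U)))"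
proof -
  have fam: "permuted_family n A \<sigma>" using assms(2,3) by unfold_locales auto
  interpret permuted_family n A \<sigma> by (rule fam)
  show ?thesis
  proof (intro conjI allI impI ballI; (elim conjE)?)
    fix C :: "('c, 'd) precat" and F assume C: "contextual C" and F: "F \<in> Hom n (A \<circ> \<sigma>) C"
    then show "\<exists>!F'. \<exists>\<phi>. shuffling_diagram n A \<sigma> C F F' \<phi>"
      using ex1_shuffling_diagram[OF fam contextual_categoryI[OF C]] unfolding Hom_def by blast
  next
    fix C :: "('c, 'd) precat" assume "contextual C"
    then show "bij_betw (shuffle n A \<sigma> C) (Hom n (A \<circ> \<sigma>) C) (Hom n A C)"
      by (rule bij_betw_shuffle[OF fam])
  next
    fix C :: "('c, 'd) precat" and D :: "('e, 'f) precat" and G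
    assume C: "contextual C" and D: "contextual D" and G: "contextual_functor C D G"
    show "comp_ftr (prod_cat n (A \<circ> \<sigma>)) G ` Hom n (A \<circ> \<sigma>) C \<subseteq> Hom n (A \<circ> \<sigma>) D"
      using postcomposition.multimorphism_HF[OF postcompositionI[OF S.precontextual_family_axioms C D G]]
      unfolding Hom_def by blast
    show "comp_ftr (prod_cat n A) G ` Hom n A C \<subseteq> Hom n A D"
      using postcomposition.multimorphism_HF[OF postcompositionI[OF precontextual_family_axioms C D G]]
      unfolding Hom_def by blast
    fix F assume "F \<in> Hom n (A \<circ> \<sigma>) C"
    then obtain \<phi> where "shuffling_diagram n A \<sigma> C F (shuffle n A \<sigma> C F) \<phi>"
      by (rule shuffling_diagram_shuffle[OF fam C])
    from shuffle_eqI[OF fam D shuffling_diagram_postcomposition[OF fam C D G this]]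
    show "shuffle n A \<sigma> D (comp_ftr (prod_cat n (A \<circ> \<sigma>)) G F) =
        comp_ftr (prod_cat n A) G (shuffle n A \<sigma> C F)" .
  next
    fix A' :: "nat \<Rightarrow> ('p, 'q) precat" and U :: "nat \<Rightarrow> ('p, 'q, 'o, 'm) ftr" and C :: "('c, 'd) precat"
    assume U: "\<forall>i\<in>{1..n}. precontextual (A' i) \<and> contextual_functor (A' i) (A i) (U i)" and C: "contextual C"
    have pre': "precontextual_family n A'" using U by unfold_locales auto
    then have fam': "permuted_family n A' \<sigma>"
      using perm unfolding permuted_family_def permuted_family_axioms_def by blast
    interpret P': permuted_family n A' \<sigma> by (rule fam')
    have f: "family_functor n A' A U"
      using pre' precontextual_family_axioms U unfolding family_functor_def family_functor_axioms_def by blast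
    have f': "family_functor n (A' \<circ> \<sigma>) (A \<circ> \<sigma>) (U \<circ> \<sigma>)"
      using P'.S.precontextual_family_axioms S.precontextual_family_axioms U perm_in
      unfolding family_functor_def family_functor_axioms_def by auto
    show "(\<lambda>F. comp_ftr (prod_cat n (A' \<circ> \<sigma>)) F (prod_ftr n (U \<circ> \<sigma>))) ` Hom n (A \<circ> \<sigma>) C
        \<subseteq> Hom n (A' \<circ> \<sigma>) C"
      using precomposition.multimorphism_FU[OF precompositionI[OF f' C]] unfolding Hom_def by blast
    show "(\<lambda>F. comp_ftr (prod_cat n A') F (prod_ftr n U)) ` Hom n A C \<subseteq> Hom n A' C"
      using precomposition.multimorphism_FU[OF precompositionI[OF f C]] unfolding Hom_def by blast
    fix F assume "F \<in> Hom n (A \<circ> \<sigma>) C"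
    then obtain \<phi> where "shuffling_diagram n A \<sigma> C F (shuffle n A \<sigma> C F) \<phi>"
      by (rule shuffling_diagram_shuffle[OF fam C])
    from shuffle_eqI[OF fam' C shuffling_diagram_precomposition[OF f perm C this]]
    show "shuffle n A' \<sigma> C (comp_ftr (prod_cat n (A' \<circ> \<sigma>)) F (prod_ftr n (U \<circ> \<sigma>))) =
        comp_ftr (prod_cat n A') (shuffle n A \<sigma> C F) (prod_ftr n U)" .
  qed
qed

end
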